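(* Let $s\geq 1$, let $0\leq t_1\leq t_2$, and let $\phi$ be a smooth function on $[t_1,t_2]\times\mathbb{R}^3$ such that $\lim_{R\to\infty}\sup_{|x|=R}|x|^{s+1/2}|\phi(t_1,x)|=0$. Then there is a constant $C$ depending only on $s$ such that \[ \|\phi(t_1,\cdot)\|_{1,+,s-1}+\sup_{R>0}F_R^s(t_1,t_2)^{1/2}\leq C\Big(\|\phi(t_2,\cdot)\|_{1,+,s-1}+\int_{t_1}^{t_2}\big\|\langle t+|x|\rangle^s\,\Box\phi(t,\cdot)\big\|_{L^2(\mathbb{R}^3)}\,dt\Big). \] Moreover, for every $t\geq 0$ and every smooth $\phi$ defined near $\{t\}\times\mathbb{R}^3$ with $\lim_{R\to\infty}\sup_{|x|=R}|x|^{s+1/2}|\phi(t,x)|=0$, one has $\|\phi(t,\cdot)\|_{1,s-1}\leq C\|\phi(t,\cdot)\|_{1,+,s-1}$.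
   Context: Coordinates $(t,x)\in\mathbb{R}\times\mathbb{R}^3$, Minkowski metric $m=\mathrm{diag}(-1,1,1,1)$, $\Box=m^{\alpha\beta}\partial_\alpha\partial_\beta=-\partial_t^2+\Delta$. Write $r=|x|$, $\omega=x/|x|$, $\partial_r=\omega^i\partial_i$, $L=\partial_t+\partial_r$, $\underline L=\partial_t-\partial_r$, $\langle a\rangle=(1+a^2)^{1/2}$. The angular gradient is $\nabla\!\!\!/_i=\partial_i-\omega_i\omega^j\partial_j$, $|\nabla\!\!\!/\phi|^2=\sum_i|\nabla\!\!\!/_i\phi|^2$. The commuting vector fields $Z$ are: $\partial_t$, $\partial_i$, the rotations $x^i\partial_j-x^j\partial_i$, the boosts $x^i\partial_t+t\partial_i$, and the scaling $t\partial_t+x^i\partial_i$; $Z^I$ denotes a product of $|I|$ of them. Norms on the slice $\{t\}\times\mathbb{R}^3$: \[ \|\phi(t,\cdot)\|_{1,+,s-1}^2=\int_{\mathbb{R}^3}\Big[\langle t+r\rangle^{2s}\big(|L(r\phi)|^2+|\nabla\!\!\!/(r\phi)|^2\big)+\langle t-r\rangle^{2s}\Big(|\underline L(r\phi)|^2+\phi^2+\frac{(r\phi)^2}{\langle t-r\rangle^2}\Big)\Big]\frac{dx}{r^2}, \] \[ \|\phi(t,\cdot)\|_{1,s-1}=\sum_{|I|\leq1}\|\langle t-r\rangle^{s-1}(Z^I\phi)(t,\cdot)\|_{L^2(\mathbb{R}^3)}. \] For $R>0$ the flux through the outgoing null cone is \[ F_R^s(t_1,t_2)=\int_{t_1}^{t_2}\int_{|x|=R-(t_2-t)}\Big(\langle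 t+r\rangle^{2s}|L(r\phi)|^2+\langle t-r\rangle^{2s}|\nabla\!\!\!/(r\phi)|^2\Big)\,dS(\omega)\,dt, \] where $dS(\omega)$ is the standard measure on the unit sphere (in the variable $\omega$) and the inner integral is taken to be $0$ when $R-(t_2-t)<0$. *)

theory Defs
  imports "HOL-Analysis.Analysis"
begin

type_synonym stfun = "real \<Rightarrow> real^3 \<Rightarrow> real"

definition jp :: "real \<Rightarrow> real" where
  "jp a = sqrt (1 + a\<^sup>2)"

definition enn_sqrt :: "ennreal \<Rightarrow> ennreal" where
  "enn_sqrt v = (if v = top then top else ennreal (sqrt (enn2real v)))"

definition dt :: "stfun \<Rightarrow> stfun" where
  "dt f t x = deriv (\<lambda>\<tau>. f \<tau> x) t"

definition dx :: "3 \<Rightarrow> stfun \<Rightarrow> stfun" where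
  "dx i f t x = deriv (\<lambda>h. f t (x + h *\<^sub>R axis i 1)) 0"

fun pdw :: "3 option list \<Rightarrow> stfun \<Rightarrow> stfun" where
  "pdw [] f = f"
| "pdw (None # ds) f = dt (pdw ds f)"
| "pdw (Some i # ds) f = dx i (pdw ds f)"

definition smooth_on :: "(real \<times> (real^3)) set \<Rightarrow> stfun \<Rightarrow> bool" where
  "smooth_on U f \<longleftrightarrow> (\<forall>ds. continuous_on U (\<lambda>p. pdw ds f (fst p) (snd p)) \<and>
      (\<forall>p\<in>U. (\<lambda>q. pdw ds f (fst q) (snd q)) differentiable (at p)))"

definition omega :: "real^3 \<Rightarrow> real^3" where
  "omega x = x /\<^sub>R norm x"

definition grad :: "stfun \<Rightarrow> real \<Rightarrow> real^3 \<Rightarrow> real^3" where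
  "grad f t x = (\<chi> i. dx i f t x)"

definition dr :: "stfun \<Rightarrow> stfun" where
  "dr f t x = omega x \<bullet> grad f t x"

definition Lop :: "stfun \<Rightarrow> stfun" where
  "Lop f t x = dt f t x + dr f t x"

definition Lbar :: "stfun \<Rightarrow> stfun" where
  "Lbar f t x = dt f t x - dr f t x"

definition angrad :: "stfun \<Rightarrow> real \<Rightarrow> real^3 \<Rightarrow> real^3" where
  "angrad f t x = grad f t x - (omega x \<bullet> grad f t x) *\<^sub>R omega x"

definition rphi :: "stfun \<Rightarrow> stfun" where
  "rphi f t x = norm x * f t x"

definition box :: "stfun \<Rightarrow> stfun" where
  "box f t x = - dt (dt f) t x + (\<Sum>i\<in>UNIV. dx i (dx i f) t x)"

definition L2norm :: "(real^3 \<Rightarrow> real) \<Rightarrow> ennreal" where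
  "L2norm g = enn_sqrt (\<integral>\<^sup>+ x. ennreal ((g x)\<^sup>2) \<partial>lborel)"

definition normplus :: "real \<Rightarrow> stfun \<Rightarrow> real \<Rightarrow> ennreal" where
  "normplus s f t = enn_sqrt (\<integral>\<^sup>+ x. ennreal (
      (jp (t + norm x) powr (2 * s) * ((Lop (rphi f) t x)\<^sup>2 + (norm (angrad (rphi f) t x))\<^sup>2)
     + jp (t - norm x) powr (2 * s) * ((Lbar (rphi f) t x)\<^sup>2 + (f t x)\<^sup>2
          + (rphi f t x)\<^sup>2 / (jp (t - norm x))\<^sup>2)) / (norm x)\<^sup>2) \<partial>lborel)"

definition rot :: "3 \<Rightarrow> 3 \<Rightarrow> stfun \<Rightarrow> stfun" where
  "rot i j f t x = x $ i * dx j f t x - x $ j * dx i f t x"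

definition boost :: "3 \<Rightarrow> stfun \<Rightarrow> stfun" where
  "boost i f t x = x $ i * dt f t x + t * dx i f t x"

definition scal :: "stfun \<Rightarrow> stfun" where
  "scal f t x = t * dt f t x + (\<Sum>i\<in>UNIV. x $ i * dx i f t x)"

text \<open>All Z^I with |I| <= 1 (coordinates are indexed 1,2,3 in type 3).\<close>
definition Zops :: "(stfun \<Rightarrow> stfun) list" where
  "Zops = [id, dt, dx 1, dx 2, dx 3, rot 1 2, rot 1 3, rot 2 3,
           boost 1, boost 2, boost 3, scal]"

definition normZ :: "real \<Rightarrow> stfun \<Rightarrow> real \<Rightarrow> ennreal" where
  "normZ s f t = sum_list (map (\<lambda>Z. L2norm (\<lambda>x. jp (t - norm x) powr (s - 1) * Z f t x)) Zops)"

definition sph :: "real \<Rightarrow> real \<Rightarrow> real^3" where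
  "sph \<theta> \<phi> = vector [sin \<theta> * cos \<phi>, sin \<theta> * sin \<phi>, cos \<theta>]"

definition sphint :: "(real^3 \<Rightarrow> ennreal) \<Rightarrow> ennreal" where
  "sphint g = (\<integral>\<^sup>+ \<theta>\<in>{0..pi}. (\<integral>\<^sup>+ \<phi>\<in>{0..2 * pi}. g (sph \<theta> \<phi>) * ennreal (sin \<theta>) \<partial>lborel) \<partial>lborel)"

definition flux :: "real \<Rightarrow> stfun \<Rightarrow> real \<Rightarrow> real \<Rightarrow> real \<Rightarrow> ennreal" where
  "flux s f R t1 t2 = (\<integral>\<^sup>+ t\<in>{t1..t2}.
     (if R - (t2 - t) < 0 then 0 else
       sphint (\<lambda>w. let x = (R - (t2 - t)) *\<^sub>R w in
         ennreal (jp (t + norm x) powr (2 * s) * (Lop (rphi f) t x)\<^sup>2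
                + jp (t - norm x) powr (2 * s) * (norm (angrad (rphi f) t x))\<^sup>2))) \<partial>lborel)"

definition decay :: "real \<Rightarrow> stfun \<Rightarrow> real \<Rightarrow> bool" where
  "decay s f t \<longleftrightarrow> ((\<lambda>R. SUP x\<in>sphere 0 R. norm x powr (s + 1/2) * \<bar>f t x\<bar>) \<longlongrightarrow> 0) at_top"

end

theory Submission
  imports Defs
begin

text \<open>
  With \<open>\<psi> = r\<phi>\<close>, \<open>u = t - r\<close>, \<open>v = t + r\<close> the wave operator becomes \<open>r\<box>\<phi> = - LL\<^sub>-\<psi> + \<Delta>\<^sub>S\<psi>/r\<^sup>2\<close>, and
  the multiplier \<open>\<langle>v\<rangle>\<^sup>2\<^sup>s L\<psi> + \<langle>u\<rangle>\<^sup>2\<^sup>s L\<^sub>-\<psi>\<close> yields an energy identity whose only bulk term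
  without \<open>\<box>\<phi>\<close> is the squared angular gradient of \<open>\<psi>\<close> times the error of the trapezoidal rule
  for the weight \<open>\<langle>\<cdot>\<rangle>\<^sup>2\<^sup>s\<close> on \<open>[u, v]\<close>. For \<open>s \<ge> 1\<close> and \<open>t \<ge> 0\<close> that error has a sign, favourable for estimates backwards in time.
  Integrating over \<open>r \<le> R - (t\<^sub>2 - t)\<close>, a region bounded by an outgoing cone, controls the energy at
  the earlier time and the flux at once, with finite energies for every \<open>R\<close>. The zeroth order terms
  of the norm at \<open>t\<^sub>1\<close> follow from a weighted Hardy inequality, whose boundary term at infinity vanishes
  by the decay assumption. The bound of the \<open>Z\<close> norm holds pointwise under the integral.
\<close>

subsection \<open>Spherical coordinates\<close>

text \<open>The obstacle is the angular term: the sphere has no global coordinates, and polar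
  coordinates degenerate at r = 0. Both are avoided by letting (r, w) range over all of R and R^3,
  where \<open>Lpsi\<close>, \<open>Lbarpsi\<close> and the cross product of w with grad f are
  smooth; only averages over |w| = 1 are ever taken. The components of that cross product are
  rotation derivatives, and rotations preserve the sphere, so integration by parts on it reduces to
  three explicit identities in the angles. What remains is a transport inequality in (t, r). The
  source is paired with the multiplier by Cauchy-Schwarz, and the resulting square root of the
  energy is absorbed at the time where the truncated energy is largest; hence the inequality is
  proved from every intermediate time \<tau> up to t2. The energy contains only derivatives of
  \<psi>: at t2 twice the squared norm dominates it, whereas at t1 the squared norm is recovered
  from it at the cost 16 s^2 + 7.\<close>

definition smean :: "(real^3 \<Rightarrow> real) \<Rightarrow> real" where
  "smean F = integral (cbox (0, 0) (pi, 2 * pi)) (\<lambda>y. F (sph (fst y) (snd y)) * sin (fst y))"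

lemma sph_nth [simp]: "sph a b $ 1 = sin a * cos b" "sph a b $ 2 = sin a * sin b" "sph a b $ 3 = cos a"
  by (simp_all add: sph_def)

lemma norm_sph [simp]: "norm (sph a b) = 1"
proof -
  have "(sin a * cos b)\<^sup>2 + (sin a * sin b)\<^sup>2 + (cos a)\<^sup>2 = (sin a)\<^sup>2 * ((sin b)\<^sup>2 + (cos b)\<^sup>2) + (cos a)\<^sup>2"
    by (simp only: power_mult_distrib distrib_left mult.commute)
  also have "\<dots> = 1" by simp
  finally show ?thesis
    by (simp add: norm_eq_1 inner_vec_def sum_3 power2_eq_square)
qed

lemma continuous_on_sph [continuous_intros]:
  fixes f g :: "'a::t2_space \<Rightarrow> real"
  assumes "continuous_on S f" "continuous_on S g"
  shows "continuous_on S (\<lambda>x. sph (f x) (g x))"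
proof -
  have "continuous_on S (\<lambda>x. \<chi> k. sph (f x) (g x) $ k)"
  proof (rule continuous_on_vec_lambda)
    show "continuous_on S (\<lambda>x. sph (f x) (g x) $ k)" for k :: 3
      using exhaust_3[of k]
      by (elim disjE; simp only: sph_nth) (intro continuous_intros assms)+
  qed
  then show ?thesis by simp
qed

text \<open>The change of variables is carried out on \<open>real^3\<close>, Fubini on the nested
  product. Box volumes must agree before integrals can be moved between the two types.\<close>

lemma content_cbox_cart3:
  "measure lborel (cbox u v :: (real^3) set) = measure lborel (cbox (u$1, u$2, u$3) (v$1, v$2, v$3))"
proof (cases "cbox u v = {}")
  case True
  then obtain i where i: "v $ i < u $ i" by (auto simp: interval_eq_empty_cart)
  then have "v $ 1 < u $ 1 \<or> v $ 2 < u $ 2 \<or> v $ 3 < u $ 3" using exhaust_3[of i] by auto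
  then have "cbox (u$1, u$2, u$3) (v$1, v$2, v$3) = {}" by (auto simp: cbox_Pair_eq)
  then show ?thesis using True by simp
next
  case False
  then have *: "u $ i \<le> v $ i" for i by (auto simp: interval_eq_empty_cart not_less)
  have "(\<Prod>i\<in>UNIV. v$i - u$i) = (v$1 - u$1) * ((v$2 - u$2) * (v$3 - u$3))"
    unfolding UNIV_3 by (simp add: ac_simps)
  moreover have "measure lborel (cbox (u$i) (v$i)) = v$i - u$i" for i
    using *[of i] by simp
  ultimately show ?thesis
    by (simp only: content_cbox_cart[OF False] content_Pair)
qed

lemma vector3_collapse: "vector [x$1, x$2, x$3] = (x :: real^3)"
  by (simp add: vec_eq_iff forall_3)

lemma image_coords_cbox:
  "(\<lambda>y::real^3. (y$1, y$2, y$3)) ` cbox u v = cbox (u$1, u$2, u$3) (v$1, v$2, v$3)" (is "?g ` _ = _")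
proof (intro subset_antisym subsetI)
  fix z assume "z \<in> cbox (u$1, u$2, u$3) (v$1, v$2, v$3)"
  then have "vector [fst z, fst (snd z), snd (snd z)] \<in> cbox u v"
    by (cases z) (auto simp: mem_box_cart cbox_Pair_eq forall_3)
  moreover have "z = ?g (vector [fst z, fst (snd z), snd (snd z)])" by simp
  ultimately show "z \<in> ?g ` cbox u v" by blast
qed (auto simp: mem_box_cart cbox_Pair_eq)

lemma image_vector3_cbox:
  "(\<lambda>z. vector [fst z, fst (snd z), snd (snd z)] :: real^3) ` cbox (a, b, c) (a', b', c') =
    cbox (vector [a, b, c]) (vector [a', b', c'])" (is "?h ` _ = _")
proof -
  have "cbox (a, b, c) (a', b', c') = (\<lambda>y::real^3. (y$1, y$2, y$3)) ` cbox (vector [a, b, c]) (vector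
      [a', b', c'])"
    by (simp add: image_coords_cbox)
  then show ?thesis by (simp add: image_image vector3_collapse)
qed

lemma has_integral_vector3:
  fixes f :: "real \<times> real \<times> real \<Rightarrow> real"
  assumes "(f has_integral i) (cbox (a, b, c) (a', b', c'))"
  shows "((\<lambda>y::real^3. f (y$1, y$2, y$3)) has_integral i) (cbox (vector [a, b, c]) (vector [a', b', c']))"
proof -
  have "((\<lambda>y::real^3. f (y$1, y$2, y$3)) has_integral (1/1) *\<^sub>R i)
     ((\<lambda>z. vector [fst z, fst (snd z), snd (snd z)]) ` cbox (a, b, c) (a', b', c'))"
  proof (rule has_integral_twiddle)
    show "continuous (at x) (\<lambda>y::real^3. (y$1, y$2, y$3))" for x
      by (intro continuous_intros)
    show "\<exists>w z. (\<lambda>y::real^3. (y$1, y$2, y$3)) ` cbox u v = cbox w z" for u v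
      using image_coords_cbox by blast
    show "\<exists>w z. (\<lambda>z. vector [fst z, fst (snd z), snd (snd z)] :: real^3) ` cbox u v = cbox w z" for u v
      by (cases u; cases v) (auto simp: image_vector3_cbox)
    show "measure lborel ((\<lambda>y::real^3. (y$1, y$2, y$3)) ` cbox u v) = 1 * measure lborel (cbox u v)" for u v
      by (simp add: image_coords_cbox content_cbox_cart3)
  qed (use assms in \<open>auto simp: vector3_collapse\<close>)
  then show ?thesis by (simp add: image_vector3_cbox)
qed

lemma smean_cont:
  fixes F :: "'a::metric_space \<Rightarrow> real^3 \<Rightarrow> real"
  assumes "continuous_on (S \<times> UNIV) (\<lambda>p. F (fst p) (snd p))"
  shows "continuous_on S (\<lambda>x. smean (F x))"
  unfolding smean_def
proof (rule integral_continuous_on_param)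
  show "continuous_on (S \<times> cbox (0, 0) (pi, 2 * pi)) (\<lambda>(x, t). F x (sph (fst t) (snd t)) * sin (fst t))"
    unfolding split_beta
    by (intro continuous_intros continuous_on_compose2[OF assms, where f="\<lambda>x. (fst x, sph (fst (snd x))
        (snd (snd x)))", unfolded fst_conv snd_conv])
       (auto intro!: continuous_intros)
qed

section \<open>Polar coordinates as a change of variables\<close>

definition pol :: "real^3 \<Rightarrow> real^3" where
  "pol y = y$1 *\<^sub>R sph (y$2) (y$3)"

definition pol' :: "real^3 \<Rightarrow> real^3 \<Rightarrow> real^3" where
  "pol' y h = vector
    [sin (y$2) * cos (y$3) * h$1 + y$1 * cos (y$2) * cos (y$3) * h$2 - y$1 * sin (y$2) * sin (y$3) * h$3,
     sin (y$2) * sin (y$3) * h$1 + y$1 * cos (y$2) * sin (y$3) * h$2 + y$1 * sin (y$2) * cos (y$3) * h$3,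
     cos (y$2) * h$1 - y$1 * sin (y$2) * h$2]"

lemma pol_has_derivative: "(pol has_derivative pol' y) (at y within S)"
  unfolding has_derivative_componentwise_within[of pol]
proof
  fix i :: "real^3" assume "i \<in> Basis"
  then obtain k where i: "i = axis k 1" by (auto simp: Basis_vec_def)
  have "((\<lambda>y. pol y $ k) has_derivative (\<lambda>h. pol' y h $ k)) (at y within S)"
    using exhaust_3[of k]
    by (auto simp: pol_def pol'_def fun_eq_iff algebra_simps intro!: derivative_eq_intros
        bounded_linear_imp_has_derivative[OF bounded_linear_vec_nth])
  then show "((\<lambda>x. pol x \<bullet> i) has_derivative (\<lambda>x. pol' y x \<bullet> i)) (at y within S)"
    by (simp add: i inner_axis)
qed

lemma det_pol': "det (matrix (pol' y)) = (y$1)\<^sup>2 * sin (y$2)"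
proof -
  define S C s c r where "S = sin (y$2)" and "C = cos (y$2)" and "s = sin (y$3)" and "c = cos (y$3)" and
      "r = y$1"
  have M: "matrix (pol' y) = vector [vector [S * c, r * C * c, - (r * S * s)],
      vector [S * s, r * C * s, r * S * c], vector [C, - (r * S), 0]]"
    unfolding vec_eq_iff forall_3 matrix_def pol'_def S_def C_def s_def c_def r_def by (simp add: axis_def)
  have "det (matrix (pol' y)) = r\<^sup>2 * S * ((S\<^sup>2 + C\<^sup>2) * (s\<^sup>2 + c\<^sup>2))"
    unfolding M det_3 vector_3 by (simp add: power2_eq_square algebra_simps)
  also have "(S\<^sup>2 + C\<^sup>2) * (s\<^sup>2 + c\<^sup>2) = 1" by (simp add: S_def C_def s_def c_def)
  finally show ?thesis by (simp add: S_def r_def)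
qed

text \<open>The norm gives the radius, injectivity of cos on [0, pi] the polar angle. As its sine is
  nonzero, sin and cos of the azimuth are then known, and the open range excludes a full
  turn.\<close>

lemma pol_cong_imp:
  assumes "pol y = pol z" "0 < y$1" "0 < z$1" "0 < y$2" "y$2 < pi" "0 < z$2" "z$2 < pi"
    "0 < y$3" "y$3 < 2 * pi" "0 < z$3" "z$3 < 2 * pi"
  shows "y = z"
proof -
  have 1: "y$1 = z$1"
    using arg_cong[OF assms(1), of norm] assms(2,3) by (simp add: pol_def)
  then have s: "sph (y$2) (y$3) = sph (z$2) (z$3)"
    using assms(1,2) by (simp add: pol_def)
  have 2: "y$2 = z$2"
    using arg_cong[OF s, of "\<lambda>v. v$3"] assms(4-7) by (auto intro: cos_inj_pi)
  have "sin (y$2) > 0" using assms(4,5) sin_gt_zero by blast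
  then have c: "cos (y$3) = cos (z$3)" "sin (y$3) = sin (z$3)"
    using arg_cong[OF s, of "\<lambda>v. v$1"] arg_cong[OF s, of "\<lambda>v. v$2"] 2 by auto
  then obtain n :: int where n: "y$3 = z$3 + 2 * pi * n"
    using sin_cos_eq_iff[of "y$3" "z$3"] by auto
  have "\<bar>2 * pi * n\<bar> < 2 * pi" using n assms(8-11) by linarith
  then have "\<bar>real_of_int n\<bar> < 1" by (simp add: abs_mult)
  then have "n = 0" by linarith
  with n 1 2 show ?thesis by (simp add: vec_eq_iff forall_3)
qed

text \<open>The open coordinate box misses the axis and the half plane of azimuth 0. Both lie in the
  plane \<open>x$2 = 0\<close>, a null set, so it is simplest to exclude that whole plane.\<close>

lemma pol_surj:
  assumes "x$2 \<noteq> 0" "norm x < b"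
  shows "\<exists>y \<in> Topology_Euclidean_Space.box (vector [0,0,0]) (vector [b, pi, 2 * pi]). pol y = (x::real^3)"
proof -
  define r where "r = norm x"
  define \<rho> where "\<rho> = sqrt ((x$1)\<^sup>2 + (x$2)\<^sup>2)"
  have \<rho>: "\<rho> > 0" "\<rho>\<^sup>2 = (x$1)\<^sup>2 + (x$2)\<^sup>2"
    using assms(1) by (auto simp: \<rho>_def add_nonneg_pos)
  have r2: "r\<^sup>2 = (x$1)\<^sup>2 + (x$2)\<^sup>2 + (x$3)\<^sup>2"
    unfolding r_def power2_norm_eq_inner inner_vec_def by (simp add: sum_3 power2_eq_square)
  have r: "r > 0" using assms(1) by (auto simp: r_def)
  have "(x$3)\<^sup>2 < r\<^sup>2" using r2 \<rho> zero_less_power[OF \<rho>(1), of 2] by linarith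
  then have "(x$3 / r)\<^sup>2 < 1" using r by (simp add: power_divide)
  then have lt: "\<bar>x$3 / r\<bar> < 1" by (simp add: abs_square_less_1)
  define \<theta> where "\<theta> = arccos (x$3 / r)"
  have \<theta>: "0 < \<theta>" "\<theta> < pi" "cos \<theta> = x$3 / r"
    unfolding \<theta>_def using arccos_lt_bounded[of "x$3/r"] cos_arccos_abs[of "x$3/r"] lt[unfolded
        abs_less_iff] lt
    by linarith+
  have st: "sin \<theta> = \<rho> / r"
  proof -
    have "(sin \<theta>)\<^sup>2 = (r\<^sup>2 - (x$3)\<^sup>2) / r\<^sup>2"
      using \<theta>(3) r by (simp add: sin_squared_eq power_divide diff_divide_distrib)
    then have "(sin \<theta>)\<^sup>2 = (\<rho> / r)\<^sup>2"
      using r2 \<rho> by (simp add: power_divide)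
    moreover have "sin \<theta> > 0" using \<theta> sin_gt_zero by blast
    ultimately show ?thesis using \<rho> r by (simp add: power2_eq_iff_nonneg)
  qed
  have "(x$1 / \<rho>)\<^sup>2 + (x$2 / \<rho>)\<^sup>2 = \<rho>\<^sup>2 / \<rho>\<^sup>2"
    by (simp only: \<rho>(2) power_divide add_divide_distrib)
  also have "\<dots> = 1" using \<rho>(1) by simp
  finally have "(x$1 / \<rho>)\<^sup>2 + (x$2 / \<rho>)\<^sup>2 = 1" .
  then obtain p where p: "0 \<le> p" "p < 2 * pi" "x$1 / \<rho> = cos p" "x$2 / \<rho> = sin p"
    using sincos_total_2pi by metis
  have "p \<noteq> 0" using p(4) assms(1) \<rho> by auto
  then have "vector [r, \<theta>, p] \<in> Topology_Euclidean_Space.box (vector [0,0,0]) (vector [b, pi, 2 * pi] ::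
      real^3)"
    using p \<theta> r assms(2) by (simp add: mem_box_cart forall_3 r_def)
  moreover have "pol (vector [r, \<theta>, p]) = x"
    using \<theta>(3) st p(3,4)[symmetric] \<rho> r by (simp add: pol_def vec_eq_iff forall_3)
  ultimately show ?thesis by blast
qed

text \<open>The weight r^(-2) of the norm cancels the Jacobian r^2 sin \<theta>. The transformed
  integrand is continuous on a closed box, so integrability is immediate even though the original
  integrand may be unbounded at the origin.\<close>

lemma polar_has_integral:
  fixes F :: "real \<Rightarrow> real^3 \<Rightarrow> real"
  assumes F: "continuous_on UNIV (\<lambda>p. F (fst p) (snd p))" and b: "0 < b"
  shows "((\<lambda>x. F (norm x) (omega x) / (norm x)\<^sup>2) has_integral integral {0..b} (\<lambda>r. smean (F r))) (ball
      0 b)"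
proof -
  define S where "S = Topology_Euclidean_Space.box (vector [0,0,0]) (vector [b, pi, 2 * pi] :: real^3)"
  define f where "f = (\<lambda>z. F (fst z) (sph (fst (snd z)) (snd (snd z))) * sin (fst (snd z)))"
  define H where "H = (\<lambda>x::real^3. F (norm x) (omega x) / (norm x)\<^sup>2)"
  let ?J = "integral {0..b} (\<lambda>r. smean (F r))"
  have cf: "continuous_on UNIV f"
    unfolding f_def
    by (intro continuous_intros continuous_on_compose2[OF F, where f="\<lambda>z. (fst z, sph (fst (snd z)) (snd
        (snd z)))", unfolded fst_conv snd_conv]) auto
  have "integral (cbox (0, 0, 0) (b, pi, 2 * pi)) f = ?J"
    by (subst integral_prod_continuous[OF continuous_on_subset[OF cf]]) (simp_all add: f_def smean_def)
  then have "(f has_integral ?J) (cbox (0, 0, 0) (b, pi, 2 * pi))"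
    using integrable_continuous[OF continuous_on_subset[OF cf]] by (metis has_integral_integral subset_UNIV)
  from has_integral_vector3[OF this]
  have "((\<lambda>y::real^3. f (y$1, y$2, y$3)) has_integral ?J) (cbox (vector [0,0,0]) (vector [b, pi, 2 *
      pi]))" .
  then have I1: "((\<lambda>y::real^3. f (y$1, y$2, y$3)) has_integral ?J) S"
    using has_integral_open_interval unfolding S_def by blast
  have "(\<lambda>y::real^3. f (y$1, y$2, y$3)) absolutely_integrable_on cbox (vector [0,0,0]) (vector [b, pi, 2
      * pi])"
    by (intro absolutely_integrable_continuous continuous_on_compose2[OF cf]) (auto intro!:
        continuous_intros)
  then have I2: "(\<lambda>y::real^3. f (y$1, y$2, y$3)) absolutely_integrable_on S"
    by (rule set_integrable_subset) (auto simp: S_def box_subset_cbox)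
  have Sb: "y$1 > 0 \<and> y$1 < b \<and> y$2 > 0 \<and> y$2 < pi \<and> y$3 > 0 \<and> y$3 < 2 * pi" if "y \<in> S" for y
    using that by (auto simp: S_def mem_box_cart forall_3)
  have eq: "\<bar>det (matrix (pol' y))\<bar> * H (pol y) = f (y$1, y$2, y$3)" if "y \<in> S" for y
    using Sb[OF that] sin_gt_zero[of "y$2"] 
    by (simp add: det_pol' H_def f_def pol_def omega_def abs_mult)
  have inj: "inj_on pol S"
    by (rule inj_onI, rule pol_cong_imp) (use Sb in blast)+
  have SL: "S \<in> sets lebesgue" by (simp add: S_def)
  \<comment> \<open>The change of variables theorem speaks of vector valued functions; a real
    function enters it as one with values in \<open>real^1\<close>.\<close>
  have a1: "(\<lambda>y. \<bar>det (matrix (pol' y))\<bar> *\<^sub>R (vec (H (pol y)) :: real^1)) absolutely_integrable_on S"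
    unfolding absolutely_integrable_on_1_iff
    using I2 eq by (subst set_integrable_cong[OF refl refl, where f'="\<lambda>y. f (y$1, y$2, y$3)"]) auto
  have a2: "integral S (\<lambda>y. \<bar>det (matrix (pol' y))\<bar> *\<^sub>R (vec (H (pol y)) :: real^1)) = vec ?J"
    unfolding integral_on_1_eq using integral_unique[OF I1] eq 
    by (simp cong: integral_cong)
  have "(\<lambda>x. vec (H x) :: real^1) absolutely_integrable_on (pol ` S) \<and> integral (pol ` S) (\<lambda>x. vec (H x)
      :: real^1) = vec ?J"
    using has_absolute_integral_change_of_variables[OF SL pol_has_derivative inj, of "\<lambda>x. vec (H x) ::
        real^1" "vec ?J"] a1 a2
    by blast
  then have "H absolutely_integrable_on (pol ` S)" "integral (pol ` S) H = ?J"
    unfolding absolutely_integrable_on_1_iff integral_on_1_eq by (simp_all add: vec_eq_iff)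
  then have hi: "(H has_integral ?J) (pol ` S)"
    using has_integral_iff set_lebesgue_integral_eq_integral(1) by blast
  have sub: "pol ` S \<subseteq> ball 0 b"
    using Sb by (fastforce simp: pol_def)
  have "ball 0 b - pol ` S \<subseteq> {x. x$2 = 0}"
    using pol_surj[of _ b] unfolding S_def by fastforce
  then have neg: "negligible (ball 0 b - pol ` S)"
    using negligible_standard_hyperplane_cart negligible_subset by blast
  show ?thesis
    unfolding H_def[symmetric]
    proof (rule iffD1[OF has_integral_spike_set_eq hi])
    show "negligible {x \<in> pol ` S - ball 0 b. H x \<noteq> 0}"
      using sub by (intro negligible_subset[OF negligible_empty]) blast
    show "negligible {x \<in> ball 0 b - pol ` S. H x \<noteq> 0}"
      by (rule negligible_subset[OF neg]) auto
  qed
qed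

lemma polar_nn_integral:
  fixes F :: "real \<Rightarrow> real^3 \<Rightarrow> real"
  assumes "continuous_on UNIV (\<lambda>p. F (fst p) (snd p))" and "0 < b"
    and "\<And>r w. 0 \<le> F r w"
  shows "(\<integral>\<^sup>+ x. ennreal (F (norm x) (omega x) / (norm x)\<^sup>2) * indicator (ball 0 b) x \<partial>lborel)
    = ennreal (integral {0..b} (\<lambda>r. smean (F r)))"
  by (rule nn_integral_has_integral_lebesgue'[OF _ polar_has_integral]) (use assms in auto)

subsection \<open>Smooth functions\<close>

lemma mixed_directional_derivatives:
  fixes g gu gv guv gvu :: "'a::real_normed_vector \<Rightarrow> real"
  assumes "open U" "p \<in> U"
    and gu: "\<And>q. q \<in> U \<Longrightarrow> ((\<lambda>a. g (q + a *\<^sub>R u)) has_field_derivative gu q) (at 0)"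
    and gv: "\<And>q. q \<in> U \<Longrightarrow> ((\<lambda>a. g (q + a *\<^sub>R v)) has_field_derivative gv q) (at 0)"
    and guv: "\<And>q. q \<in> U \<Longrightarrow> ((\<lambda>a. gu (q + a *\<^sub>R v)) has_field_derivative guv q) (at 0)"
    and gvu: "\<And>q. q \<in> U \<Longrightarrow> ((\<lambda>a. gv (q + a *\<^sub>R u)) has_field_derivative gvu q) (at 0)"
    and cont: "continuous_on U guv" "continuous_on U gvu"
  shows "guv p = gvu p"
proof (rule ccontr)
  assume ne: "guv p \<noteq> gvu p"
  \<comment> \<open>Half of the gap: values closer than e to \<open>guv p\<close> and to
    \<open>gvu p\<close> respectively cannot coincide.\<close>
  define e where "e = \<bar>guv p - gvu p\<bar> / 2"
  have e: "e > 0" using ne by (simp add: e_def)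
  define V where "V = {q \<in> U. \<bar>guv q - guv p\<bar> < e \<and> \<bar>gvu q - gvu p\<bar> < e}"
  have "isCont guv p" "isCont gvu p"
    using cont assms(1,2) continuous_on_eq_continuous_at by blast+
  then have ev: "\<forall>\<^sub>F q in nhds p. \<bar>guv q - guv p\<bar> < e" "\<forall>\<^sub>F q in nhds p. \<bar>gvu q - gvu p\<bar> < e"
    using e unfolding isCont_def tendsto_iff dist_real_def
    by (auto simp: eventually_nhds_conv_at elim: eventually_mono)
  have "\<forall>\<^sub>F q in nhds p. q \<in> V"
    using eventually_conj[OF eventually_nhds_in_open[OF assms(1,2)] eventually_conj[OF ev]]
    by (simp add: V_def)
  then obtain d where d: "d > 0" "\<And>q. dist q p < d \<Longrightarrow> q \<in> V"
    unfolding eventually_nhds_metric by blast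
  define h where "h = d / (2 * (norm u + norm v + 1))"
  have h: "h > 0" using d by (simp add: h_def add_nonneg_pos)
  have inV: "p + x *\<^sub>R u + y *\<^sub>R v \<in> V" if "0 \<le> x" "x \<le> h" "0 \<le> y" "y \<le> h" for x y
  proof (rule d(2))
    have "dist (p + x *\<^sub>R u + y *\<^sub>R v) p \<le> x * norm u + y * norm v"
      using norm_triangle_ineq[of "x *\<^sub>R u" "y *\<^sub>R v"] that by (simp add: dist_norm)
    also have "\<dots> \<le> h * norm u + h * norm v"
      using that by (intro add_mono mult_right_mono) auto
    also have "\<dots> \<le> h * (norm u + norm v + 1)"
      using h by (simp add: algebra_simps)
    also have "\<dots> = d / 2"
      using add_nonneg_pos[of "norm u + norm v" 1] by (simp add: h_def field_simps)
    also have "\<dots> < d" using d by simp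
    finally show "dist (p + x *\<^sub>R u + y *\<^sub>R v) p < d" .
  qed
  then have inU: "p + x *\<^sub>R u + y *\<^sub>R v \<in> U" if "0 \<le> x" "x \<le> h" "0 \<le> y" "y \<le> h" for x y
    using that by (auto simp: V_def)
  have shift: "((\<lambda>a. k (q + a *\<^sub>R w)) has_field_derivative k' (q + x *\<^sub>R w)) (at x)"
    if "((\<lambda>a. k ((q + x *\<^sub>R w) + a *\<^sub>R w)) has_field_derivative k' (q + x *\<^sub>R w)) (at 0)"
    for k k' :: "'a \<Rightarrow> real" and q w x
  proof -
    have "((\<lambda>a. k (q + (x + a) *\<^sub>R w)) has_field_derivative k' (q + x *\<^sub>R w)) (at 0)"
      using that by (simp add: scaleR_add_left add.assoc)
    then show ?thesis
      using DERIV_shift[of "\<lambda>a. k (q + a *\<^sub>R w)" _ 0 x] by (simp add: add.commute)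
  qed
  define G where "G x y = g (p + x *\<^sub>R u + y *\<^sub>R v)" for x y
  have comm: "p + x *\<^sub>R u + y *\<^sub>R v = p + y *\<^sub>R v + x *\<^sub>R u" for x y by simp
  have Gx: "((\<lambda>x. G x y) has_field_derivative gu (p + x *\<^sub>R u + y *\<^sub>R v)) (at x)"
    if "0 \<le> x" "x \<le> h" "0 \<le> y" "y \<le> h" for x y
    unfolding G_def comm using shift[of g "p + y *\<^sub>R v" x u gu] gu inU[OF that] by (simp add: comm)
  have Gy: "((\<lambda>y. G x y) has_field_derivative gv (p + x *\<^sub>R u + y *\<^sub>R v)) (at y)"
    if "0 \<le> x" "x \<le> h" "0 \<le> y" "y \<le> h" for x y
    unfolding G_def using shift[of g "p + x *\<^sub>R u" y v gv] gv inU[OF that] by simp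
  have Gxy: "((\<lambda>y. gu (p + x *\<^sub>R u + y *\<^sub>R v)) has_field_derivative guv (p + x *\<^sub>R u + y *\<^sub>R v)) (at y)"
    if "0 \<le> x" "x \<le> h" "0 \<le> y" "y \<le> h" for x y
    using shift[of gu "p + x *\<^sub>R u" y v guv] guv inU[OF that] by simp
  have Gyx: "((\<lambda>x. gv (p + x *\<^sub>R u + y *\<^sub>R v)) has_field_derivative gvu (p + x *\<^sub>R u + y *\<^sub>R v)) (at x)"
    if "0 \<le> x" "x \<le> h" "0 \<le> y" "y \<le> h" for x y
    unfolding comm using shift[of gv "p + y *\<^sub>R v" x u gvu] gvu inU[OF that] by (simp add: comm)
  \<comment> \<open>The second difference over the parallelogram. Two mean value steps, taken in
    either order, write it as h^2 times a value of \<open>guv\<close> and as h^2 times a value of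
    \<open>gvu\<close>, both attained in V.\<close>
  define D where "D = G h h - G h 0 - G 0 h + G 0 0"
  obtain x where x: "0 < x" "x < h" "D = h * (gu (p + x *\<^sub>R u + h *\<^sub>R v) - gu (p + x *\<^sub>R u + 0 *\<^sub>R v))"
  proof -
    have "\<exists>z. 0 < z \<and> z < h \<and> (G h h - G h 0) - (G 0 h - G 0 0) = (h - 0) * (gu (p + z *\<^sub>R u + h *\<^sub>R v)
        - gu (p + z *\<^sub>R u + 0 *\<^sub>R v))"
      by (rule MVT2[of 0 h "\<lambda>x. G x h - G x 0"]) (use h in \<open>auto intro!: DERIV_diff Gx[of _ 0,
          simplified] Gx\<close>)
    then show thesis using that unfolding D_def by (auto simp: algebra_simps)
  qed
  obtain y where y: "0 < y" "y < h" "gu (p + x *\<^sub>R u + h *\<^sub>R v) - gu (p + x *\<^sub>R u + 0 *\<^sub>R v) = h * guv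
      (p + x *\<^sub>R u + y *\<^sub>R v)"
    using MVT2[of 0 h "\<lambda>y. gu (p + x *\<^sub>R u + y *\<^sub>R v)" "\<lambda>y. guv (p + x *\<^sub>R u + y *\<^sub>R v)"] h x Gxy by auto
  obtain y' where y': "0 < y'" "y' < h" "D = h * (gv (p + h *\<^sub>R u + y' *\<^sub>R v) - gv (p + 0 *\<^sub>R u + y' *\<^sub>R
      v))"
  proof -
    have "\<exists>z. 0 < z \<and> z < h \<and> (G h h - G 0 h) - (G h 0 - G 0 0) = (h - 0) * (gv (p + h *\<^sub>R u + z *\<^sub>R v)
        - gv (p + 0 *\<^sub>R u + z *\<^sub>R v))"
      by (rule MVT2[of 0 h "\<lambda>y. G h y - G 0 y"]) (use h in \<open>auto intro!: DERIV_diff Gy[of 0, simplified]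
          Gy\<close>)
    then show thesis using that unfolding D_def by (auto simp: algebra_simps)
  qed
  obtain x' where x': "0 < x'" "x' < h" "gv (p + h *\<^sub>R u + y' *\<^sub>R v) - gv (p + 0 *\<^sub>R u + y' *\<^sub>R v) = h *
      gvu (p + x' *\<^sub>R u + y' *\<^sub>R v)"
    using MVT2[of 0 h "\<lambda>x. gv (p + x *\<^sub>R u + y' *\<^sub>R v)" "\<lambda>x. gvu (p + x *\<^sub>R u + y' *\<^sub>R v)"] h y' Gyx by auto
  have "guv (p + x *\<^sub>R u + y *\<^sub>R v) = gvu (p + x' *\<^sub>R u + y' *\<^sub>R v)"
    using x(3) y(3) y'(3) x'(3) h by simp
  moreover have "p + x *\<^sub>R u + y *\<^sub>R v \<in> V" "p + x' *\<^sub>R u + y' *\<^sub>R v \<in> V"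
    using x y x' y' by (auto intro!: inV)
  ultimately show False
    unfolding V_def e_def mem_Collect_eq by (smt (verit) field_sum_of_halves)
qed

abbreviation unc :: "stfun \<Rightarrow> real \<times> (real^3) \<Rightarrow> real" where
  "unc f \<equiv> (\<lambda>p. f (fst p) (snd p))"

lemma smooth_on_pdw:
  assumes "smooth_on U f"
  shows "smooth_on U (dt f)" "smooth_on U (dx i f)"
proof -
  have "pdw ds (dt f) = pdw (ds @ [None]) f" "pdw ds (dx i f) = pdw (ds @ [Some i]) f" for ds
  proof (induction ds)
    case (Cons a ds)
    { case 1 then show ?case using Cons by (cases a) auto }
    { case 2 then show ?case using Cons by (cases a) auto }
  qed auto
  then show "smooth_on U (dt f)" "smooth_on U (dx i f)"
    using assms by (simp_all add: smooth_on_def)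
qed

lemma smooth_on_continuous: "smooth_on U f \<Longrightarrow> continuous_on U (unc f)"
  unfolding smooth_on_def by (drule spec[of _ "[]"]) simp

text \<open>Total differentiability is part of \<open>smooth_on\<close>, so the derivative exists.
  Being linear, it is determined on the coordinate directions, where it must equal the partial
  derivatives \<open>dt\<close> and \<open>dx\<close>.\<close>

lemma smooth_on_has_derivative:
  assumes "smooth_on U f" "(t, x) \<in> U"
  shows "(unc f has_derivative (\<lambda>h. fst h * dt f t x + snd h \<bullet> grad f t x)) (at (t, x))"
proof -
  have "unc f differentiable (at (t, x))"
    using assms unfolding smooth_on_def by (auto dest: spec[of _ "[]"])
  then obtain D where D: "(unc f has_derivative D) (at (t, x))" by (auto simp: differentiable_def)
  then have lin: "linear D" by (rule has_derivative_linear)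
  have D1: "D (1, 0) = dt f t x"
  proof -
    have "((\<lambda>\<tau>. unc f (\<tau>, x)) has_derivative (\<lambda>h. D (h, 0))) (at t)"
      by (rule has_derivative_compose[of "\<lambda>\<tau>. (\<tau>, x)" "\<lambda>h. (h, 0)" t UNIV, OF _ D])
         (auto intro!: derivative_eq_intros)
    moreover have "(\<lambda>h. D (h, 0)) = (*) (D (1, 0))"
    proof
      show "D (h, 0) = D (1, 0) * h" for h
        using linear_scale[OF lin, of h "(1, 0)"] by simp
    qed
    ultimately have "((\<lambda>\<tau>. f \<tau> x) has_field_derivative D (1, 0)) (at t)"
      unfolding has_field_derivative_def by (simp only: fst_conv snd_conv)
    from DERIV_imp_deriv[OF this] show ?thesis by (simp add: dt_def)
  qed
  have D2: "D (0, axis i 1) = dx i f t x" for i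
  proof -
    have D': "(unc f has_derivative D) (at (t, x + 0 *\<^sub>R axis i 1))" using D by simp
    have "((\<lambda>h. unc f (t, x + h *\<^sub>R axis i 1)) has_derivative (\<lambda>h. D (0, h *\<^sub>R axis i 1))) (at 0)"
      by (rule has_derivative_compose[of "\<lambda>h. (t, x + h *\<^sub>R axis i 1)" "\<lambda>h. (0, h *\<^sub>R axis i 1)" 0 UNIV,
          OF _ D'])
         (auto intro!: derivative_eq_intros)
    moreover have "(\<lambda>h. D (0, h *\<^sub>R axis i 1)) = (*) (D (0, axis i 1))"
    proof
      show "D (0, h *\<^sub>R axis i 1) = D (0, axis i 1) * h" for h
        using linear_scale[OF lin, of h "(0, axis i 1)"] by simp
    qed
    ultimately have "((\<lambda>h. f t (x + h *\<^sub>R axis i 1)) has_field_derivative D (0, axis i 1)) (at 0)"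
      unfolding has_field_derivative_def by (simp only: fst_conv snd_conv)
    from DERIV_imp_deriv[OF this] show ?thesis by (simp add: dx_def)
  qed
  have "D h = fst h * dt f t x + snd h \<bullet> grad f t x" for h
  proof -
    have "h = fst h *\<^sub>R (1, 0) + (\<Sum>i\<in>UNIV. snd h $ i *\<^sub>R (0, axis i 1))"
      using basis_expansion[of "snd h"] 
      by (simp add: prod_eq_iff fst_sum snd_sum scalar_mult_eq_scaleR)
    then have "D h = D (fst h *\<^sub>R (1, 0) + (\<Sum>i\<in>UNIV. snd h $ i *\<^sub>R (0, axis i 1)))" by simp
    also have "\<dots> = fst h * D (1, 0) + (\<Sum>i\<in>UNIV. snd h $ i * D (0, axis i 1))"
      by (simp only: linear_add[OF lin] linear_sum[OF lin] linear_scale[OF lin] real_scaleR_def)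
    finally show ?thesis
      by (simp add: D1 D2 grad_def inner_vec_def)
  qed
  then have "D = (\<lambda>h. fst h * dt f t x + snd h \<bullet> grad f t x)" by (rule ext)
  then show ?thesis using D by simp
qed

lemma smooth_on_DERIV_dt:
  assumes "smooth_on U f" "(t, x) \<in> U"
  shows "((\<lambda>\<tau>. f \<tau> x) has_field_derivative dt f t x) (at t)"
proof -
  obtain D where D: "(unc f has_derivative D) (at (t, x))" "D = (\<lambda>h. fst h * dt f t x + snd h \<bullet> grad f t x)"
    using smooth_on_has_derivative[OF assms] by blast
  have "((\<lambda>\<tau>. unc f (\<tau>, x)) has_derivative (\<lambda>h. D (h, 0))) (at t)"
    by (rule has_derivative_compose[of "\<lambda>\<tau>. (\<tau>, x)" "\<lambda>h. (h, 0)" t UNIV, OF _ D(1)])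
       (auto intro!: derivative_eq_intros)
  then show ?thesis by (simp add: has_field_derivative_def D(2) mult.commute[of _ "dt f t x"])
qed

lemma smooth_on_DERIV_line:
  assumes "smooth_on U f" "(t, x + a *\<^sub>R v) \<in> U"
  shows "((\<lambda>a. f t (x + a *\<^sub>R v)) has_field_derivative v \<bullet> grad f t (x + a *\<^sub>R v)) (at a within S)"
proof -
  obtain D where D: "(unc f has_derivative D) (at (t, x + a *\<^sub>R v))"
      "D = (\<lambda>h. fst h * dt f t (x + a *\<^sub>R v) + snd h \<bullet> grad f t (x + a *\<^sub>R v))"
    using smooth_on_has_derivative[OF assms] by blast
  have "((\<lambda>a. unc f (t, x + a *\<^sub>R v)) has_derivative (\<lambda>h. D (0, h *\<^sub>R v))) (at a within S)"
    by (rule has_derivative_compose[of "\<lambda>a. (t, x + a *\<^sub>R v)" "\<lambda>h. (0, h *\<^sub>R v)" a S, OF _ D(1)])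
       (auto intro!: derivative_eq_intros)
  then show ?thesis by (simp add: has_field_derivative_def D(2) mult.commute[of _ "v \<bullet> _"])
qed

lemma inner_grad_axis: "axis i 1 \<bullet> grad f t x = dx i f t x"
  by (simp add: inner_axis' grad_def)

lemma dt_dx_commute:
  assumes "open U" "smooth_on U f" "(t, x) \<in> U"
  shows "dt (dx i f) t x = dx i (dt f) t x"
proof -
  have *: "((\<lambda>a. unc f (q + a *\<^sub>R (1, 0))) has_field_derivative unc (dt f) q) (at 0)"
    if "smooth_on U f" "q \<in> U" for f q
    using DERIV_shift[of "\<lambda>\<tau>. f \<tau> (snd q)" _ 0 "fst q"] that smooth_on_DERIV_dt[of U f "fst q" "snd q"]
    by (simp add: add.commute)
  have **: "((\<lambda>a. unc f (q + a *\<^sub>R (0, axis i 1))) has_field_derivative unc (dx i f) q) (at 0)"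
    if "smooth_on U f" "q \<in> U" for f q
    using smooth_on_DERIV_line[of U f "fst q" "snd q" 0 "axis i 1" UNIV] that by (simp add: inner_grad_axis)
  have "unc (dt (dx i f)) (t, x) = unc (dx i (dt f)) (t, x)"
    by (rule mixed_directional_derivatives[OF assms(1,3), where g = "unc f" and gu = "unc (dx i f)" and
        gv = "unc (dt f)"
        and u = "(0, axis i 1)" and v = "(1, 0)"])
       (rule **[OF assms(2)] *[OF assms(2)] *[OF smooth_on_pdw(2)[OF assms(2)]] **[OF
           smooth_on_pdw(1)[OF assms(2)]]
          smooth_on_continuous smooth_on_pdw assms(2) | assumption)+
  then show ?thesis by simp
qed

lemma dx_dx_commute:
  assumes "open U" "smooth_on U f" "(t, x) \<in> U"
  shows "dx i (dx j f) t x = dx j (dx i f) t x"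
proof -
  have **: "((\<lambda>a. unc f (q + a *\<^sub>R (0, axis i 1))) has_field_derivative unc (dx i f) q) (at 0)"
    if "smooth_on U f" "q \<in> U" for f q i
    using smooth_on_DERIV_line[of U f "fst q" "snd q" 0 "axis i 1" UNIV] that by (simp add: inner_grad_axis)
  have "unc (dx i (dx j f)) (t, x) = unc (dx j (dx i f)) (t, x)"
    by (rule mixed_directional_derivatives[OF assms(1,3), where g = "unc f" and gu = "unc (dx j f)" and
        gv = "unc (dx i f)"
        and u = "(0, axis j 1)" and v = "(0, axis i 1)"])
       (rule **[OF assms(2)] **[OF smooth_on_pdw(2)[OF assms(2)]]
          smooth_on_continuous smooth_on_pdw assms(2) | assumption)+
  then show ?thesis by simp
qed

subsection \<open>Weights\<close>

text \<open>The exponent counts powers of 1 + a^2, so that \<open>wt s\<close> is the weight with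
  exponent 2s of the norms. The family is closed under differentiation, which lowers k by
  one.\<close>

definition wt :: "real \<Rightarrow> real \<Rightarrow> real" where
  "wt k a = (1 + a\<^sup>2) powr k"

lemma wt_pos [simp]: "0 < wt k a"
  unfolding wt_def using zero_le_power2[of a] by (smt (verit) powr_gt_zero)

lemma wt_nonneg [simp]: "0 \<le> wt k a"
  using wt_pos[of k a] by linarith

lemma wt_1 [simp]: "wt 1 a = 1 + a\<^sup>2" by (simp add: wt_def)

lemma wt_0 [simp]: "wt 0 a = 1" using zero_le_power2[of a] by (simp add: wt_def add_nonneg_eq_0_iff)

lemma wt_add: "wt (k + l) a = wt k a * wt l a" by (simp add: wt_def powr_add)

lemma jp_powr: "jp a powr k = wt (k / 2) a"
  by (simp add: jp_def wt_def powr_half_sqrt[symmetric] powr_powr)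

lemma jp_power2: "(jp a)\<^sup>2 = 1 + a\<^sup>2"
  by (simp add: jp_def)

lemma wt_mono:
  assumes "k \<ge> 0" "\<bar>a\<bar> \<le> \<bar>b\<bar>"
  shows "wt k a \<le> wt k b"
  unfolding wt_def using assms abs_le_square_iff[of a b] by (intro powr_mono2) auto

lemma wt_mono_exp: "k \<le> l \<Longrightarrow> wt k a \<le> wt l a"
  unfolding wt_def by (intro powr_mono) auto

lemma DERIV_wt [derivative_intros]:
  assumes "(f has_field_derivative f') (at x within S)"
  shows "((\<lambda>x. wt k (f x)) has_field_derivative 2 * k * f x * wt (k - 1) (f x) * f') (at x within S)"
proof -
  have p: "1 + (f x)\<^sup>2 > 0" using zero_le_power2[of "f x"] by linarith
  show ?thesis
    unfolding wt_def
    by (rule derivative_eq_intros assms p refl)+ (use p in \<open>simp add: powr_diff field_simps\<close>)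
qed

lemma continuous_on_wt [continuous_intros]:
  assumes "continuous_on S f"
  shows "continuous_on S (\<lambda>x. wt k (f x))"
proof -
  have "1 + (f x)\<^sup>2 \<noteq> 0" for x using zero_le_power2[of "f x"] by linarith
  then show ?thesis unfolding wt_def by (intro continuous_intros assms) auto
qed

abbreviation wt' :: "real \<Rightarrow> real \<Rightarrow> real" where
  "wt' k a \<equiv> 2 * k * a * wt (k - 1) a"

text \<open>The trapezoidal rule overestimates the integral of the derivative of the weight: both sides
  vanish at \<open>r = 0\<close>, and the derivative of their difference is
  \<open>r (h''(t + r) - h''(t - r))\<close>, where \<open>h = wt s\<close> and its second derivative is even and
  increasing on the half line.\<close>

lemma wt_trapezoid:
  assumes s: "s \<ge> 1" and t: "0 \<le> t" and r: "0 \<le> r"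
  shows "wt s (t + r) - wt s (t - r) \<le> r * (wt' s (t + r) + wt' s (t - r))"
proof -
  \<comment> \<open>The second derivative of \<open>wt s\<close>.\<close>
  define w2 where "w2 a = 2 * s * wt (s - 1) a + 4 * s * (s - 1) * (a\<^sup>2 * wt (s - 2) a)" for a
  define G where "G r = r * (wt' s (t + r) + wt' s (t - r)) - (wt s (t + r) - wt s (t - r))" for r
  have D: "(G has_field_derivative r * (w2 (t + r) - w2 (t - r))) (at r)" for r
    unfolding G_def w2_def
    by (rule derivative_eq_intros refl)+ (simp add: algebra_simps power2_eq_square)
  have w2: "w2 a \<le> w2 b" if "\<bar>a\<bar> \<le> \<bar>b\<bar>" for a b
  proof -
    \<comment> \<open>Written this way the second summand of \<open>w2\<close> is a product of two
      nonnegative factors that both grow with |a|; the exponent s - 1 is nonnegative, although s - 2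
      need not be.\<close>
    have q: "a\<^sup>2 * wt (s - 2) a = (1 - wt (-1) a) * wt (s - 1) a" for a
    proof -
      have "wt (s - 1) a = wt (s - 2) a * (1 + a\<^sup>2)" using wt_add[of "s - 2" 1 a] by simp
      moreover have "wt (-1) a * wt (s - 1) a = wt (s - 2) a" using wt_add[of "-1" "s - 1" a] by simp
      ultimately show ?thesis by (simp add: algebra_simps)
    qed
    have "wt (-1) b \<le> wt (-1) a"
      using wt_mono[of 1 a b] that by (simp add: wt_def powr_minus le_imp_inverse_le add_pos_nonneg)
    moreover have "wt (-1) b \<le> 1" "wt (-1) a \<le> 1" using wt_mono_exp[of "-1" 0] by auto
    moreover have "wt (s - 1) a \<le> wt (s - 1) b" using wt_mono that s by simp
    ultimately have "(1 - wt (-1) a) * wt (s - 1) a \<le> (1 - wt (-1) b) * wt (s - 1) b"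
      by (intro mult_mono) auto
    then show ?thesis
      unfolding w2_def q using s \<open>wt (s - 1) a \<le> wt (s - 1) b\<close>
      by (intro add_mono mult_left_mono) auto
  qed
  have "G 0 \<le> G r"
  proof (rule DERIV_nonneg_imp_nondecreasing[OF r])
    fix x assume "0 \<le> x" "x \<le> r"
    then have "x * (w2 (t + x) - w2 (t - x)) \<ge> 0"
      using t by (intro mult_nonneg_nonneg) (auto intro: w2)
    then show "\<exists>y. (G has_real_derivative y) (at x) \<and> 0 \<le> y" using D by blast
  qed
  then show ?thesis by (simp add: G_def)
qed

subsection \<open>Spherical means\<close>

lemma smean_integrable:
  assumes "continuous_on UNIV F"
  shows "(\<lambda>y. F (sph (fst y) (snd y)) * sin (fst y)) integrable_on cbox (0, 0) (pi, 2 * pi)"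
  by (intro integrable_continuous continuous_intros continuous_on_compose2[OF assms]) auto

lemma smean_mono:
  assumes "continuous_on UNIV F" "continuous_on UNIV G" "\<And>w. norm w = 1 \<Longrightarrow> F w \<le> G w"
  shows "smean F \<le> smean G"
  unfolding smean_def
proof (rule integral_le)
  fix y :: "real \<times> real" assume "y \<in> cbox (0, 0) (pi, 2 * pi)"
  then have "0 \<le> fst y" "fst y \<le> pi" by (cases y; auto simp: cbox_Pair_eq)+
  then have "0 \<le> sin (fst y)" by (rule sin_ge_zero)
  then show "F (sph (fst y) (snd y)) * sin (fst y) \<le> G (sph (fst y) (snd y)) * sin (fst y)"
    using assms(3) by (intro mult_right_mono) auto
qed (rule smean_integrable assms)+

lemma smean_cong: "(\<And>w. norm w = 1 \<Longrightarrow> F w = G w) \<Longrightarrow> smean F = smean G"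
  unfolding smean_def by (rule integral_cong) simp

lemma smean_nonneg:
  assumes "continuous_on UNIV F" "\<And>w. norm w = 1 \<Longrightarrow> 0 \<le> F w"
  shows "0 \<le> smean F"
  using smean_mono[of "\<lambda>_. 0" F] assms by (simp add: smean_def)

lemma smean_add:
  assumes "continuous_on UNIV F" "continuous_on UNIV G"
  shows "smean (\<lambda>w. F w + G w) = smean F + smean G"
  unfolding smean_def by (simp add: distrib_right integral_add smean_integrable assms)

lemma smean_diff:
  assumes "continuous_on UNIV F" "continuous_on UNIV G"
  shows "smean (\<lambda>w. F w - G w) = smean F - smean G"
  unfolding smean_def by (simp add: left_diff_distrib integral_diff smean_integrable assms)

lemma smean_cmult: "smean (\<lambda>w. c * F w) = c * smean F"
  unfolding smean_def by (simp add: mult.assoc)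

lemma smean_const: "smean (\<lambda>w. c) = c * smean (\<lambda>w. 1)"
  using smean_cmult[of c "\<lambda>w. 1"] by simp

lemma DERIV_smean:
  fixes F F' :: "real \<Rightarrow> real^3 \<Rightarrow> real"
  assumes "\<And>x w. x \<in> S \<Longrightarrow> ((\<lambda>x. F x w) has_field_derivative F' x w) (at x within S)"
    and "\<And>x. x \<in> S \<Longrightarrow> continuous_on UNIV (F x)"
    and cont: "continuous_on (S \<times> UNIV) (\<lambda>p. F' (fst p) (snd p))"
    and "x \<in> S" "convex S"
  shows "((\<lambda>x. smean (F x)) has_field_derivative smean (F' x)) (at x within S)"
  unfolding smean_def
proof (rule leibniz_rule_field_derivative[OF _ _ _ assms(4,5)])
  show "continuous_on (S \<times> cbox (0, 0) (pi, 2 * pi)) (\<lambda>(x, t). F' x (sph (fst t) (snd t)) * sin (fst t))"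
    unfolding split_beta
    by (intro continuous_intros continuous_on_compose2[OF cont, where f="\<lambda>x. (fst x, sph (fst (snd x))
        (snd (snd x)))", unfolded fst_conv snd_conv])
       (auto intro!: continuous_intros)
qed (auto intro!: derivative_eq_intros assms smean_integrable)

text \<open>Divergence theorem on a rectangle: each component is integrated first in its own
  variable, where equal values on opposite sides cancel. For the sphere, the factor sin \<theta>
  vanishes at both poles and the azimuth is periodic.\<close>

lemma integral_divergence_zero:
  fixes A A' B B' :: "real \<Rightarrow> real \<Rightarrow> real"
  assumes "\<And>x y. ((\<lambda>x. A x y) has_field_derivative A' x y) (at x)"
    and "\<And>x y. ((\<lambda>y. B x y) has_field_derivative B' x y) (at y)"
    and cA: "continuous_on UNIV (\<lambda>p. A' (fst p) (snd p))" and cB: "continuous_on UNIV (\<lambda>p. B' (fst p)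
        (snd p))"
    and "\<And>y. A a y = A b y" "\<And>x. B x c = B x d" and "a \<le> b" "c \<le> d"
  shows "integral (cbox (a, c) (b, d)) (\<lambda>p. A' (fst p) (snd p) + B' (fst p) (snd p)) = 0"
proof -
  have "integral (cbox (a, c) (b, d)) (\<lambda>p. B' (fst p) (snd p)) = integral (cbox a b) (\<lambda>x. integral (cbox
      c d) (\<lambda>y. B' x y))"
    by (subst integral_prod_continuous[OF continuous_on_subset[OF cB]]) auto
  also have "\<dots> = integral (cbox a b) (\<lambda>x. 0)"
  proof (rule integral_cong)
    fix x
    have "(B' x has_integral B x d - B x c) {c..d}"
      using assms(2,8) by (intro fundamental_theorem_of_calculus)
        (auto simp: has_real_derivative_iff_has_vector_derivative[symmetric] intro: DERIV_subset)
    then show "integral (cbox c d) (\<lambda>y. B' x y) = 0" using assms(6) by (simp add: integral_unique)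
  qed
  finally have 1: "integral (cbox (a, c) (b, d)) (\<lambda>p. B' (fst p) (snd p)) = 0" by simp
  have "integral (cbox (a, c) (b, d)) (\<lambda>p. A' (fst p) (snd p)) = integral (cbox a b) (\<lambda>x. integral (cbox
      c d) (\<lambda>y. A' x y))"
    by (subst integral_prod_continuous[OF continuous_on_subset[OF cA]]) auto
  also have "\<dots> = integral (cbox c d) (\<lambda>y. integral (cbox a b) (\<lambda>x. A' x y))"
    by (rule integral_swap_continuous) (simp add: split_beta continuous_on_subset[OF cA])
  also have "\<dots> = integral (cbox c d) (\<lambda>x. 0)"
  proof (rule integral_cong)
    fix y
    have "((\<lambda>x. A' x y) has_integral A b y - A a y) {a..b}"
      using assms(1,7) by (intro fundamental_theorem_of_calculus)
        (auto simp: has_real_derivative_iff_has_vector_derivative[symmetric] intro: DERIV_subset)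
    then show "integral (cbox a b) (\<lambda>x. A' x y) = 0" using assms(5) by (simp add: integral_unique)
  qed
  finally have 2: "integral (cbox (a, c) (b, d)) (\<lambda>p. A' (fst p) (snd p)) = 0" by simp
  show ?thesis
    by (subst integral_add) (auto intro!: integrable_continuous continuous_on_subset[OF cA]
        continuous_on_subset[OF cB] simp: 1 2)
qed

text \<open>Rotations preserve the surface measure, so derivatives along the three rotation fields
  have mean zero; g is the gradient of F. This is the only integration by parts on the sphere that
  the proof uses.\<close>

lemma smean_rotation_zero:
  fixes F :: "real^3 \<Rightarrow> real" and g :: "real^3 \<Rightarrow> real^3"
  assumes F: "\<And>w. (F has_derivative (\<lambda>h. h \<bullet> g w)) (at w)" and g: "continuous_on UNIV g"
  shows "smean (\<lambda>w. w$1 * g w$2 - w$2 * g w$1) = 0"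
    "smean (\<lambda>w. w$3 * g w$1 - w$1 * g w$3) = 0"
    "smean (\<lambda>w. w$2 * g w$3 - w$3 * g w$2) = 0"
proof -
  have F': "((\<lambda>x. F (k x)) has_field_derivative k' \<bullet> g (k x)) (at x)"
    if "(k has_vector_derivative k') (at x)" for k :: "real \<Rightarrow> real^3" and k' x
  proof -
    have "((\<lambda>x. F (k x)) has_derivative (\<lambda>h. (h *\<^sub>R k') \<bullet> g (k x))) (at x)"
      by (rule has_derivative_compose[OF _ F]) (use that in \<open>simp add: has_vector_derivative_def\<close>)
    then show ?thesis by (simp add: has_field_derivative_def mult.commute[of _ "k' \<bullet> _"])
  qed
  have vd: "(k has_vector_derivative k') (at x)"
    if k: "\<And>i::3. ((\<lambda>x. k x $ i) has_field_derivative k' $ i) (at x)" for k :: "real \<Rightarrow> real^3" and k' x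
    unfolding has_vector_derivative_def has_derivative_componentwise_within[of k]
  proof
    fix b :: "real^3" assume "b \<in> Basis"
    then obtain i where i: "b = axis i 1" by (auto simp: Basis_vec_def)
    show "((\<lambda>x. k x \<bullet> b) has_derivative (\<lambda>x. (x *\<^sub>R k') \<bullet> b)) (at x)"
      using k[of i] by (simp add: i inner_axis has_field_derivative_def mult.commute[of _ "k' $ i"])
  qed
  \<comment> \<open>\<open>Pt\<close> and \<open>Pp\<close> are the derivatives of F in the polar
    angle a and the azimuth b.\<close>
  define Pt where "Pt a b = vector [cos a * cos b, cos a * sin b, - sin a] \<bullet> g (sph a b)" for a b
  define Pp where "Pp a b = vector [- sin a * sin b, sin a * cos b, 0] \<bullet> g (sph a b)" for a b
  have t: "((\<lambda>a. F (sph a b)) has_field_derivative Pt a b) (at a)" for a b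
    unfolding Pt_def 
  proof (intro F' vd)
    show "((\<lambda>x. sph x b $ i) has_real_derivative vector [cos a * cos b, cos a * sin b, - sin a] $ i) (at
        a)" for i :: 3
      using exhaust_3[of i] by (auto intro!: derivative_eq_intros)
  qed
  have p: "((\<lambda>b. F (sph a b)) has_field_derivative Pp a b) (at b)" for a b
    unfolding Pp_def 
  proof (intro F' vd)
    show "((\<lambda>x. sph a x $ i) has_real_derivative vector [- sin a * sin b, sin a * cos b, 0] $ i) (at b)"
        for i :: 3
      using exhaust_3[of i] by (auto intro!: derivative_eq_intros)
  qed
  have Fc: "continuous_on UNIV F"
    by (intro continuous_at_imp_continuous_on ballI has_derivative_continuous[OF F])
  have c1: "continuous_on UNIV (\<lambda>x. F (sph (fst x) (snd x)))"
    by (intro continuous_on_compose2[OF Fc] continuous_intros) auto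
  have c2: "continuous_on UNIV (\<lambda>x. g (sph (fst x) (snd x)) $ i)" for i
    by (intro continuous_intros continuous_on_compose2[OF g]) auto
  have Pt: "Pt a b = cos a * cos b * g (sph a b) $ 1 + cos a * sin b * g (sph a b) $ 2 - sin a * g (sph
      a b) $ 3" for a b
    by (simp add: Pt_def inner_vec_def sum_3)
  have Pp: "Pp a b = - sin a * sin b * g (sph a b) $ 1 + sin a * cos b * g (sph a b) $ 2" for a b
    by (simp add: Pp_def inner_vec_def sum_3)
  have cPt: "continuous_on UNIV (\<lambda>x. Pt (fst x) (snd x))" and cPp: "continuous_on UNIV (\<lambda>x. Pp (fst x)
      (snd x))"
    unfolding Pt Pp by (intro continuous_intros c2)+
  have sph_periodic: "sph a (2 * pi) = sph a 0" for a by (simp add: sph_def)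
  have sc: "sin x * sin x = 1 - cos x * cos x" for x :: real
    using sin_cos_squared_add[of x] by (simp add: power2_eq_square algebra_simps)
  have 1: "integral (cbox (0, 0) (pi, 2 * pi)) (\<lambda>p. (\<lambda>a b. 0) (fst p) (snd p) + (\<lambda>a b. sin a * Pp a b)
      (fst p) (snd p)) = 0"
    by (rule integral_divergence_zero[where A = "\<lambda>a b. 0" and B = "\<lambda>a b. sin a * F (sph a b)"])
       (use cPt cPp in \<open>auto intro!: continuous_intros c1 derivative_eq_intros p t simp: sph_periodic\<close>)
  then show "smean (\<lambda>w. w$1 * g w$2 - w$2 * g w$1) = 0"
    unfolding smean_def by (simp add: Pp algebra_simps)
  \<comment> \<open>In angles the field is cos b times the a-derivative minus cot a sin b times the
    b-derivative. The factor sin a of the measure removes the pole and makes it an exact divergence: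
    the two undifferentiated terms in F cancel.\<close>
  have 2: "integral (cbox (0, 0) (pi, 2 * pi)) (\<lambda>p. (\<lambda>a b. cos b * (cos a * F (sph a b) + sin a * Pt a
      b)) (fst p) (snd p)
     + (\<lambda>a b. - cos a * (cos b * F (sph a b) + sin b * Pp a b)) (fst p) (snd p)) = 0"
    by (rule integral_divergence_zero[where A = "\<lambda>a b. cos b * (sin a * F (sph a b))" and B = "\<lambda>a b. -
        cos a * (sin b * F (sph a b))"])
       (use cPt cPp in \<open>auto intro!: continuous_intros c1 derivative_eq_intros p t simp: sph_periodic\<close>)
  have e2: "cos b * (cos a * F (sph a b) + sin a * Pt a b) + - cos a * (cos b * F (sph a b) + sin b * Pp
      a b)
     = (cos a * g (sph a b) $ 1 - sin a * cos b * g (sph a b) $ 3) * sin a" for a b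
    unfolding Pp Pt using sc[of b] by algebra
  show "smean (\<lambda>w. w$3 * g w$1 - w$1 * g w$3) = 0"
    using 2 unfolding smean_def e2 by simp
  have 3: "integral (cbox (0, 0) (pi, 2 * pi)) (\<lambda>p. (\<lambda>a b. - sin b * (cos a * F (sph a b) + sin a * Pt a
      b)) (fst p) (snd p)
     + (\<lambda>a b. - cos a * (- sin b * F (sph a b) + cos b * Pp a b)) (fst p) (snd p)) = 0"
    by (rule integral_divergence_zero[where A = "\<lambda>a b. - sin b * (sin a * F (sph a b))" and B = "\<lambda>a b. -
        cos a * (cos b * F (sph a b))"])
       (use cPt cPp in \<open>auto intro!: continuous_intros c1 derivative_eq_intros p t simp: sph_periodic\<close>)
  have e3: "- sin b * (cos a * F (sph a b) + sin a * Pt a b) + - cos a * (- sin b * F (sph a b) + cos b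
      * Pp a b)
     = (sin a * sin b * g (sph a b) $ 3 - cos a * g (sph a b) $ 2) * sin a" for a b
    unfolding Pp Pt using sc[of b] by algebra
  show "smean (\<lambda>w. w$2 * g w$3 - w$3 * g w$2) = 0"
    using 3 unfolding smean_def e3 by simp
qed

subsection \<open>The pointwise energy identity\<close>

text \<open>An open U around the closed slab makes all time derivatives two-sided, also at t1 and
  t2. The case t1 = t2 is allowed and serves for statements about one slice.\<close>

locale smooth_wave =
  fixes s :: real and f :: stfun and U :: "(real \<times> (real^3)) set" and t1 t2 :: real
  assumes s: "s \<ge> 1" and t1: "0 \<le> t1" and t12: "t1 \<le> t2"
    and U: "open U" and slab: "{t1..t2} \<times> UNIV \<subseteq> U" and smooth: "smooth_on U f"
begin

text \<open>In polar coordinates \<open>x = r w\<close>, \<open>Lpsi\<close> and \<open>Lbarpsi\<close> are the null derivatives of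
  \<open>\<psi> = r f\<close>, and \<open>r\<^sup>2 * ang2\<close> is the squared angular gradient of \<open>\<psi>\<close>. Expanding the product keeps
  everything smooth at \<open>r = 0\<close>, and the directions \<open>w\<close> range over all vectors so that one can
  differentiate in \<open>w\<close>.\<close>

definition Lpsi :: "real \<Rightarrow> real \<Rightarrow> real^3 \<Rightarrow> real" where
  "Lpsi t r w = r * (dt f t (r *\<^sub>R w) + w \<bullet> grad f t (r *\<^sub>R w)) + f t (r *\<^sub>R w)"

definition Lbarpsi :: "real \<Rightarrow> real \<Rightarrow> real^3 \<Rightarrow> real" where
  "Lbarpsi t r w = r * (dt f t (r *\<^sub>R w) - w \<bullet> grad f t (r *\<^sub>R w)) - f t (r *\<^sub>R w)"

text \<open>For unit w the cross product has the length of the projected gradient. Unlike the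
  projection, its components are rotation derivatives (divided by r), as
  \<open>smean_rotation_zero\<close> requires.\<close>

definition ang :: "real \<Rightarrow> real \<Rightarrow> real^3 \<Rightarrow> real^3" where
  "ang t r w = cross3 w (grad f t (r *\<^sub>R w))"

definition ang2 :: "real \<Rightarrow> real \<Rightarrow> real^3 \<Rightarrow> real" where
  "ang2 t r w = ang t r w \<bullet> ang t r w"

lemma ang2_nonneg: "0 \<le> ang2 t r w"
  by (simp add: ang2_def)

abbreviation wtp :: "real \<Rightarrow> real \<Rightarrow> real" where "wtp t r \<equiv> wt s (t + r)"
abbreviation wtm :: "real \<Rightarrow> real \<Rightarrow> real" where "wtm t r \<equiv> wt s (t - r)"

definition edens :: "real \<Rightarrow> real \<Rightarrow> real^3 \<Rightarrow> real" where
  "edens t r w = wtp t r * (Lpsi t r w)\<^sup>2 + wtm t r * (Lbarpsi t r w)\<^sup>2 + (wtp t r + wtm t r) * (r\<^sup>2 *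
      ang2 t r w)"

text \<open>The radial current belonging to \<open>edens\<close>: the \<open>Lpsi\<close> part
  travels inward, the \<open>Lbarpsi\<close> part outward. Across an outgoing cone the boundary
  density is \<open>edens - eflux\<close>, which is twice the integrand of
  \<open>flux\<close>.\<close>

definition eflux :: "real \<Rightarrow> real \<Rightarrow> real^3 \<Rightarrow> real" where
  "eflux t r w = - wtp t r * (Lpsi t r w)\<^sup>2 + wtm t r * (Lbarpsi t r w)\<^sup>2 + (wtp t r - wtm t r) * (r\<^sup>2 *
      ang2 t r w)"

text \<open>The Hessian of f applied to w, which is the r-derivative of the gradient along the ray
  through w.\<close>

definition hessw :: "real \<Rightarrow> real \<Rightarrow> real^3 \<Rightarrow> real^3" where
  "hessw t r w = (\<chi> i. w \<bullet> grad (dx i f) t (r *\<^sub>R w))"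

lemma slabD: "t \<in> {t1..t2} \<Longrightarrow> (t, x) \<in> U"
  using slab by blast

lemma cont_comp:
  assumes "smooth_on U g" "continuous_on X T" "continuous_on X Y" "\<And>x. x \<in> X \<Longrightarrow> T x \<in> {t1..t2}"
  shows "continuous_on X (\<lambda>x. g (T x) (Y x))"
  using continuous_on_compose2[OF smooth_on_continuous[OF assms(1)], of X "\<lambda>x. (T x, Y x)"] assms slabD
  by (auto intro!: continuous_intros)

lemma cont_grad:
  assumes "smooth_on U g" "continuous_on X T" "continuous_on X Y" "\<And>x. x \<in> X \<Longrightarrow> T x \<in> {t1..t2}"
  shows "continuous_on X (\<lambda>x. grad g (T x) (Y x))"
  unfolding grad_def by (intro continuous_on_vec_lambda cont_comp[OF smooth_on_pdw(2)[OF assms(1)]]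
      assms(2-4))

lemmas smooth2 = smooth smooth_on_pdw(1)[OF smooth] smooth_on_pdw(2)[OF smooth]
  smooth_on_pdw(1)[OF smooth_on_pdw(1)[OF smooth]] smooth_on_pdw(2)[OF smooth_on_pdw(2)[OF smooth]]

lemmas cont_comps = smooth2[THEN cont_comp] smooth2(1-3)[THEN cont_grad]

lemma cross3_nth: "cross3 a b $ 1 = a$2 * b$3 - a$3 * b$2" "cross3 a b $ 2 = a$3 * b$1 - a$1 * b$3"
    "cross3 a b $ 3 = a$1 * b$2 - a$2 * b$1"
  by (simp_all add: cross3_def)

lemma cont_cross3:
  fixes a b :: "'a::t2_space \<Rightarrow> real^3"
  assumes "continuous_on X a" "continuous_on X b"
  shows "continuous_on X (\<lambda>x. cross3 (a x) (b x))"
  by (rule continuous_on_cross assms)+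

text \<open>Time, radius and direction are continuous functions of an arbitrary parameter, so that
  one proof covers fixed slices, fixed radii and joint continuity.\<close>

context
  fixes X :: "'a::t2_space set" and T R :: "'a \<Rightarrow> real" and Y :: "'a \<Rightarrow> real^3"
  assumes c: "continuous_on X T" "continuous_on X R" "continuous_on X Y"
    and T: "\<And>x. x \<in> X \<Longrightarrow> T x \<in> {t1..t2}"
begin

lemma cont_Lpsi: "continuous_on X (\<lambda>x. Lpsi (T x) (R x) (Y x))"
  unfolding Lpsi_def by (intro continuous_intros cont_comps c T)

lemma cont_Lbarpsi: "continuous_on X (\<lambda>x. Lbarpsi (T x) (R x) (Y x))"
  unfolding Lbarpsi_def by (intro continuous_intros cont_comps c T)

lemma cont_ang: "continuous_on X (\<lambda>x. ang (T x) (R x) (Y x))"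
  unfolding ang_def by (intro continuous_intros cont_comps cont_cross3 c T)

lemma cont_ang2: "continuous_on X (\<lambda>x. ang2 (T x) (R x) (Y x))"
  unfolding ang2_def by (intro continuous_intros cont_ang)

lemma cont_edens: "continuous_on X (\<lambda>x. edens (T x) (R x) (Y x))"
  unfolding edens_def by (intro continuous_intros cont_Lpsi cont_Lbarpsi cont_ang2 c)

lemma cont_eflux: "continuous_on X (\<lambda>x. eflux (T x) (R x) (Y x))"
  unfolding eflux_def by (intro continuous_intros cont_Lpsi cont_Lbarpsi cont_ang2 c)

lemma cont_hessw: "continuous_on X (\<lambda>x. hessw (T x) (R x) (Y x))"
  unfolding hessw_def by (intro continuous_intros continuous_on_vec_lambda cont_comps c T)

lemma cont_box: "continuous_on X (\<lambda>x. Defs.box f (T x) (R x *\<^sub>R Y x))"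
  unfolding box_def by (intro continuous_intros cont_comps c T)

end

lemma dt_comp:
  "smooth_on U g \<Longrightarrow> t \<in> {t1..t2} \<Longrightarrow> ((\<lambda>t. g t x) has_field_derivative dt g t x) (at t)"
  by (rule smooth_on_DERIV_dt) (use slabD in auto)

lemma dr_comp:
  assumes "smooth_on U g" "t \<in> {t1..t2}"
  shows "((\<lambda>r. g t (r *\<^sub>R w)) has_field_derivative w \<bullet> grad g t (r *\<^sub>R w)) (at r)"
  using smooth_on_DERIV_line[of U g t 0 r w UNIV] assms slabD by simp

lemma dw_comp:
  assumes "smooth_on U g" "t \<in> {t1..t2}"
  shows "((\<lambda>w. g t (r *\<^sub>R w)) has_derivative (\<lambda>h. h \<bullet> (r *\<^sub>R grad g t (r *\<^sub>R w)))) (at w)"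
proof -
  obtain D where D: "(unc g has_derivative D) (at (t, r *\<^sub>R w))"
      "D = (\<lambda>h. fst h * dt g t (r *\<^sub>R w) + snd h \<bullet> grad g t (r *\<^sub>R w))"
    using smooth_on_has_derivative[OF assms(1) slabD[OF assms(2)]] by blast
  have "((\<lambda>w. unc g (t, r *\<^sub>R w)) has_derivative (\<lambda>h. D (0, r *\<^sub>R h))) (at w)"
    by (rule has_derivative_compose[of "\<lambda>w. (t, r *\<^sub>R w)" "\<lambda>h. (0, r *\<^sub>R h)" w UNIV, OF _ D(1)])
       (auto intro!: derivative_eq_intros)
  then show ?thesis by (simp add: D(2))
qed

lemmas dt_comps = smooth2(1-3)[THEN dt_comp]
lemmas dr_comps = smooth2(1-3)[THEN dr_comp]
lemmas dw_comps = smooth2(1-3)[THEN dw_comp]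

lemma inner_grad_eq: "w \<bullet> grad g t x = w$1 * dx 1 g t x + w$2 * dx 2 g t x + w$3 * dx 3 g t x"
  by (simp add: inner_vec_def sum_3 grad_def)

lemma inner_3: "(a::real^3) \<bullet> b = a$1 * b$1 + a$2 * b$2 + a$3 * b$3"
  by (simp add: inner_vec_def sum_3)

lemma grad_nth [simp]: "grad g t x $ i = dx i g t x"
  by (simp add: grad_def)

lemma dt_dx: "t \<in> {t1..t2} \<Longrightarrow> dt (dx i f) t x = dx i (dt f) t x"
  by (rule dt_dx_commute[OF U smooth]) (use slabD in auto)

lemma dx_dx: "t \<in> {t1..t2} \<Longrightarrow> dx i (dx j f) t x = dx j (dx i f) t x"
  by (rule dx_dx_commute[OF U smooth]) (use slabD in auto)

text \<open>Suffixes \<open>_t\<close> and \<open>_r\<close> denote derivatives, \<open>_w\<close> the gradient in the direction variable \<open>w\<close>.\<close>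

definition Lpsi_t where "Lpsi_t t r w = r * (dt (dt f) t (r *\<^sub>R w) + w \<bullet> grad (dt f) t (r *\<^sub>R w)) + dt f
    t (r *\<^sub>R w)"
definition Lbarpsi_t where "Lbarpsi_t t r w = r * (dt (dt f) t (r *\<^sub>R w) - w \<bullet> grad (dt f) t (r *\<^sub>R w))
    - dt f t (r *\<^sub>R w)"
definition Lpsi_r where "Lpsi_r t r w = dt f t (r *\<^sub>R w) + 2 * (w \<bullet> grad f t (r *\<^sub>R w)) + r * (w \<bullet> grad
    (dt f) t (r *\<^sub>R w) + w \<bullet> hessw t r w)"
definition Lbarpsi_r where "Lbarpsi_r t r w = dt f t (r *\<^sub>R w) - 2 * (w \<bullet> grad f t (r *\<^sub>R w)) + r * (w \<bullet>
    grad (dt f) t (r *\<^sub>R w) - w \<bullet> hessw t r w)"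
definition ang2_t where "ang2_t t r w = 2 * (ang t r w \<bullet> cross3 w (grad (dt f) t (r *\<^sub>R w)))"
definition ang2_r where "ang2_r t r w = 2 * (ang t r w \<bullet> cross3 w (hessw t r w))"
definition Lpsi_w where "Lpsi_w t r w = r\<^sup>2 *\<^sub>R grad (dt f) t (r *\<^sub>R w) + (2 * r) *\<^sub>R grad f t (r *\<^sub>R w)
    + r\<^sup>2 *\<^sub>R hessw t r w"
definition Lbarpsi_w where "Lbarpsi_w t r w = r\<^sup>2 *\<^sub>R grad (dt f) t (r *\<^sub>R w) - (2 * r) *\<^sub>R grad f t (r
    *\<^sub>R w) - r\<^sup>2 *\<^sub>R hessw t r w"

lemma DERIV_Lpsi_t: "t \<in> {t1..t2} \<Longrightarrow> ((\<lambda>t. Lpsi t r w) has_field_derivative Lpsi_t t r w) (at t)"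
  unfolding Lpsi_def Lpsi_t_def inner_grad_eq
  by (rule derivative_eq_intros dt_comps refl | assumption)+ (simp add: dt_dx)

lemma DERIV_Lbarpsi_t: "t \<in> {t1..t2} \<Longrightarrow> ((\<lambda>t. Lbarpsi t r w) has_field_derivative Lbarpsi_t t r w) (at t)"
  unfolding Lbarpsi_def Lbarpsi_t_def inner_grad_eq
  by (rule derivative_eq_intros dt_comps refl | assumption)+ (simp add: dt_dx)

lemma DERIV_Lpsi_r: "t \<in> {t1..t2} \<Longrightarrow> ((\<lambda>r. Lpsi t r w) has_field_derivative Lpsi_r t r w) (at r)"
  unfolding Lpsi_def Lpsi_r_def inner_grad_eq[where g=f]
  by (rule derivative_eq_intros dr_comps refl | assumption)+
     (simp add: inner_3 hessw_def algebra_simps)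

lemma DERIV_Lbarpsi_r: "t \<in> {t1..t2} \<Longrightarrow> ((\<lambda>r. Lbarpsi t r w) has_field_derivative Lbarpsi_r t r w) (at r)"
  unfolding Lbarpsi_def Lbarpsi_r_def inner_grad_eq[where g=f]
  by (rule derivative_eq_intros dr_comps refl | assumption)+
     (simp add: inner_3 hessw_def algebra_simps)

lemma ang2_eq: "ang2 t r w =
   (w$2 * dx 3 f t (r *\<^sub>R w) - w$3 * dx 2 f t (r *\<^sub>R w))\<^sup>2 + (w$3 * dx 1 f t (r *\<^sub>R w) - w$1 * dx 3 f t
       (r *\<^sub>R w))\<^sup>2
   + (w$1 * dx 2 f t (r *\<^sub>R w) - w$2 * dx 1 f t (r *\<^sub>R w))\<^sup>2"
  by (simp add: ang2_def ang_def inner_3 cross3_nth power2_eq_square)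

lemma DERIV_ang2_t: "t \<in> {t1..t2} \<Longrightarrow> ((\<lambda>t. ang2 t r w) has_field_derivative ang2_t t r w) (at t)"
  unfolding ang2_eq
  by (rule derivative_eq_intros dt_comps refl | assumption)+
     (simp add: dt_dx ang2_t_def ang_def inner_3 cross3_nth algebra_simps)

lemma DERIV_ang2_r: "t \<in> {t1..t2} \<Longrightarrow> ((\<lambda>r. ang2 t r w) has_field_derivative ang2_r t r w) (at r)"
  unfolding ang2_eq
  by (rule derivative_eq_intros dr_comps refl | assumption)+
     (simp add: ang2_r_def ang_def inner_3 cross3_nth hessw_def algebra_simps)

definition edens_t where
  "edens_t t r w = wt' s (t + r) * (Lpsi t r w)\<^sup>2 + wtp t r * (2 * Lpsi t r w * Lpsi_t t r w)
    + wt' s (t - r) * (Lbarpsi t r w)\<^sup>2 + wtm t r * (2 * Lbarpsi t r w * Lbarpsi_t t r w)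
    + (wt' s (t + r) + wt' s (t - r)) * (r\<^sup>2 * ang2 t r w) + (wtp t r + wtm t r) * (r\<^sup>2 * ang2_t t r w)"

text \<open>No term of the energy identity; it enters only because the outer end of the radial
  integral moves with t.\<close>

definition edens_r where
  "edens_r t r w = wt' s (t + r) * (Lpsi t r w)\<^sup>2 + wtp t r * (2 * Lpsi t r w * Lpsi_r t r w)
    - wt' s (t - r) * (Lbarpsi t r w)\<^sup>2 + wtm t r * (2 * Lbarpsi t r w * Lbarpsi_r t r w)
    + (wt' s (t + r) - wt' s (t - r)) * (r\<^sup>2 * ang2 t r w)
    + (wtp t r + wtm t r) * (2 * r * ang2 t r w + r\<^sup>2 * ang2_r t r w)"

definition eflux_r where
  "eflux_r t r w = - wt' s (t + r) * (Lpsi t r w)\<^sup>2 - wtp t r * (2 * Lpsi t r w * Lpsi_r t r w)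
    - wt' s (t - r) * (Lbarpsi t r w)\<^sup>2 + wtm t r * (2 * Lbarpsi t r w * Lbarpsi_r t r w)
    + (wt' s (t + r) + wt' s (t - r)) * (r\<^sup>2 * ang2 t r w)
    + (wtp t r - wtm t r) * (2 * r * ang2 t r w + r\<^sup>2 * ang2_r t r w)"

lemma DERIV_edens_t: "t \<in> {t1..t2} \<Longrightarrow> ((\<lambda>t. edens t r w) has_field_derivative edens_t t r w) (at t)"
  unfolding edens_def edens_t_def
  by (rule derivative_eq_intros DERIV_Lpsi_t DERIV_Lbarpsi_t DERIV_ang2_t refl | assumption)+ (simp add:
      algebra_simps)

lemma DERIV_edens_r: "t \<in> {t1..t2} \<Longrightarrow> ((\<lambda>r. edens t r w) has_field_derivative edens_r t r w) (at r)"
  unfolding edens_def edens_r_def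
  by (rule derivative_eq_intros DERIV_Lpsi_r DERIV_Lbarpsi_r DERIV_ang2_r refl | assumption)+ (simp add:
      algebra_simps)

lemma DERIV_eflux_r: "t \<in> {t1..t2} \<Longrightarrow> ((\<lambda>r. eflux t r w) has_field_derivative eflux_r t r w) (at r)"
  unfolding eflux_def eflux_r_def
  by (rule derivative_eq_intros DERIV_Lpsi_r DERIV_Lbarpsi_r DERIV_ang2_r refl | assumption)+ (simp add:
      algebra_simps)

lemma Lpsi_has_derivative_w: "t \<in> {t1..t2} \<Longrightarrow> ((\<lambda>w. Lpsi t r w) has_derivative (\<lambda>h. h \<bullet> Lpsi_w t r w))
    (at w)"
  unfolding Lpsi_def Lpsi_w_def inner_grad_eq[where g=f]
  by (rule derivative_eq_intros dw_comps refl bounded_linear_imp_has_derivative[OF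
      bounded_linear_vec_nth] | assumption)+
     (simp add: fun_eq_iff inner_3 hessw_def dx_dx[of _ 1 2] dx_dx[of _ 1 3] dx_dx[of _ 2 3]
         algebra_simps power2_eq_square)

lemma Lbarpsi_has_derivative_w: "t \<in> {t1..t2} \<Longrightarrow> ((\<lambda>w. Lbarpsi t r w) has_derivative (\<lambda>h. h \<bullet> Lbarpsi_w t
    r w)) (at w)"
  unfolding Lbarpsi_def Lbarpsi_w_def inner_grad_eq[where g=f]
  by (rule derivative_eq_intros dw_comps refl bounded_linear_imp_has_derivative[OF
      bounded_linear_vec_nth] | assumption)+
     (simp add: fun_eq_iff inner_3 hessw_def dx_dx[of _ 1 2] dx_dx[of _ 1 3] dx_dx[of _ 2 3]
         algebra_simps power2_eq_square)

section \<open>Angular derivatives and the divergence on the sphere\<close>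

definition ang_w :: "3 \<Rightarrow> real \<Rightarrow> real \<Rightarrow> real^3 \<Rightarrow> real^3" where
  "ang_w k t r w = (if k = 1 then
      vector [0, dx 3 f t (r *\<^sub>R w), - dx 2 f t (r *\<^sub>R w)]
        + r *\<^sub>R (w$2 *\<^sub>R grad (dx 3 f) t (r *\<^sub>R w) - w$3 *\<^sub>R grad (dx 2 f) t (r *\<^sub>R w))
    else if k = 2 then
      vector [- dx 3 f t (r *\<^sub>R w), 0, dx 1 f t (r *\<^sub>R w)]
        + r *\<^sub>R (w$3 *\<^sub>R grad (dx 1 f) t (r *\<^sub>R w) - w$1 *\<^sub>R grad (dx 3 f) t (r *\<^sub>R w))
    else
      vector [dx 2 f t (r *\<^sub>R w), - dx 1 f t (r *\<^sub>R w), 0]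
        + r *\<^sub>R (w$1 *\<^sub>R grad (dx 2 f) t (r *\<^sub>R w) - w$2 *\<^sub>R grad (dx 1 f) t (r *\<^sub>R w)))"

lemma ang_w_nth:
  "ang_w 1 t r w = vector [0, dx 3 f t (r *\<^sub>R w), - dx 2 f t (r *\<^sub>R w)]
        + r *\<^sub>R (w$2 *\<^sub>R grad (dx 3 f) t (r *\<^sub>R w) - w$3 *\<^sub>R grad (dx 2 f) t (r *\<^sub>R w))"
  "ang_w 2 t r w = vector [- dx 3 f t (r *\<^sub>R w), 0, dx 1 f t (r *\<^sub>R w)]
        + r *\<^sub>R (w$3 *\<^sub>R grad (dx 1 f) t (r *\<^sub>R w) - w$1 *\<^sub>R grad (dx 3 f) t (r *\<^sub>R w))"
  "ang_w 3 t r w = vector [dx 2 f t (r *\<^sub>R w), - dx 1 f t (r *\<^sub>R w), 0]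
        + r *\<^sub>R (w$1 *\<^sub>R grad (dx 2 f) t (r *\<^sub>R w) - w$2 *\<^sub>R grad (dx 1 f) t (r *\<^sub>R w))"
  by (simp_all add: ang_w_def)

lemma ang_has_derivative_w:
  assumes "t \<in> {t1..t2}"
  shows "((\<lambda>w. ang t r w $ k) has_derivative (\<lambda>h. h \<bullet> ang_w k t r w)) (at w)"
proof -
  have "((\<lambda>w. ang t r w $ 1) has_derivative (\<lambda>h. h \<bullet> ang_w 1 t r w)) (at w)"
    unfolding ang_def cross3_nth grad_nth
    by (rule derivative_eq_intros dw_comps assms refl bounded_linear_imp_has_derivative[OF
        bounded_linear_vec_nth])+
       (simp add: fun_eq_iff inner_3 ang_w_nth algebra_simps)
  moreover have "((\<lambda>w. ang t r w $ 2) has_derivative (\<lambda>h. h \<bullet> ang_w 2 t r w)) (at w)"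
    unfolding ang_def cross3_nth grad_nth
    by (rule derivative_eq_intros dw_comps assms refl bounded_linear_imp_has_derivative[OF
        bounded_linear_vec_nth])+
       (simp add: fun_eq_iff inner_3 ang_w_nth algebra_simps)
  moreover have "((\<lambda>w. ang t r w $ 3) has_derivative (\<lambda>h. h \<bullet> ang_w 3 t r w)) (at w)"
    unfolding ang_def cross3_nth grad_nth
    by (rule derivative_eq_intros dw_comps assms refl bounded_linear_imp_has_derivative[OF
        bounded_linear_vec_nth])+
       (simp add: fun_eq_iff inner_3 ang_w_nth algebra_simps)
  ultimately show ?thesis using exhaust_3[of k] by auto
qed

definition multiplier :: "real \<Rightarrow> real \<Rightarrow> real^3 \<Rightarrow> real" where
  "multiplier t r w = 2 * (wtp t r * Lpsi t r w + wtm t r * Lbarpsi t r w)"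

text \<open>The gradient in w of the multiplier times the k-th component of
  \<open>ang\<close>.\<close>

definition fieldw :: "3 \<Rightarrow> real \<Rightarrow> real \<Rightarrow> real^3 \<Rightarrow> real^3" where
  "fieldw k t r w = multiplier t r w *\<^sub>R ang_w k t r w
    + (2 * ang t r w $ k) *\<^sub>R (wtp t r *\<^sub>R Lpsi_w t r w + wtm t r *\<^sub>R Lbarpsi_w t r w)"

lemma field_has_derivative_w:
  assumes "t \<in> {t1..t2}"
  shows "((\<lambda>w. multiplier t r w * ang t r w $ k) has_derivative (\<lambda>h. h \<bullet> fieldw k t r w)) (at w)"
  unfolding multiplier_def
  by (rule derivative_eq_intros Lpsi_has_derivative_w Lbarpsi_has_derivative_w ang_has_derivative_w
      assms refl)+
     (simp add: fun_eq_iff fieldw_def multiplier_def inner_add_right algebra_simps)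

text \<open>The angular divergence of the multiplier times the angular gradient, written as a sum of
  rotation derivatives. It has spherical mean zero.\<close>

definition rotdiv :: "real \<Rightarrow> real \<Rightarrow> real^3 \<Rightarrow> real" where
  "rotdiv t r w = cross3 w (fieldw 1 t r w) $ 1 + cross3 w (fieldw 2 t r w) $ 2 + cross3 w (fieldw 3 t r
      w) $ 3"

context
  fixes X :: "'a::t2_space set" and T R :: "'a \<Rightarrow> real" and Y :: "'a \<Rightarrow> real^3"
  assumes c: "continuous_on X T" "continuous_on X R" "continuous_on X Y"
    and T: "\<And>x. x \<in> X \<Longrightarrow> T x \<in> {t1..t2}"
begin

lemma cont_vector3:
  assumes "continuous_on X a" "continuous_on X b" "continuous_on X d"
  shows "continuous_on X (\<lambda>x. vector [a x, b x, d x] :: real^3)"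
proof -
  have "continuous_on X (\<lambda>x. \<chi> k. (vector [a x, b x, d x] :: real^3) $ k)"
  proof (rule continuous_on_vec_lambda)
    show "continuous_on X (\<lambda>x. (vector [a x, b x, d x] :: real^3) $ k)" for k
      using exhaust_3[of k] by (elim disjE; simp only: vector_3) (intro assms)+
  qed
  then show ?thesis by simp
qed

lemma cont_multiplier: "continuous_on X (\<lambda>x. multiplier (T x) (R x) (Y x))"
  unfolding multiplier_def by (intro continuous_intros cont_Lpsi cont_Lbarpsi c T)

lemma cont_ang_w: "continuous_on X (\<lambda>x. ang_w k (T x) (R x) (Y x))"
proof -
  have "continuous_on X (\<lambda>x. ang_w 1 (T x) (R x) (Y x))"
    unfolding ang_w_nth by (intro continuous_intros cont_vector3 cont_comps cont_grad[OF smooth2(3)] c T)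
  moreover have "continuous_on X (\<lambda>x. ang_w 2 (T x) (R x) (Y x))"
    unfolding ang_w_nth by (intro continuous_intros cont_vector3 cont_comps cont_grad[OF smooth2(3)] c T)
  moreover have "continuous_on X (\<lambda>x. ang_w 3 (T x) (R x) (Y x))"
    unfolding ang_w_nth by (intro continuous_intros cont_vector3 cont_comps cont_grad[OF smooth2(3)] c T)
  ultimately show ?thesis using exhaust_3[of k] by auto
qed

lemma cont_fieldw: "continuous_on X (\<lambda>x. fieldw k (T x) (R x) (Y x))"
  unfolding fieldw_def Lpsi_w_def Lbarpsi_w_def
  by (intro continuous_intros cont_multiplier cont_ang_w cont_ang cont_hessw cont_comps c T)

lemma cont_rotdiv: "continuous_on X (\<lambda>x. rotdiv (T x) (R x) (Y x))"
  unfolding rotdiv_def by (intro continuous_intros cont_cross3 cont_fieldw c)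

lemma cont_edens_t: "continuous_on X (\<lambda>x. edens_t (T x) (R x) (Y x))"
  unfolding edens_t_def Lpsi_t_def Lbarpsi_t_def ang2_t_def
  by (intro continuous_intros cont_Lpsi cont_Lbarpsi cont_ang cont_ang2 cont_cross3 cont_comps c T)

lemma cont_edens_r: "continuous_on X (\<lambda>x. edens_r (T x) (R x) (Y x))"
  unfolding edens_r_def Lpsi_r_def Lbarpsi_r_def ang2_r_def
  by (intro continuous_intros cont_Lpsi cont_Lbarpsi cont_ang cont_ang2 cont_hessw cont_cross3
      cont_comps c T)

lemma cont_eflux_r: "continuous_on X (\<lambda>x. eflux_r (T x) (R x) (Y x))"
  unfolding eflux_r_def Lpsi_r_def Lbarpsi_r_def ang2_r_def
  by (intro continuous_intros cont_Lpsi cont_Lbarpsi cont_ang cont_ang2 cont_hessw cont_cross3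
      cont_comps c T)

end

lemma smean_rotdiv:
  assumes "t \<in> {t1..t2}"
  shows "smean (rotdiv t r) = 0"
proof -
  have c: "continuous_on UNIV (fieldw k t r)" for k
    using cont_fieldw[of UNIV "\<lambda>_. t" "\<lambda>_. r" "\<lambda>w. w" k] assms by simp
  note z = smean_rotation_zero[OF field_has_derivative_w[OF assms] c]
  have c': "continuous_on UNIV (\<lambda>w. cross3 w (fieldw k t r w) $ k)" for k
    by (intro continuous_intros cont_cross3 c)
  have "smean (\<lambda>w. cross3 w (fieldw 1 t r w) $ 1) = 0" "smean (\<lambda>w. cross3 w (fieldw 2 t r w) $ 2) = 0"
    "smean (\<lambda>w. cross3 w (fieldw 3 t r w) $ 3) = 0"
    unfolding cross3_nth using z(3)[of 1] z(2)[of 2] z(1)[of 3] by auto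
  then show ?thesis
    unfolding rotdiv_def by (simp add: smean_add c' continuous_on_add)
qed

text \<open>The weight \<open>wtp\<close> is constant along incoming and \<open>wtm\<close> along
  outgoing null lines, so the null terms produce only the multiplier times the mixed null derivative
  of \<psi>. The wave operator replaces that by an angular Laplacian, and the product rule turns
  multiplier times Laplacian into \<open>rotdiv\<close> minus gradient terms. These cancel the
  derivatives of the angular energy except for those of its weights and of the power of r.\<close>

lemma energy_identity:
  assumes t: "t \<in> {t1..t2}" and w: "norm w = 1"
  shows "edens_t t r w + eflux_r t r w = rotdiv t r w
    + 2 * r * (r * (wt' s (t + r) + wt' s (t - r)) - (wtp t r - wtm t r)) * ang2 t r w
    - r * Defs.box f t (r *\<^sub>R w) * multiplier t r w"
proof -
  have w1: "w$1 * w$1 + w$2 * w$2 + w$3 * w$3 = 1"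
    using w by (simp add: norm_eq_1 inner_3)
  define q where "q = w \<bullet> grad f t (r *\<^sub>R w)"
  define h where "h = w \<bullet> hessw t r w"
  define a where "a = dt (dt f) t (r *\<^sub>R w)"
  define b where "b = Defs.box f t (r *\<^sub>R w)"
  have tr: "dx 1 (dx 1 f) t (r *\<^sub>R w) + dx 2 (dx 2 f) t (r *\<^sub>R w) + dx 3 (dx 3 f) t (r *\<^sub>R w) = b + a"
    by (simp add: b_def a_def box_def sum_3)
  \<comment> \<open>The spherical Laplacian of f divided by r equals r times (Laplacian minus second
    radial derivative) minus twice the radial derivative; here b + a is the Laplacian, h the second
    and q the first radial derivative.\<close>
  have I2: "cross3 w (ang_w 1 t r w) $ 1 + cross3 w (ang_w 2 t r w) $ 2 + cross3 w (ang_w 3 t r w) $ 3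
    = r * (b + a - h) - 2 * q"
  proof -
    define H where "H i j = dx i (dx j f) t (r *\<^sub>R w)" for i j
    have sym: "H 2 1 = H 1 2" "H 3 1 = H 1 3" "H 3 2 = H 2 3"
      unfolding H_def using dx_dx[OF t] by auto
    have h: "h = w$1 * (w$1 * H 1 1 + w$2 * H 1 2 + w$3 * H 1 3) + w$2 * (w$1 * H 1 2 + w$2 * H 2 2 +
        w$3 * H 2 3)
        + w$3 * (w$1 * H 1 3 + w$2 * H 2 3 + w$3 * H 3 3)"
      unfolding h_def inner_3 hessw_def by (simp add: inner_grad_eq flip: H_def) (simp add: sym)
    have "cross3 w (ang_w 1 t r w) $ 1 + cross3 w (ang_w 2 t r w) $ 2 + cross3 w (ang_w 3 t r w) $ 3
      = r * ((w$2 * w$2 + w$3 * w$3) * H 1 1 + (w$1 * w$1 + w$3 * w$3) * H 2 2 + (w$1 * w$1 + w$2 * w$2)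
          * H 3 3
        - 2 * (w$1 * w$2 * H 1 2 + w$1 * w$3 * H 1 3 + w$2 * w$3 * H 2 3)) - 2 * q"
      unfolding cross3_nth ang_w_nth q_def inner_grad_eq by (simp add: sym algebra_simps flip: H_def)
    also have "\<dots> = r * ((w$1 * w$1 + w$2 * w$2 + w$3 * w$3) * (H 1 1 + H 2 2 + H 3 3) - h) - 2 * q"
      unfolding h by (simp add: algebra_simps)
    finally show ?thesis using tr w1 by (simp add: H_def)
  qed
  have I1: "rotdiv t r w = multiplier t r w * (r * (b + a - h) - 2 * q)
    + 2 * (wtp t r * (ang t r w \<bullet> cross3 w (Lpsi_w t r w)) + wtm t r * (ang t r w \<bullet> cross3 w (Lbarpsi_w
        t r w)))"
    unfolding I2[symmetric] rotdiv_def fieldw_def cross3_nth inner_3 by (simp add: algebra_simps)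
  have X: "cross3 w (Lpsi_w t r w) = r\<^sup>2 *\<^sub>R cross3 w (grad (dt f) t (r *\<^sub>R w)) + (2 * r) *\<^sub>R ang t r w
      + r\<^sup>2 *\<^sub>R cross3 w (hessw t r w)"
    "cross3 w (Lbarpsi_w t r w) = r\<^sup>2 *\<^sub>R cross3 w (grad (dt f) t (r *\<^sub>R w)) - (2 * r) *\<^sub>R ang t r w -
        r\<^sup>2 *\<^sub>R cross3 w (hessw t r w)"
    unfolding Lpsi_w_def Lbarpsi_w_def ang_def vec_eq_iff forall_3 by (simp_all add: cross3_nth
        algebra_simps)
  have I3: "ang t r w \<bullet> cross3 w (Lpsi_w t r w) = r\<^sup>2 * ang2_t t r w / 2 + 2 * r * ang2 t r w + r\<^sup>2 *
      ang2_r t r w / 2"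
    "ang t r w \<bullet> cross3 w (Lbarpsi_w t r w) = r\<^sup>2 * ang2_t t r w / 2 - 2 * r * ang2 t r w - r\<^sup>2 * ang2_r
        t r w / 2"
    unfolding X ang2_t_def ang2_r_def ang2_def by (simp_all add: inner_add_right inner_diff_right)
  \<comment> \<open>The two mixed null derivatives of \<psi> agree. Their common value is the right
    side of \<open>I2\<close> minus r b, which is the wave operator in null form.\<close>
  have I4: "Lpsi_t t r w = Lpsi_r t r w + (r * a - 2 * q - r * h)" "Lbarpsi_t t r w = (r * a - 2 * q - r
      * h) - Lbarpsi_r t r w"
    unfolding Lpsi_t_def Lpsi_r_def Lbarpsi_t_def Lbarpsi_r_def a_def q_def h_def by (simp_all add:
        algebra_simps)
  show ?thesis
    unfolding I1 I3 I4 edens_t_def eflux_r_def multiplier_def b_def[symmetric] by (simp add: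
        algebra_simps power2_eq_square)
qed

end

subsection \<open>The energy inequality\<close>

lemma integral_scale:
  fixes g :: "real \<Rightarrow> real"
  assumes "0 \<le> b" "continuous_on {0..b} g"
  shows "integral {0..1} (\<lambda>l. b * g (l * b)) = integral {0..b} g"
proof -
  have "((\<lambda>l. b *\<^sub>R g (l * b)) has_integral integral {0 * b..1 * b} g) {0..1}"
  proof (rule has_integral_substitution)
    show "(\<lambda>l. l * b) ` {0..1} \<subseteq> {0..b}"
      using assms(1) by (auto intro!: mult_left_le_one_le)
  qed (use assms in \<open>auto intro!: derivative_eq_intros\<close>)
  then show ?thesis
    unfolding real_scaleR_def mult_zero_left mult_1_left by (rule integral_unique)
qed

text \<open>Joint differentiability comes from the partial derivatives together with continuity of
  the one in r. Time stays restricted to S, so the rule applies at end points of an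
  interval.\<close>

lemma chain_two_variables:
  fixes e et er :: "real \<Rightarrow> real \<Rightarrow> real"
  assumes et: "\<And>r. ((\<lambda>t. e t r) has_field_derivative et t r) (at t within S)"
    and er: "\<And>t r. t \<in> S \<Longrightarrow> ((\<lambda>r. e t r) has_field_derivative er t r) (at r)"
    and cer: "continuous_on (S \<times> UNIV) (\<lambda>p. er (fst p) (snd p))"
    and y: "(y has_field_derivative y') (at t within S)" and t: "t \<in> S"
  shows "((\<lambda>t. e t (y t)) has_field_derivative et t (y t) + er t (y t) * y') (at t within S)"
proof -
  have D: "((\<lambda>(t, r). e t r) has_derivative (\<lambda>(a, b). et t (y t) * a + blinfun_apply (er t (y t) *\<^sub>R
      id_blinfun) b)) (at (t, y t) within S \<times> UNIV)"
  proof (rule has_derivative_partialsI)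
    show "((\<lambda>x. e x (y t)) has_derivative (*) (et t (y t))) (at t within S)"
      using et by (simp add: has_field_derivative_def)
    show "((\<lambda>r. e t r) has_derivative blinfun_apply (er t r *\<^sub>R id_blinfun)) (at r within UNIV)" if "t \<in>
        S" for t r
      using er[OF that, of r] by (simp add: has_field_derivative_def scaleR_blinfun.rep_eq)
    have "continuous_on (S \<times> UNIV) (\<lambda>p. er (fst p) (snd p) *\<^sub>R (id_blinfun :: real \<Rightarrow>\<^sub>L real))"
      by (intro continuous_intros cer)
    then show "continuous (at (t, y t) within S \<times> UNIV) (\<lambda>(t, r). er t r *\<^sub>R (id_blinfun :: real \<Rightarrow>\<^sub>L real))"
      unfolding case_prod_beta' using t by (simp add: continuous_on_eq_continuous_within)
  qed auto
  have "((\<lambda>t. (\<lambda>(t, r). e t r) (t, y t)) has_derivative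
      (\<lambda>h. (\<lambda>(a, b). et t (y t) * a + blinfun_apply (er t (y t) *\<^sub>R id_blinfun) b) (h, y' * h))) (at t
          within S)"
    by (rule has_derivative_in_compose[of "\<lambda>t. (t, y t)" "\<lambda>h. (h, y' * h)"])
       (use y in \<open>auto simp: has_field_derivative_def intro!: derivative_eq_intros
           has_derivative_subset[OF D]\<close>)
  then show ?thesis
    unfolding has_field_derivative_def prod.case
    by (rule has_derivative_eq_rhs) (simp add: fun_eq_iff scaleR_blinfun.rep_eq algebra_simps)
qed

lemma continuous_on_integral_moving_end:
  fixes N :: "real \<Rightarrow> real \<Rightarrow> real"
  assumes N: "continuous_on ({\<alpha>..\<beta>} \<times> UNIV) (\<lambda>p. N (fst p) (snd p))" and c: "0 \<le> c + \<alpha>"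
  shows "continuous_on {\<alpha>..\<beta>} (\<lambda>t. integral {0..c + t} (N t))"
proof -
  let ?I = "{\<alpha>..\<beta>}"
  have C: "continuous_on X (\<lambda>x. N (a x) (b x))"
    if "continuous_on X a" "continuous_on X b" "\<And>x. x \<in> X \<Longrightarrow> a x \<in> ?I" for X :: "'x::t2_space set" and a b
    by (rule continuous_on_compose2[OF N, of X "\<lambda>x. (a x, b x)", unfolded fst_conv snd_conv])
       (use that in \<open>auto intro!: continuous_intros\<close>)
  have "continuous_on ?I (\<lambda>t. integral (cbox 0 1) (\<lambda>l. (c + t) * N t (l * (c + t))))"
    by (rule integral_continuous_on_param) (auto simp: split_beta intro!: continuous_intros C)
  moreover have "integral (cbox 0 1) (\<lambda>l. (c + t) * N t (l * (c + t))) = integral {0..c + t} (N t)" if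
      "t \<in> ?I" for t
    unfolding cbox_interval using c that by (intro integral_scale C) (auto intro!: continuous_intros)
  ultimately show ?thesis
    by (rule continuous_on_eq)
qed

text \<open>Divergence theorem for e and j on the region 0 \<le> r \<le> c + t, whose right side is
  an outgoing cone. There the outward contribution is e - j, on the axis it vanishes by
  \<open>j0\<close>, and N is the permitted defect. The balance bounds data at the earlier time
  \<alpha> by data at \<beta>.\<close>

lemma energy_transport:
  fixes e et er j jr N :: "real \<Rightarrow> real \<Rightarrow> real"
  assumes ab: "\<alpha> \<le> \<beta>" and c: "0 \<le> c + \<alpha>"
    and et: "\<And>t r. t \<in> {\<alpha>..\<beta>} \<Longrightarrow> ((\<lambda>t. e t r) has_field_derivative et t r) (at t within {\<alpha>..\<beta>})"
    and er: "\<And>t r. t \<in> {\<alpha>..\<beta>} \<Longrightarrow> ((\<lambda>r. e t r) has_field_derivative er t r) (at r)"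
    and jr: "\<And>t r. t \<in> {\<alpha>..\<beta>} \<Longrightarrow> ((\<lambda>r. j t r) has_field_derivative jr t r) (at r)"
    and ce: "continuous_on ({\<alpha>..\<beta>} \<times> UNIV) (\<lambda>p. e (fst p) (snd p))"
    and cet: "continuous_on ({\<alpha>..\<beta>} \<times> UNIV) (\<lambda>p. et (fst p) (snd p))"
    and cer: "continuous_on ({\<alpha>..\<beta>} \<times> UNIV) (\<lambda>p. er (fst p) (snd p))"
    and cj: "continuous_on ({\<alpha>..\<beta>} \<times> UNIV) (\<lambda>p. j (fst p) (snd p))"
    and cjr: "continuous_on ({\<alpha>..\<beta>} \<times> UNIV) (\<lambda>p. jr (fst p) (snd p))"
    and cN: "continuous_on ({\<alpha>..\<beta>} \<times> UNIV) (\<lambda>p. N (fst p) (snd p))"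
    and ineq: "\<And>t r. t \<in> {\<alpha>..\<beta>} \<Longrightarrow> 0 \<le> r \<Longrightarrow> - N t r \<le> et t r + jr t r"
    and j0: "\<And>t. t \<in> {\<alpha>..\<beta>} \<Longrightarrow> j t 0 = 0"
  shows "integral {0..c + \<alpha>} (e \<alpha>) + integral {\<alpha>..\<beta>} (\<lambda>t. e t (c + t) - j t (c + t))
    \<le> integral {0..c + \<beta>} (e \<beta>) + integral {\<alpha>..\<beta>} (\<lambda>t. integral {0..c + t} (N t))"
proof -
  let ?I = "{\<alpha>..\<beta>}"
  have C: "continuous_on X (\<lambda>x. g (a x) (b x))"
    if "continuous_on (?I \<times> UNIV) (\<lambda>p. g (fst p) (snd p))" "continuous_on X a" "continuous_on X b" "\<And>x.
        x \<in> X \<Longrightarrow> a x \<in> ?I"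
    for X :: "'x::t2_space set" and g :: "real \<Rightarrow> real \<Rightarrow> real" and a b
    by (rule continuous_on_compose2[OF that(1), of X "\<lambda>x. (a x, b x)", unfolded fst_conv snd_conv])
       (use that in \<open>auto intro!: continuous_intros\<close>)
  \<comment> \<open>Scaling r = l (c + t) fixes the domain of integration, so that differentiation
    under the integral sign applies; the motion of the boundary moves into the integrand.\<close>
  define F where "F t l = (c + t) * e t (l * (c + t))" for t l
  define F' where "F' t l = e t (l * (c + t)) + (c + t) * (et t (l * (c + t)) + er t (l * (c + t)) * l)"
      for t l
  have F: "((\<lambda>t. F t l) has_field_derivative F' t l) (at t within ?I)" if "t \<in> ?I" for t l
  proof -
    have "((\<lambda>t. e t (l * (c + t))) has_field_derivative et t (l * (c + t)) + er t (l * (c + t)) * l) (at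
        t within ?I)"
      by (rule chain_two_variables[OF _ er cer]) (use that in \<open>auto intro!: et derivative_eq_intros\<close>)
    then show ?thesis unfolding F_def F'_def by (auto intro!: derivative_eq_intros)
  qed
  have cF': "continuous_on (?I \<times> {0..1}) (\<lambda>p. F' (fst p) (snd p))"
    unfolding F'_def by (intro continuous_intros C[OF ce] C[OF cet] C[OF cer]) auto
  have cF: "continuous_on {0..1} (F t)" if "t \<in> ?I" for t
    unfolding F_def by (intro continuous_intros C[OF ce]) (use that in auto)
  define E where "E t = integral {0..1} (F t)" for t
  have E: "(E has_field_derivative integral {0..1} (F' t)) (at t within ?I)" if "t \<in> ?I" for t
    unfolding E_def
    using leibniz_rule_field_derivative[of ?I 0 1 F F' t] F cF' cF that
    by (auto simp: split_beta integrable_continuous_interval)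
  have Eeq: "E t = integral {0..c + t} (e t)" if "t \<in> ?I" for t
    unfolding E_def F_def using c that by (intro integral_scale C[OF ce]) (auto intro!: continuous_intros)
  have lower: "e t (c + t) - j t (c + t) - integral {0..c + t} (N t) \<le> integral {0..1} (F' t)" if t: "t
      \<in> ?I" for t
  proof -
    let ?b = "c + t"
    have b: "0 \<le> ?b" using t c by auto
    \<comment> \<open>The terms of \<open>F'\<close> without \<open>et\<close> form the exact
      derivative of l e. Subtracting the derivative of j prepares the comparison with
      \<open>ineq\<close>.\<close>
    have "((\<lambda>l. (e t (l * ?b) + l * (er t (l * ?b) * ?b)) - jr t (l * ?b) * ?b) has_integral
        (1 * e t (1 * ?b) - j t (1 * ?b)) - (0 * e t (0 * ?b) - j t (0 * ?b))) {0..1}"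
    proof (rule fundamental_theorem_of_calculus)
      fix l :: real
      have "((\<lambda>l. e t (l * ?b)) has_field_derivative er t (l * ?b) * ?b) (at l within {0..1})"
        by (rule DERIV_chain2[OF er[OF t]]) (auto intro!: derivative_eq_intros)
      moreover have "((\<lambda>l. j t (l * ?b)) has_field_derivative jr t (l * ?b) * ?b) (at l within {0..1})"
        by (rule DERIV_chain2[OF jr[OF t]]) (auto intro!: derivative_eq_intros)
      ultimately show "((\<lambda>l. l * e t (l * ?b) - j t (l * ?b)) has_vector_derivative
          (e t (l * ?b) + l * (er t (l * ?b) * ?b)) - jr t (l * ?b) * ?b) (at l within {0..1})"
        unfolding has_real_derivative_iff_has_vector_derivative[symmetric]
        by (auto intro!: derivative_eq_intros)
    qed simp
    then have 1: "((\<lambda>l. (e t (l * ?b) + l * (er t (l * ?b) * ?b)) - jr t (l * ?b) * ?b) has_integral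
        e t ?b - j t ?b) {0..1}"
      using j0[OF t] by simp
    have "(\<lambda>l. ?b * N t (l * ?b)) integrable_on {0..1}"
      using t by (auto intro!: integrable_continuous_interval continuous_intros C[OF cN])
    moreover have "integral {0..1} (\<lambda>l. ?b * N t (l * ?b)) = integral {0..?b} (N t)"
      using t by (intro integral_scale[OF b] C[OF cN]) (auto intro!: continuous_intros)
    ultimately have "((\<lambda>l. ?b * N t (l * ?b)) has_integral integral {0..?b} (N t)) {0..1}"
      by (simp only: has_integral_iff)
    from has_integral_diff[OF 1 this]
    have "((\<lambda>l. (e t (l * ?b) + l * (er t (l * ?b) * ?b)) - jr t (l * ?b) * ?b - ?b * N t (l * ?b))
        has_integral
        e t ?b - j t ?b - integral {0..?b} (N t)) {0..1}" .
    moreover have "(F' t has_integral integral {0..1} (F' t)) {0..1}"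
      unfolding F'_def using t
      by (auto intro!: integrable_integral integrable_continuous_interval continuous_intros C[OF ce]
          C[OF cet] C[OF cer])
    ultimately show ?thesis
    proof (rule has_integral_le)
      fix l :: real assume "l \<in> {0..1}"
      then have "?b * (- N t (l * ?b)) \<le> ?b * (et t (l * ?b) + jr t (l * ?b))"
        using b t by (intro mult_left_mono ineq) auto
      then show "(e t (l * ?b) + l * (er t (l * ?b) * ?b)) - jr t (l * ?b) * ?b - ?b * N t (l * ?b) \<le> F'
          t l"
        unfolding F'_def by (simp add: algebra_simps)
    qed
  qed
  note cint = continuous_on_integral_moving_end[OF cN c]
  have "((\<lambda>t. integral {0..1} (F' t)) has_integral E \<beta> - E \<alpha>) ?I"
    using ab E by (intro fundamental_theorem_of_calculus)
      (auto simp: has_real_derivative_iff_has_vector_derivative[symmetric])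
  moreover have ii: "(\<lambda>t. e t (c + t) - j t (c + t)) integrable_on ?I" "(\<lambda>t. integral {0..c + t} (N t))
      integrable_on ?I"
    by (auto intro!: integrable_continuous_interval cint continuous_intros C[OF ce] C[OF cj])
  have "((\<lambda>t. e t (c + t) - j t (c + t) - integral {0..c + t} (N t)) has_integral
      integral ?I (\<lambda>t. e t (c + t) - j t (c + t)) - integral ?I (\<lambda>t. integral {0..c + t} (N t))) ?I"
    by (intro has_integral_diff integrable_integral ii)
  ultimately have "integral ?I (\<lambda>t. e t (c + t) - j t (c + t)) - integral ?I (\<lambda>t. integral {0..c + t} (N
      t)) \<le> E \<beta> - E \<alpha>"
    using has_integral_le lower by blast
  then show ?thesis using ab by (simp add: Eeq)
qed

context smooth_wave begin

definition source :: "real \<Rightarrow> real \<Rightarrow> real^3 \<Rightarrow> real" where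
  "source t r w = \<bar>r * Defs.box f t (r *\<^sub>R w) * multiplier t r w\<bar>"

lemmas conts = cont_Lpsi cont_Lbarpsi cont_ang2 cont_edens cont_eflux cont_box cont_multiplier
    cont_rotdiv cont_edens_t cont_edens_r cont_eflux_r

lemma cont_source:
  fixes X :: "'a::t2_space set"
  assumes "continuous_on X T" "continuous_on X R" "continuous_on X Y" "\<And>x. x \<in> X \<Longrightarrow> T x \<in> {t1..t2}"
  shows "continuous_on X (\<lambda>x. source (T x) (R x) (Y x))"
  unfolding source_def by (intro continuous_intros conts assms)

text \<open>The premise has the shape of the continuity lemmas for densities, so each of them gives
  joint continuity of the spherical mean in (t, r).\<close>

lemma cont_smean:
  assumes "\<And>X :: ((real \<times> real) \<times> (real^3)) set. continuous_on X (\<lambda>p. fst (fst p)) \<Longrightarrow> continuous_on X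
      (\<lambda>p. snd (fst p)) \<Longrightarrow>
      continuous_on X snd \<Longrightarrow> (\<And>p. p \<in> X \<Longrightarrow> fst (fst p) \<in> {t1..t2}) \<Longrightarrow>
      continuous_on X (\<lambda>p. g (fst (fst p)) (snd (fst p)) (snd p))"
    and "S \<subseteq> {t1..t2}"
  shows "continuous_on (S \<times> UNIV) (\<lambda>p. smean (g (fst p) (snd p)))"
  by (rule smean_cont, rule assms(1)) (use assms(2) in \<open>auto intro!: continuous_intros\<close>)

text \<open>Averaging removes \<open>rotdiv\<close>, the trapezoidal estimate makes the angular bulk
  term nonnegative, and the source enters through its absolute value.\<close>

lemma energy_source_inequality:
  assumes t: "t \<in> {t1..t2}" and r: "0 \<le> r"
  shows "- smean (source t r) \<le> smean (edens_t t r) + smean (eflux_r t r)"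
proof -
  have c: "continuous_on UNIV (edens_t t r)" "continuous_on UNIV (eflux_r t r)" "continuous_on UNIV
      (source t r)" "continuous_on UNIV (rotdiv t r)"
    using t by (auto intro!: conts cont_source continuous_intros)
  have "smean (rotdiv t r) - smean (source t r) = smean (\<lambda>w. rotdiv t r w - source t r w)"
    by (simp add: smean_diff c)
  also have "\<dots> \<le> smean (\<lambda>w. edens_t t r w + eflux_r t r w)"
  proof (rule smean_mono)
    fix w :: "real^3" assume w: "norm w = 1"
    have "0 \<le> ang2 t r w" by (simp add: ang2_def)
    moreover have "0 \<le> t" using t t1 by simp
    ultimately have "0 \<le> 2 * r * (r * (wt' s (t + r) + wt' s (t - r)) - (wtp t r - wtm t r)) * ang2 t r w"
      using wt_trapezoid[OF s, of t r] r by (intro mult_nonneg_nonneg) auto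
    then show "rotdiv t r w - source t r w \<le> edens_t t r w + eflux_r t r w"
      unfolding energy_identity[OF t w] source_def by linarith
  qed (intro continuous_intros c)+
  also have "\<dots> = smean (edens_t t r) + smean (eflux_r t r)"
    by (simp add: smean_add c)
  finally show ?thesis by (simp add: smean_rotdiv[OF t])
qed

lemma eflux_origin: "t \<in> {t1..t2} \<Longrightarrow> eflux t 0 w = 0"
  by (simp add: eflux_def Lpsi_def Lbarpsi_def)

lemma energy_inequality:
  assumes \<tau>: "t1 \<le> \<tau>" "\<tau> \<le> t2" and c: "0 \<le> c + \<tau>"
  shows "integral {0..c + \<tau>} (\<lambda>r. smean (edens \<tau> r)) + integral {\<tau>..t2} (\<lambda>t. smean (edens t (c + t)) -
      smean (eflux t (c + t)))
    \<le> integral {0..c + t2} (\<lambda>r. smean (edens t2 r)) + integral {\<tau>..t2} (\<lambda>t. integral {0..c + t} (\<lambda>r.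
        smean (source t r)))"
proof (rule energy_transport[OF \<tau>(2) c])
  have sub: "{\<tau>..t2} \<subseteq> {t1..t2}" using \<tau> by auto
  show "continuous_on ({\<tau>..t2} \<times> UNIV) (\<lambda>p. smean (edens (fst p) (snd p)))"
    "continuous_on ({\<tau>..t2} \<times> UNIV) (\<lambda>p. smean (edens_t (fst p) (snd p)))"
    "continuous_on ({\<tau>..t2} \<times> UNIV) (\<lambda>p. smean (edens_r (fst p) (snd p)))"
    "continuous_on ({\<tau>..t2} \<times> UNIV) (\<lambda>p. smean (eflux (fst p) (snd p)))"
    "continuous_on ({\<tau>..t2} \<times> UNIV) (\<lambda>p. smean (eflux_r (fst p) (snd p)))"
    "continuous_on ({\<tau>..t2} \<times> UNIV) (\<lambda>p. smean (source (fst p) (snd p)))"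
    by (rule cont_smean[OF _ sub], intro conts cont_source, assumption+)+
  fix t r assume "t \<in> {\<tau>..t2}"
  then have t: "t \<in> {t1..t2}" using sub by blast
  show "((\<lambda>t. smean (edens t r)) has_real_derivative smean (edens_t t r)) (at t within {\<tau>..t2})"
    by (rule DERIV_smean)
       (use sub \<open>t \<in> {\<tau>..t2}\<close> in \<open>auto intro!: conts DERIV_subset[OF DERIV_edens_t] continuous_intros\<close>)
  show "((\<lambda>r. smean (edens t r)) has_real_derivative smean (edens_r t r)) (at r)"
    by (rule DERIV_smean) (use t in \<open>auto intro!: conts DERIV_edens_r continuous_intros\<close>)
  show "((\<lambda>r. smean (eflux t r)) has_real_derivative smean (eflux_r t r)) (at r)"
    by (rule DERIV_smean) (use t in \<open>auto intro!: conts DERIV_eflux_r continuous_intros\<close>)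
  show "smean (eflux t 0) = 0"
    using smean_const[of 0] smean_cong[of "eflux t 0" "\<lambda>w. 0"] eflux_origin[OF t] by simp
  show "- smean (source t r) \<le> smean (edens_t t r) + smean (eflux_r t r)" if "0 \<le> r"
    by (rule energy_source_inequality[OF t that])
qed

end

text \<open>Young's inequality at every scale d is equivalent to Cauchy-Schwarz. Its linear form can
  be integrated over the sphere and over r, and the scale is chosen only at the end.\<close>

lemma le_sqrt_mult_of_all_scales:
  fixes x a b :: real
  assumes "\<And>d. 0 < d \<Longrightarrow> x \<le> a / d + d * b" "0 \<le> a" "0 \<le> b"
  shows "x \<le> 2 * (sqrt a * sqrt b)"
proof -
  have "x \<le> 2 * (sqrt a * sqrt b) + e" if e: "e > 0" for e
  proof -
    define p q where "p = sqrt a" and "q = sqrt b"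
    have pq: "0 \<le> p" "0 \<le> q" "a = p\<^sup>2" "b = q\<^sup>2" using assms by (auto simp: p_def q_def)
    show ?thesis
    proof (cases "b = 0")
      case True
      \<comment> \<open>For b = 0 the best scale is infinite; this one already brings a / d below
        e.\<close>
      have pos: "0 < a / e + 1" using e assms(2) by (intro add_nonneg_pos) auto
      have "x \<le> a / (a / e + 1)"
        using assms(1)[OF pos] True by simp
      also have "\<dots> \<le> e"
        unfolding pos_divide_le_eq[OF pos] using e by (simp add: algebra_simps)
      finally show ?thesis using True by simp
    next
      case False
      then have q0: "q > 0" using pq by (cases "q = 0") auto
      \<comment> \<open>The best scale p / q, enlarged to remain positive when p = 0; the
        enlargement costs e / 2.\<close>
      define d where "d = (p + e / (2 * q)) / q"
      have d: "d > 0" using e q0 pq by (simp add: d_def add_nonneg_pos)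
      have "x \<le> p\<^sup>2 / d + d * q\<^sup>2" using assms(1)[OF d] pq by simp
      also have "d * q\<^sup>2 = p * q + e / 2" using q0 by (simp add: d_def power2_eq_square field_simps)
      also have "p\<^sup>2 / d \<le> p * q"
      proof -
        have "p\<^sup>2 \<le> (p * q) * d" using q0 pq e by (simp add: d_def field_simps power2_eq_square)
        then show ?thesis using d by (simp add: divide_le_eq)
      qed
      finally show ?thesis using e by (simp add: p_def q_def)
    qed
  qed
  then show ?thesis by (rule field_le_epsilon)
qed

section \<open>Absorbing the source term\<close>

context smooth_wave begin

definition boxdens :: "real \<Rightarrow> real \<Rightarrow> real^3 \<Rightarrow> real" where
  "boxdens t r w = wtp t r * (r * Defs.box f t (r *\<^sub>R w))\<^sup>2"

lemma cont_boxdens: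
  fixes X :: "'a::t2_space set"
  assumes "continuous_on X T" "continuous_on X R" "continuous_on X Y" "\<And>x. x \<in> X \<Longrightarrow> T x \<in> {t1..t2}"
  shows "continuous_on X (\<lambda>x. boxdens (T x) (R x) (Y x))"
  unfolding boxdens_def by (intro continuous_intros conts assms)

lemma wtm_le_wtp: "0 \<le> t \<Longrightarrow> 0 \<le> r \<Longrightarrow> wtm t r \<le> wtp t r"
  using s by (intro wt_mono) auto

lemma edens_ge: "wtp t r * (Lpsi t r w)\<^sup>2 + wtm t r * (Lbarpsi t r w)\<^sup>2 \<le> edens t r w"
  by (simp add: edens_def ang2_def)

lemma edens_nonneg: "0 \<le> edens t r w"
  by (simp add: edens_def ang2_def)

text \<open>Young's inequality for each null component. In the term with \<open>wtm\<close> the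
  weight on the source is raised to \<open>wtp\<close>, the weight used in the statement; the
  constants let the two squares of the source add up to exactly one
  \<open>boxdens / d\<close>.\<close>

lemma source_le:
  assumes t: "0 \<le> t" "0 \<le> r" and d: "0 < d"
  shows "source t r w \<le> boxdens t r w / d + d * (2 * edens t r w)"
proof -
  define X where "X = \<bar>r * Defs.box f t (r *\<^sub>R w)\<bar>"
  have yo: "2 * X * (K * \<bar>l\<bar>) \<le> K * X\<^sup>2 / (2 * d) + 2 * d * (K * l\<^sup>2)" if "0 \<le> K" for K l
  proof -
    have "0 \<le> K * (X - 2 * d * \<bar>l\<bar>)\<^sup>2 / (2 * d)" using that d by simp
    also have "\<dots> = K * X\<^sup>2 / (2 * d) + 2 * d * (K * l\<^sup>2) - 2 * X * (K * \<bar>l\<bar>)"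
      using d by (simp add: field_simps power2_eq_square)
    finally show ?thesis by simp
  qed
  have "source t r w = 2 * X * \<bar>wtp t r * Lpsi t r w + wtm t r * Lbarpsi t r w\<bar>"
    by (simp add: source_def X_def multiplier_def abs_mult del: distrib_left_numeral)
  also have "\<dots> \<le> 2 * X * (wtp t r * \<bar>Lpsi t r w\<bar>) + 2 * X * (wtm t r * \<bar>Lbarpsi t r w\<bar>)"
    unfolding distrib_left[symmetric]
    by (intro mult_left_mono order_trans[OF abs_triangle_ineq]) (auto simp: abs_mult X_def)
  also have "\<dots> \<le> (wtp t r * X\<^sup>2 / (2 * d) + 2 * d * (wtp t r * (Lpsi t r w)\<^sup>2)) + (wtm t r * X\<^sup>2 / (2 *
      d) + 2 * d * (wtm t r * (Lbarpsi t r w)\<^sup>2))"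
    by (intro add_mono yo) auto
  also have "wtm t r * X\<^sup>2 / (2 * d) \<le> wtp t r * X\<^sup>2 / (2 * d)"
    using wtm_le_wtp[OF t] d by (intro divide_right_mono mult_right_mono) auto
  also have "(wtp t r * X\<^sup>2 / (2 * d) + 2 * d * (wtp t r * (Lpsi t r w)\<^sup>2)) + (wtp t r * X\<^sup>2 / (2 * d) +
      2 * d * (wtm t r * (Lbarpsi t r w)\<^sup>2))
    = boxdens t r w / d + d * (2 * (wtp t r * (Lpsi t r w)\<^sup>2 + wtm t r * (Lbarpsi t r w)\<^sup>2))"
    by (simp add: boxdens_def X_def field_simps)
  also have "\<dots> \<le> boxdens t r w / d + d * (2 * edens t r w)"
    using edens_ge d by (intro add_left_mono mult_left_mono) auto
  finally show ?thesis by simp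
qed

definition energy :: "real \<Rightarrow> real \<Rightarrow> real" where
  "energy t b = integral {0..b} (\<lambda>r. smean (edens t r))"

definition boxint :: "real \<Rightarrow> real \<Rightarrow> real" where
  "boxint t b = integral {0..b} (\<lambda>r. smean (boxdens t r))"

lemma cont_smean_r:
  assumes "\<And>X :: (real \<times> (real^3)) set. continuous_on X fst \<Longrightarrow> continuous_on X snd \<Longrightarrow>
      continuous_on X (\<lambda>p. g (fst p) (snd p))"
  shows "continuous_on S (\<lambda>r. smean (g r))"
  by (rule smean_cont, rule assms(1)) (auto intro!: continuous_intros)

lemma source_integral_le:
  assumes t: "t \<in> {t1..t2}" and b: "0 \<le> b"
  shows "integral {0..b} (\<lambda>r. smean (source t r)) \<le> 2 * sqrt 2 * sqrt (boxint t b) * sqrt (energy t b)"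
proof -
  have t0: "0 \<le> t" using t t1 by simp
  have c: "continuous_on UNIV (source t r)" "continuous_on UNIV (boxdens t r)" "continuous_on UNIV
      (edens t r)" for r
    using t by (auto intro!: conts cont_source cont_boxdens continuous_intros)
  have i: "(\<lambda>r. smean (source t r)) integrable_on {0..b}" "(\<lambda>r. smean (boxdens t r)) integrable_on {0..b}"
    "(\<lambda>r. smean (edens t r)) integrable_on {0..b}"
    by (intro integrable_continuous_interval cont_smean_r conts cont_source cont_boxdens
        continuous_intros; use t in simp)+
  have nn: "0 \<le> boxint t b" "0 \<le> energy t b"
    unfolding boxint_def energy_def
    by (auto intro!: integral_nonneg i smean_nonneg c edens_nonneg simp: boxdens_def)
  have "integral {0..b} (\<lambda>r. smean (source t r)) \<le> boxint t b / d + d * (2 * energy t b)" if d: "0 < d"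
      for d
  proof -
    have "integral {0..b} (\<lambda>r. smean (source t r)) \<le> integral {0..b} (\<lambda>r. (1 / d) * smean (boxdens t r)
        + (2 * d) * smean (edens t r))"
    proof (rule integral_le)
      fix r assume "r \<in> {0..b}"
      then have r: "0 \<le> r" by simp
      have "smean (source t r) \<le> smean (\<lambda>w. (1 / d) * boxdens t r w + (2 * d) * edens t r w)"
        using source_le[OF t0 r d] by (intro smean_mono c continuous_intros) (simp add: algebra_simps)
      also have "\<dots> = (1 / d) * smean (boxdens t r) + (2 * d) * smean (edens t r)"
        unfolding smean_cmult[symmetric] by (intro smean_add continuous_intros c)
      finally show "smean (source t r) \<le> (1 / d) * smean (boxdens t r) + (2 * d) * smean (edens t r)" .
    qed (intro i integrable_add integrable_on_mult_right)+
    also have "\<dots> = (1 / d) * boxint t b + (2 * d) * energy t b"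
      unfolding boxint_def energy_def by (simp add: integral_add i integrable_on_mult_right del:
          times_divide_eq_left)
    also have "\<dots> = boxint t b / d + d * (2 * energy t b)" by simp
    finally show ?thesis .
  qed
  from le_sqrt_mult_of_all_scales[OF this nn(1)] nn(2) show ?thesis
    by (simp add: real_sqrt_mult mult_ac)
qed

text \<open>With M^2 the largest energy on the interval, the source integral is at most a multiple
  of M times the time integral of the source norm. This bounds M by a quadratic inequality, and
  inserting the bound at \<tau> keeps the cone term on the left.\<close>

lemma energy_bound:
  assumes \<tau>: "t1 \<le> \<tau>" "\<tau> \<le> t2" and c: "0 \<le> c + \<tau>"
  shows "energy \<tau> (c + \<tau>) + integral {\<tau>..t2} (\<lambda>t. smean (edens t (c + t)) - smean (eflux t (c + t)))
    \<le> (sqrt (energy t2 (c + t2)) + 2 * sqrt 2 * integral {\<tau>..t2} (\<lambda>t. sqrt (boxint t (c + t))))\<^sup>2"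
proof -
  let ?I = "{\<tau>..t2}"
  have sub: "?I \<subseteq> {t1..t2}" using \<tau> by auto
  have cc: "continuous_on (?I \<times> UNIV) (\<lambda>p. smean (edens (fst p) (snd p)))"
    "continuous_on (?I \<times> UNIV) (\<lambda>p. smean (eflux (fst p) (snd p)))"
    "continuous_on (?I \<times> UNIV) (\<lambda>p. smean (boxdens (fst p) (snd p)))"
    "continuous_on (?I \<times> UNIV) (\<lambda>p. smean (source (fst p) (snd p)))"
    by (rule cont_smean[OF _ sub], intro conts cont_source cont_boxdens, assumption+)+
  have cE: "continuous_on ?I (\<lambda>t. energy t (c + t))" and cn: "continuous_on ?I (\<lambda>t. boxint t (c + t))"
    and cs: "continuous_on ?I (\<lambda>t. integral {0..c + t} (\<lambda>r. smean (source t r)))"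
    unfolding energy_def boxint_def by (intro continuous_on_integral_moving_end cc c)+
  have cf: "continuous_on ?I (\<lambda>t. smean (edens t (c + t)) - smean (eflux t (c + t)))"
    by (intro continuous_intros continuous_on_compose2[OF cc(1), of _ "\<lambda>t. (t, c + t)", unfolded
        fst_conv snd_conv]
        continuous_on_compose2[OF cc(2), of _ "\<lambda>t. (t, c + t)", unfolded fst_conv snd_conv]) auto
  obtain m where m: "m \<in> ?I" "\<And>t. t \<in> ?I \<Longrightarrow> energy t (c + t) \<le> energy m (c + m)"
    using continuous_attains_sup[OF _ _ cE] \<tau> by auto
  have En: "0 \<le> energy t (c + t)" if "t \<in> ?I" for t
    unfolding energy_def using that sub
    by (intro integral_nonneg integrable_continuous_interval cont_smean_r smean_nonneg conts edens_nonneg)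
       (auto intro!: continuous_intros)
  define M where "M = sqrt (energy m (c + m))"
  define B where "B = integral ?I (\<lambda>t. sqrt (boxint t (c + t)))"
  define e where "e = sqrt (energy t2 (c + t2))"
  have M: "0 \<le> M" "M\<^sup>2 = energy m (c + m)" using En[OF m(1)] by (auto simp: M_def)
  have e: "0 \<le> e" "e\<^sup>2 = energy t2 (c + t2)" using En[of t2] \<tau> by (auto simp: e_def)
  have nn: "0 \<le> boxint t (c + t)" if "t \<in> ?I" for t
    unfolding boxint_def using that sub
    by (intro integral_nonneg integrable_continuous_interval cont_smean_r smean_nonneg cont_boxdens)
       (auto intro!: continuous_intros simp: boxdens_def)
  have ci: "(\<lambda>t. sqrt (boxint t (c + t))) integrable_on S" if "S = {\<sigma>..t2}" "\<sigma> \<in> ?I" for S \<sigma>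
    unfolding that using that by (intro integrable_continuous_interval continuous_intros
        continuous_on_subset[OF cn]) auto
  have B: "0 \<le> B" unfolding B_def using \<tau> nn by (intro integral_nonneg ci[OF refl]) auto
  have main: "energy \<sigma> (c + \<sigma>) + integral {\<sigma>..t2} (\<lambda>t. smean (edens t (c + t)) - smean (eflux t (c +
      t))) \<le> e\<^sup>2 + 2 * sqrt 2 * M * B"
    if \<sigma>: "\<sigma> \<in> ?I" for \<sigma>
  proof -
    have "energy \<sigma> (c + \<sigma>) + integral {\<sigma>..t2} (\<lambda>t. smean (edens t (c + t)) - smean (eflux t (c + t)))
      \<le> e\<^sup>2 + integral {\<sigma>..t2} (\<lambda>t. integral {0..c + t} (\<lambda>r. smean (source t r)))"
      unfolding e energy_def using \<sigma> \<tau> c by (intro energy_inequality) auto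
    also have "integral {\<sigma>..t2} (\<lambda>t. integral {0..c + t} (\<lambda>r. smean (source t r)))
        \<le> integral {\<sigma>..t2} (\<lambda>t. 2 * sqrt 2 * M * sqrt (boxint t (c + t)))"
    proof (rule integral_le)
      show "(\<lambda>t. integral {0..c + t} (\<lambda>r. smean (source t r))) integrable_on {\<sigma>..t2}"
        using \<sigma> by (intro integrable_continuous_interval continuous_on_subset[OF cs]) auto
      show "(\<lambda>t. 2 * sqrt 2 * M * sqrt (boxint t (c + t))) integrable_on {\<sigma>..t2}"
        by (intro integrable_on_mult_right ci[OF refl \<sigma>])
      fix t assume t: "t \<in> {\<sigma>..t2}"
      then have tI: "t \<in> ?I" using \<sigma> by auto
      have "integral {0..c + t} (\<lambda>r. smean (source t r)) \<le> 2 * sqrt 2 * sqrt (boxint t (c + t)) * sqrt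
          (energy t (c + t))"
        using tI sub c by (intro source_integral_le) auto
      also have "\<dots> \<le> 2 * sqrt 2 * sqrt (boxint t (c + t)) * M"
        unfolding M_def using m(2)[OF tI] nn[OF tI] by (intro mult_left_mono) auto
      finally show "integral {0..c + t} (\<lambda>r. smean (source t r)) \<le> 2 * sqrt 2 * M * sqrt (boxint t (c + t))"
        by (simp add: mult_ac)
    qed
    also have "\<dots> = 2 * sqrt 2 * M * integral {\<sigma>..t2} (\<lambda>t. sqrt (boxint t (c + t)))"
      by simp
    also have "integral {\<sigma>..t2} (\<lambda>t. sqrt (boxint t (c + t))) \<le> B"
      unfolding B_def using \<sigma> nn \<tau> by (intro integral_subset_le ci[OF refl]) auto
    finally show ?thesis using M(1) by (simp add: mult_left_mono)
  qed
  have fl: "0 \<le> integral {m..t2} (\<lambda>t. smean (edens t (c + t)) - smean (eflux t (c + t)))"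
  proof (rule integral_nonneg)
    show "(\<lambda>t. smean (edens t (c + t)) - smean (eflux t (c + t))) integrable_on {m..t2}"
      using m by (intro integrable_continuous_interval continuous_on_subset[OF cf]) auto
    fix t assume "t \<in> {m..t2}"
    then have "t \<in> {t1..t2}" using m sub by auto
    then show "0 \<le> smean (edens t (c + t)) - smean (eflux t (c + t))"
      by (auto intro!: smean_mono conts continuous_intros simp: edens_def eflux_def ang2_def algebra_simps)
  qed
  have "M\<^sup>2 \<le> e\<^sup>2 + 2 * sqrt 2 * M * B" using main[OF m(1)] fl M by simp
  \<comment> \<open>If this failed, then e \<le> M, so M^2 would exceed M e + 2 sqrt 2 M B, which is
    at least e^2 + 2 sqrt 2 M B.\<close>
  have "M \<le> e + 2 * sqrt 2 * B"
  proof (rule ccontr)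
    assume *: "\<not> M \<le> e + 2 * sqrt 2 * B"
    then have eM: "e \<le> M" using B by (smt (verit) mult_nonneg_nonneg real_sqrt_ge_zero)
    have "M * M > M * (e + 2 * sqrt 2 * B)" using * M(1) e(1) B by (intro mult_strict_left_mono) (auto
        simp: not_le intro: le_less_trans[rotated])
    moreover have "M * e \<ge> e * e" using eM e by (intro mult_right_mono)
    ultimately show False using \<open>M\<^sup>2 \<le> _\<close> by (simp add: power2_eq_square algebra_simps)
  qed
  then have "e\<^sup>2 + 2 * sqrt 2 * M * B \<le> e\<^sup>2 + 2 * sqrt 2 * (e + 2 * sqrt 2 * B) * B"
    using B by (intro add_left_mono mult_right_mono mult_left_mono) auto
  also have "\<dots> \<le> (e + 2 * sqrt 2 * B)\<^sup>2"
    using e B by (simp add: power2_eq_square algebra_simps)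
  finally show ?thesis using main[of \<tau>] \<tau> unfolding e_def B_def by auto
qed

end

subsection \<open>A weighted Hardy inequality\<close>

context smooth_wave begin

text \<open>The integrand of \<open>normplus\<close> times \<open>r\<^sup>2\<close>.\<close>

definition ndens :: "real \<Rightarrow> real \<Rightarrow> real^3 \<Rightarrow> real" where
  "ndens t r w = wtp t r * ((Lpsi t r w)\<^sup>2 + r\<^sup>2 * ang2 t r w) + wtm t r * ((Lbarpsi t r w)\<^sup>2 + (f t (r
      *\<^sub>R w))\<^sup>2)
    + wt (s - 1) (t - r) * (r * f t (r *\<^sub>R w))\<^sup>2"

text \<open>A sum of two Hardy primitives. The r-derivative of -u <u>^(2s-2) \<psi>^2, u = t - r,
  contains <u>^(2s-2) \<psi>^2 with positive sign; that of -<u>^(2s) \<psi>^2 / r contains <u>^(2s)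
  \<phi>^2. The second also differentiates its weight, and the large factor on the first absorbs
  that error.\<close>

definition hardy :: "real \<Rightarrow> real \<Rightarrow> real^3 \<Rightarrow> real" where
  "hardy t r w = - (16 * s\<^sup>2 + 2) * ((t - r) * wt (s - 1) (t - r) * (r * f t (r *\<^sub>R w))\<^sup>2)
    - 2 * (wtm t r * r * (f t (r *\<^sub>R w))\<^sup>2)"

definition hardy_r :: "real \<Rightarrow> real \<Rightarrow> real^3 \<Rightarrow> real" where
  "hardy_r t r w = (16 * s\<^sup>2 + 2) * (wt (s - 1) (t - r) * (r * f t (r *\<^sub>R w))\<^sup>2
      + 2 * (s - 1) * (t - r)\<^sup>2 * wt (s - 2) (t - r) * (r * f t (r *\<^sub>R w))\<^sup>2
      - 2 * (t - r) * wt (s - 1) (t - r) * (r * f t (r *\<^sub>R w)) * (f t (r *\<^sub>R w) + r * (w \<bullet> grad f t (r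
          *\<^sub>R w))))
    + 2 * (2 * s * (t - r) * wt (s - 1) (t - r) * (r * f t (r *\<^sub>R w)) * f t (r *\<^sub>R w)
      - wtm t r * (f t (r *\<^sub>R w))\<^sup>2 - 2 * wtm t r * f t (r *\<^sub>R w) * (r * (w \<bullet> grad f t (r *\<^sub>R w))))"

lemma DERIV_hardy: "t \<in> {t1..t2} \<Longrightarrow> ((\<lambda>r. hardy t r w) has_field_derivative hardy_r t r w) (at r)"
  unfolding hardy_def hardy_r_def
  by (rule derivative_eq_intros dr_comps refl | assumption)+ (simp add: algebra_simps power2_eq_square)

context
  fixes X :: "'a::t2_space set" and T R :: "'a \<Rightarrow> real" and Y :: "'a \<Rightarrow> real^3"
  assumes c: "continuous_on X T" "continuous_on X R" "continuous_on X Y"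
    and T: "\<And>x. x \<in> X \<Longrightarrow> T x \<in> {t1..t2}"
begin

lemma cont_ndens: "continuous_on X (\<lambda>x. ndens (T x) (R x) (Y x))"
  unfolding ndens_def by (intro continuous_intros conts cont_comps c T)

lemma cont_hardy: "continuous_on X (\<lambda>x. hardy (T x) (R x) (Y x))"
  unfolding hardy_def by (intro continuous_intros conts cont_comps c T)

lemma cont_hardy_r: "continuous_on X (\<lambda>x. hardy_r (T x) (R x) (Y x))"
  unfolding hardy_r_def by (intro continuous_intros conts cont_comps c T)

end

lemmas conts2 = conts cont_source cont_boxdens cont_ndens cont_hardy cont_hardy_r

lemma ndens_nonneg: "0 \<le> ndens t r w"
  by (simp add: ndens_def ang2_def)

text \<open>Young's inequality bounds the zeroth order terms by the radial derivative of the boundary term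
  \<open>hardy\<close> and the square of \<open>\<partial>\<^sub>r(r\<phi>) = (Lpsi - Lbarpsi) / 2\<close>.\<close>

lemma ndens_le:
  assumes "0 \<le> t" "0 \<le> r"
  shows "ndens t r w \<le> (16 * s\<^sup>2 + 7) * edens t r w + hardy_r t r w"
proof -
  define u where "u = t - r"
  define K where "K = wt (s - 1) u"
  define \<phi> where "\<phi> = f t (r *\<^sub>R w)"
  define p where "p = \<phi> + r * (w \<bullet> grad f t (r *\<^sub>R w))"
  have K: "0 \<le> K" by (simp add: K_def)
  have V: "wtm t r = (1 + u\<^sup>2) * K" using wt_add[of 1 "s - 1" u] by (simp add: u_def K_def)
  have p: "p = (Lpsi t r w - Lbarpsi t r w) / 2"
    by (simp add: p_def \<phi>_def Lpsi_def Lbarpsi_def algebra_simps)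
  have 1: "K * (r * \<phi>)\<^sup>2 - 2 * u * K * (r * \<phi>) * p \<ge> K * (r * \<phi>)\<^sup>2 / 2 - 2 * (wtm t r * p\<^sup>2)"
  proof -
    have "0 \<le> K * (r * \<phi> - 2 * u * p)\<^sup>2 / 2" using K by simp
    also have "\<dots> = (K * (r * \<phi>)\<^sup>2 - 2 * u * K * (r * \<phi>) * p) - (K * (r * \<phi>)\<^sup>2 / 2 - 2 * (u\<^sup>2 * K * p\<^sup>2))"
      by (simp add: power2_eq_square field_simps)
    finally have "K * (r * \<phi>)\<^sup>2 / 2 - 2 * (u\<^sup>2 * K * p\<^sup>2) \<le> K * (r * \<phi>)\<^sup>2 - 2 * u * K * (r * \<phi>) * p" by simp
    moreover have "u\<^sup>2 * K * p\<^sup>2 \<le> wtm t r * p\<^sup>2" unfolding V using K by (intro mult_right_mono) (auto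
        simp: algebra_simps)
    ultimately show ?thesis by linarith
  qed
  \<comment> \<open>The cross term from differentiating the weight. It is doubled below, so it costs
    8 s^2 times K (r \<phi>)^2, and half of 16 s^2 + 2 pays for this with exactly 1 to
    spare.\<close>
  have 2: "2 * s * u * K * (r * \<phi>) * \<phi> \<ge> - (wtm t r * \<phi>\<^sup>2 / 4) - 4 * s\<^sup>2 * (K * (r * \<phi>)\<^sup>2)"
  proof -
    have "0 \<le> K * (u * \<phi> / 2 + 2 * s * (r * \<phi>))\<^sup>2" using K by simp
    also have "\<dots> = 2 * s * u * K * (r * \<phi>) * \<phi> + u\<^sup>2 * K * \<phi>\<^sup>2 / 4 + 4 * s\<^sup>2 * (K * (r * \<phi>)\<^sup>2)"
      by (simp add: power2_eq_square algebra_simps)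
    finally have "0 \<le> 2 * s * u * K * (r * \<phi>) * \<phi> + u\<^sup>2 * K * \<phi>\<^sup>2 / 4 + 4 * s\<^sup>2 * (K * (r * \<phi>)\<^sup>2)" .
    moreover have "u\<^sup>2 * K * \<phi>\<^sup>2 \<le> wtm t r * \<phi>\<^sup>2" unfolding V using K by (intro mult_right_mono) (auto
        simp: algebra_simps)
    ultimately show ?thesis by linarith
  qed
  have 3: "- 2 * (wtm t r * \<phi> * p) \<ge> - (wtm t r * \<phi>\<^sup>2 / 4) - 4 * (wtm t r * p\<^sup>2)"
  proof -
    have "0 \<le> wtm t r * (\<phi> / 2 - 2 * p)\<^sup>2" by simp
    then show ?thesis by (simp add: power2_eq_square algebra_simps)
  qed
  have 4: "wtm t r * p\<^sup>2 \<le> edens t r w / 2"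
  proof -
    have "wtm t r * p\<^sup>2 \<le> wtm t r * (((Lpsi t r w)\<^sup>2 + (Lbarpsi t r w)\<^sup>2) / 2)"
    proof (rule mult_left_mono)
      have "0 \<le> (Lpsi t r w + Lbarpsi t r w)\<^sup>2" by simp
      then show "p\<^sup>2 \<le> ((Lpsi t r w)\<^sup>2 + (Lbarpsi t r w)\<^sup>2) / 2" by (simp add: p power2_eq_square
          algebra_simps)
    qed simp
    also have "\<dots> = (wtm t r * (Lpsi t r w)\<^sup>2 + wtm t r * (Lbarpsi t r w)\<^sup>2) / 2" by (simp add:
        algebra_simps)
    also have "\<dots> \<le> (wtp t r * (Lpsi t r w)\<^sup>2 + wtm t r * (Lbarpsi t r w)\<^sup>2) / 2"
      using wtm_le_wtp[OF assms] by (intro divide_right_mono add_right_mono mult_right_mono) auto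
    also have "\<dots> \<le> edens t r w / 2" using edens_ge by (intro divide_right_mono) auto
    finally show ?thesis .
  qed
  have 5: "0 \<le> 2 * (s - 1) * u\<^sup>2 * wt (s - 2) u * (r * \<phi>)\<^sup>2" using s by simp
  have "hardy_r t r w = (16 * s\<^sup>2 + 2) * ((K * (r * \<phi>)\<^sup>2 - 2 * u * K * (r * \<phi>) * p) + 2 * (s - 1) * u\<^sup>2
      * wt (s - 2) u * (r * \<phi>)\<^sup>2)
    + 2 * (2 * s * u * K * (r * \<phi>) * \<phi> + wtm t r * \<phi>\<^sup>2 + - 2 * (wtm t r * \<phi> * p))"
    unfolding hardy_r_def by (simp add: K_def p_def flip: u_def \<phi>_def) (simp add: power2_eq_square
        algebra_simps)
  also have "\<dots> \<ge> (16 * s\<^sup>2 + 2) * ((K * (r * \<phi>)\<^sup>2 / 2 - 2 * (wtm t r * p\<^sup>2)) + 0)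
    + 2 * ((- (wtm t r * \<phi>\<^sup>2 / 4) - 4 * s\<^sup>2 * (K * (r * \<phi>)\<^sup>2)) + wtm t r * \<phi>\<^sup>2 + (- (wtm t r * \<phi>\<^sup>2 / 4)
        - 4 * (wtm t r * p\<^sup>2)))"
    using 1 2 3 5 by (intro add_mono mult_left_mono order_refl) auto
  \<comment> \<open>Of the doubled \<open>wtm\<close> term 2 (1 - 1/4 - 1/4) = 1 is left, and the
    p^2 terms add up to 2 (16 s^2 + 2) + 8. Halved by \<open>4\<close> and increased by 1 for the
    derivative terms of \<open>ndens\<close>, this gives 16 s^2 + 7.\<close>
  finally have "wtm t r * \<phi>\<^sup>2 + K * (r * \<phi>)\<^sup>2 - (32 * s\<^sup>2 + 12) * (wtm t r * p\<^sup>2) \<le> hardy_r t r w"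
    by (simp add: field_simps)
  moreover have "(32 * s\<^sup>2 + 12) * (wtm t r * p\<^sup>2) \<le> (32 * s\<^sup>2 + 12) * (edens t r w / 2)"
    using 4 by (intro mult_left_mono) auto
  moreover have "wtp t r * ((Lpsi t r w)\<^sup>2 + r\<^sup>2 * ang2 t r w) + wtm t r * (Lbarpsi t r w)\<^sup>2 \<le> edens t r w"
    by (simp add: edens_def ang2_def algebra_simps)
  ultimately show ?thesis
    unfolding ndens_def by (simp add: K_def algebra_simps flip: u_def \<phi>_def)
qed

definition nint :: "real \<Rightarrow> real \<Rightarrow> real" where
  "nint t b = integral {0..b} (\<lambda>r. smean (ndens t r))"

lemma integrable_smean:
  assumes t: "t \<in> {t1..t2}"
  shows "(\<lambda>r. smean (ndens t r)) integrable_on {a..b}" "(\<lambda>r. smean (edens t r)) integrable_on {a..b}"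
    "(\<lambda>r. smean (hardy_r t r)) integrable_on {a..b}" "(\<lambda>r. smean (boxdens t r)) integrable_on {a..b}"
  by (intro integrable_continuous_interval cont_smean_r conts2 continuous_intros; use t in simp)+

lemma nint_mono:
  assumes "t \<in> {t1..t2}" "0 \<le> b" "b \<le> b'"
  shows "nint t b \<le> nint t b'"
  unfolding nint_def
  by (intro integral_subset_le integrable_smean)
     (use assms in \<open>auto intro!: smean_nonneg ndens_nonneg conts2 continuous_intros\<close>)

lemma nint_le:
  assumes t: "t \<in> {t1..t2}" and b: "0 \<le> b"
  shows "nint t b \<le> (16 * s\<^sup>2 + 7) * energy t b + smean (hardy t b)"
proof -
  have t0: "0 \<le> t" using t t1 by simp
  have c: "continuous_on UNIV (ndens t r)" "continuous_on UNIV (hardy_r t r)" "continuous_on UNIV (edens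
      t r)" for r
    using t by (auto intro!: conts2 continuous_intros)
  have "nint t b \<le> integral {0..b} (\<lambda>r. (16 * s\<^sup>2 + 7) * smean (edens t r) + smean (hardy_r t r))"
    unfolding nint_def
  proof (rule integral_le)
    fix r assume "r \<in> {0..b}"
    then have "smean (ndens t r) \<le> smean (\<lambda>w. (16 * s\<^sup>2 + 7) * edens t r w + hardy_r t r w)"
      using ndens_le[OF t0, of r] by (intro smean_mono c continuous_intros) auto
    then show "smean (ndens t r) \<le> (16 * s\<^sup>2 + 7) * smean (edens t r) + smean (hardy_r t r)"
      by (simp add: smean_add c continuous_on_mult_left smean_cmult)
  qed (intro integrable_add integrable_on_mult_right integrable_smean t)+
  also have "\<dots> = (16 * s\<^sup>2 + 7) * energy t b + integral {0..b} (\<lambda>r. smean (hardy_r t r))"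
    using integral_add[OF integrable_on_mult_right[OF integrable_smean(2)[OF t]] integrable_smean(3)[OF t]]
    by (simp add: energy_def)
  also have "((\<lambda>r. smean (hardy_r t r)) has_integral smean (hardy t b) - smean (hardy t 0)) {0..b}"
  proof (rule fundamental_theorem_of_calculus[OF b])
    fix r
    have "((\<lambda>r. smean (hardy t r)) has_real_derivative smean (hardy_r t r)) (at r)"
      by (rule DERIV_smean) (use t in \<open>auto intro!: conts2 DERIV_hardy continuous_intros\<close>)
    then show "((\<lambda>r. smean (hardy t r)) has_vector_derivative smean (hardy_r t r)) (at r within {0..b})"
      by (metis has_real_derivative_iff_has_vector_derivative has_vector_derivative_at_within)
  qed
  then have "integral {0..b} (\<lambda>r. smean (hardy_r t r)) = smean (hardy t b) - smean (hardy t 0)"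
    by (rule integral_unique)
  also have "smean (hardy t 0) = 0"
    using smean_const[of 0] smean_cong[of "hardy t 0" "\<lambda>w. 0"] by (simp add: hardy_def)
  finally show ?thesis by simp
qed

text \<open>Beyond r = t the first part of \<open>hardy\<close> is nonnegative and of size r^(2s+1)
  \<phi>^2, the square of the quantity in \<open>decay\<close>; the second part is nonpositive and
  is dropped.\<close>

lemma hardy_boundary_le:
  assumes t: "t \<in> {t1..t2}" and b: "1 \<le> b" "t \<le> b"
  shows "smean (hardy t b) \<le> (16 * s\<^sup>2 + 2) * 2 powr (s - 1) * (SUP x\<in>sphere 0 b. norm x powr (s + 1/2)
      * \<bar>f t x\<bar>)\<^sup>2 * smean (\<lambda>w. 1)"
proof -
  let ?m = "SUP x\<in>sphere (0::real^3) b. norm x powr (s + 1/2) * \<bar>f t x\<bar>"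
  have t0: "0 \<le> t" using t t1 by simp
  have "continuous_on (sphere 0 b) (\<lambda>x. norm x powr (s + 1/2) * \<bar>f t x\<bar>)"
    using t b by (intro continuous_intros cont_comps) auto
  then have "compact ((\<lambda>x. norm x powr (s + 1/2) * \<bar>f t x\<bar>) ` sphere 0 b)"
    by (intro compact_continuous_image) auto
  then have bdd: "bdd_above ((\<lambda>x. norm x powr (s + 1/2) * \<bar>f t x\<bar>) ` sphere 0 b)"
    by (intro bounded_imp_bdd_above compact_imp_bounded)
  have "smean (hardy t b) \<le> smean (\<lambda>w. (16 * s\<^sup>2 + 2) * 2 powr (s - 1) * ?m\<^sup>2)"
  proof (rule smean_mono)
    show "continuous_on UNIV (hardy t b)" using t by (auto intro!: conts2 continuous_intros)
    fix w :: "real^3" assume w: "norm w = 1"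
    let ?\<phi> = "f t (b *\<^sub>R w)"
    have m: "b powr (s + 1/2) * \<bar>?\<phi>\<bar> \<le> ?m"
      using cSUP_upper[OF _ bdd, of "b *\<^sub>R w"] w b by simp
    have "hardy t b w \<le> (16 * s\<^sup>2 + 2) * ((b - t) * wt (s - 1) (t - b) * (b * ?\<phi>)\<^sup>2)"
      using b by (simp add: hardy_def algebra_simps)
    also have "\<dots> \<le> (16 * s\<^sup>2 + 2) * (b * (2 * b\<^sup>2) powr (s - 1) * (b * ?\<phi>)\<^sup>2)"
    proof (intro mult_left_mono mult_right_mono mult_mono)
      have "(t - b)\<^sup>2 \<le> b\<^sup>2" using b t0 by (subst abs_le_square_iff[symmetric]) auto
      moreover have "1 \<le> b\<^sup>2" using b by simp
      ultimately have "1 + (t - b)\<^sup>2 \<le> 2 * b\<^sup>2" by linarith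
      then show "wt (s - 1) (t - b) \<le> (2 * b\<^sup>2) powr (s - 1)"
        unfolding wt_def using s by (intro powr_mono2) auto
    qed (use b t0 in auto)
    also have "b * (2 * b\<^sup>2) powr (s - 1) * (b * ?\<phi>)\<^sup>2 = 2 powr (s - 1) * (b powr (s + 1/2) * \<bar>?\<phi>\<bar>)\<^sup>2"
    proof -
      have "b * (b\<^sup>2) powr (s - 1) * b\<^sup>2 = (b powr (s + 1/2))\<^sup>2"
      proof -
        have sq: "b\<^sup>2 = b powr 2" using b by simp
        have "b * (b\<^sup>2) powr (s - 1) * b\<^sup>2 = b powr 1 * b powr (2 * (s - 1)) * b powr 2"
          unfolding sq powr_powr using b by simp
        also have "\<dots> = b powr (2 * (s + 1/2))"
          unfolding powr_add[symmetric] by (simp add: algebra_simps)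
        also have "\<dots> = (b powr (s + 1/2))\<^sup>2"
          by (simp add: power2_eq_square powr_add[symmetric])
        finally show ?thesis .
      qed
      then show ?thesis by (simp add: powr_mult power_mult_distrib algebra_simps)
    qed
    also have "(16 * s\<^sup>2 + 2) * (2 powr (s - 1) * (b powr (s + 1/2) * \<bar>?\<phi>\<bar>)\<^sup>2) \<le> (16 * s\<^sup>2 + 2) * (2
        powr (s - 1) * ?m\<^sup>2)"
      using m by (intro mult_left_mono power_mono) auto
    finally show "hardy t b w \<le> (16 * s\<^sup>2 + 2) * 2 powr (s - 1) * ?m\<^sup>2" by (simp add: mult.assoc)
  qed auto
  then show ?thesis by (simp only: smean_const[of "(16 * s\<^sup>2 + 2) * 2 powr (s - 1) * ?m\<^sup>2"])
qed

text \<open>The left side grows with the radius, so it may be compared with \<open>nint\<close> on a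
  much larger ball, whose Hardy boundary term tends to zero.\<close>

lemma nint_bound:
  assumes t: "t \<in> {t1..t2}" and d: "decay s f t" and Z: "\<And>b. 0 < b \<Longrightarrow> energy t b \<le> Z" and b: "0 \<le> b"
  shows "nint t b \<le> (16 * s\<^sup>2 + 7) * Z"
proof -
  let ?m = "\<lambda>b. SUP x\<in>sphere (0::real^3) b. norm x powr (s + 1/2) * \<bar>f t x\<bar>"
  let ?h = "\<lambda>b. (16 * s\<^sup>2 + 7) * Z + (16 * s\<^sup>2 + 2) * 2 powr (s - 1) * (?m b)\<^sup>2 * smean (\<lambda>w. 1)"
  have "(?m \<longlongrightarrow> 0) at_top" using d by (simp add: decay_def)
  then have "(?h \<longlongrightarrow> (16 * s\<^sup>2 + 7) * Z + (16 * s\<^sup>2 + 2) * 2 powr (s - 1) * 0\<^sup>2 * smean (\<lambda>w. 1)) at_top"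
    by (intro tendsto_intros)
  then have "(?h \<longlongrightarrow> (16 * s\<^sup>2 + 7) * Z) at_top" by simp
  moreover have "\<forall>\<^sub>F b' in at_top. nint t b \<le> ?h b'"
    using eventually_ge_at_top[of "max 1 (max t b)"]
  proof eventually_elim
    case (elim b')
    then have b': "1 \<le> b'" "t \<le> b'" "b \<le> b'" by auto
    have "nint t b \<le> nint t b'" by (rule nint_mono[OF t b b'(3)])
    also have "\<dots> \<le> (16 * s\<^sup>2 + 7) * energy t b' + smean (hardy t b')"
      using b' by (intro nint_le[OF t]) auto
    also have "\<dots> \<le> ?h b'"
      using b' by (intro add_mono mult_left_mono Z hardy_boundary_le[OF t]) auto
    finally show ?case .
  qed
  ultimately show ?thesis
    by (rule tendsto_lowerbound) simp
qed

end

subsection \<open>Comparison with the norms and the flux\<close>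

lemma enn_sqrt_ennreal: "0 \<le> v \<Longrightarrow> enn_sqrt (ennreal v) = ennreal (sqrt v)"
  by (simp add: enn_sqrt_def)

lemma enn_sqrt_mono: "v \<le> u \<Longrightarrow> enn_sqrt v \<le> enn_sqrt u"
  by (cases v; cases u) (auto simp: enn_sqrt_def top_unique ennreal_leI)

lemma enn_sqrt_scale:
  assumes "0 \<le> K"
  shows "enn_sqrt (ennreal (K\<^sup>2) * v) = ennreal K * enn_sqrt v"
proof (cases v)
  case (real r)
  then show ?thesis using assms
    by (simp add: enn_sqrt_ennreal ennreal_mult[symmetric] real_sqrt_mult)
next
  case top
  then show ?thesis using assms by (cases "K = 0") (auto simp: enn_sqrt_def ennreal_mult_top)
qed

lemma norm_omega: "x \<noteq> 0 \<Longrightarrow> norm (omega x) = 1"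
  by (simp add: omega_def)

lemma norm_scaleR_omega: "norm x *\<^sub>R omega x = x"
  by (cases "x = 0") (simp_all add: omega_def)

lemma omega_scaleR: "0 < b \<Longrightarrow> norm w = 1 \<Longrightarrow> omega (b *\<^sub>R w) = w"
  by (simp add: omega_def)

lemma omega_measurable: "omega \<in> borel_measurable borel"
  unfolding omega_def by measurable

text \<open>Bridge from the iterated Lebesgue integral in the statement to the planar integral
  \<open>smean\<close>, under which limits and derivatives are taken.\<close>

lemma sphint_continuous:
  assumes G: "continuous_on UNIV G" "\<And>w. 0 \<le> G w"
  shows "sphint (\<lambda>w. ennreal (G w)) = ennreal (smean G)"
proof -
  let ?g = "\<lambda>y. G (sph (fst y) (snd y)) * sin (fst y)"
  have cg: "continuous_on UNIV ?g"
    by (intro continuous_intros continuous_on_compose2[OF G(1)]) auto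
  have in_eq: "(\<integral>\<^sup>+ p\<in>{0..2 * pi}. ennreal (G (sph a p)) * ennreal (sin a) \<partial>lborel) = ennreal (integral
      {0..2 * pi} (\<lambda>p. ?g (a, p)))"
    if a: "a \<in> {0..pi}" for a
  proof -
    have sn: "0 \<le> sin a" using a sin_ge_zero by auto
    have "((\<lambda>p. ?g (a, p)) has_integral integral {0..2 * pi} (\<lambda>p. ?g (a, p))) {0..2 * pi}"
      by (intro integrable_integral integrable_continuous_interval continuous_on_compose2[OF cg]
          continuous_intros) auto
    from nn_integral_has_integral_lebesgue'[OF _ this] show ?thesis
      using sn G(2) by (simp add: ennreal_mult)
  qed
  have "sphint (\<lambda>w. ennreal (G w)) = (\<integral>\<^sup>+ a\<in>{0..pi}. ennreal (integral {0..2 * pi} (\<lambda>p. ?g (a, p)))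
      \<partial>lborel)"
    unfolding sphint_def by (rule nn_integral_cong) (use in_eq in \<open>simp add: indicator_def\<close>)
  also have "\<dots> = ennreal (integral {0..pi} (\<lambda>a. integral {0..2 * pi} (\<lambda>p. ?g (a, p))))"
  proof (rule nn_integral_has_integral_lebesgue')
    show "0 \<le> integral {0..2 * pi} (\<lambda>p. ?g (a, p))" if "a \<in> {0..pi}" for a
      using that G(2) sin_ge_zero
      by (intro integral_nonneg integrable_continuous_interval continuous_on_compose2[OF cg]
          continuous_intros) auto
    have "continuous_on {0..pi} (\<lambda>a. integral (cbox 0 (2 * pi)) (\<lambda>p. ?g (a, p)))"
      by (rule integral_continuous_on_param) (auto simp: split_beta intro!: continuous_on_compose2[OF
          G(1)] continuous_intros)
    then show "((\<lambda>a. integral {0..2 * pi} (\<lambda>p. ?g (a, p))) has_integral integral {0..pi} (\<lambda>a. integral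
        {0..2 * pi} (\<lambda>p. ?g (a, p)))) {0..pi}"
      by (intro integrable_integral integrable_continuous_interval) simp
  qed
  also have "integral {0..pi} (\<lambda>a. integral {0..2 * pi} (\<lambda>p. ?g (a, p))) = smean G"
    unfolding smean_def
    by (subst integral_prod_continuous[OF continuous_on_subset[OF cg]]) auto
  finally show ?thesis .
qed

section \<open>The norms, the source and the flux in polar form\<close>

context smooth_wave begin

lemma rphi_derivs:
  assumes t: "t \<in> {t1..t2}" and x: "x \<noteq> 0"
  shows "dt (rphi f) t x = norm x * dt f t x"
    and "grad (rphi f) t x = f t x *\<^sub>R omega x + norm x *\<^sub>R grad f t x"
proof -
  have "((\<lambda>\<tau>. norm x * f \<tau> x) has_field_derivative norm x * dt f t x) (at t)"
    by (intro DERIV_cmult dt_comps t)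
  then show "dt (rphi f) t x = norm x * dt f t x"
    unfolding dt_def[of "rphi f"] rphi_def by (rule DERIV_imp_deriv)
  have "dx i (rphi f) t x = f t x * omega x $ i + norm x * dx i f t x" for i
  proof -
    have "((\<lambda>h. norm (x + h *\<^sub>R axis i 1)) has_derivative (\<lambda>h. (h *\<^sub>R axis i 1) \<bullet> sgn x)) (at 0)"
      by (rule has_derivative_compose[of "\<lambda>h. x + h *\<^sub>R axis i 1" "\<lambda>h. h *\<^sub>R axis i 1" 0 UNIV norm "\<lambda>h.
          h \<bullet> sgn x"])
         (use GDERIV_norm[OF x] in \<open>auto intro!: derivative_eq_intros simp: gderiv_def\<close>)
    moreover have "(\<lambda>h::real. (h *\<^sub>R axis i 1) \<bullet> sgn x) = (*) (omega x $ i)"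
      by (simp add: fun_eq_iff inner_axis' omega_def sgn_div_norm)
    ultimately have 1: "((\<lambda>h. norm (x + h *\<^sub>R axis i 1)) has_field_derivative omega x $ i) (at 0)"
      by (simp add: has_field_derivative_def)
    have 2: "((\<lambda>h. f t (x + h *\<^sub>R axis i 1)) has_field_derivative dx i f t x) (at 0)"
      using smooth_on_DERIV_line[OF smooth, of t x 0 "axis i 1"] slabD[OF t] by (simp add: inner_grad_axis)
    have "((\<lambda>h. norm (x + h *\<^sub>R axis i 1) * f t (x + h *\<^sub>R axis i 1)) has_field_derivative
        omega x $ i * f t x + norm x * dx i f t x) (at 0)"
      using DERIV_mult[OF 1 2] by (simp add: ac_simps)
    then show ?thesis
      unfolding dx_def[of i "rphi f"] rphi_def by (simp add: DERIV_imp_deriv mult.commute)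
  qed
  then show "grad (rphi f) t x = f t x *\<^sub>R omega x + norm x *\<^sub>R grad f t x"
    by (simp add: vec_eq_iff grad_def)
qed

text \<open>Lagrange's identity for the cross product of a unit vector with p.\<close>

lemma ang2_norm:
  assumes w: "norm w = 1" and p: "p = grad f t (r *\<^sub>R w)"
  shows "(norm (p - (w \<bullet> p) *\<^sub>R w))\<^sup>2 = ang2 t r w"
proof -
  have w1: "w$1 * w$1 + w$2 * w$2 + w$3 * w$3 = 1"
    using w by (simp add: norm_eq_1 inner_3)
  have "ang2 t r w = (w$1 * w$1 + w$2 * w$2 + w$3 * w$3) * (p \<bullet> p) - (w \<bullet> p)\<^sup>2"
    unfolding ang2_def ang_def p[symmetric] inner_3 cross3_nth by (simp add: power2_eq_square algebra_simps)
  moreover have "w \<bullet> w = 1" using w by (simp add: norm_eq_1)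
  then have "(norm (p - (w \<bullet> p) *\<^sub>R w))\<^sup>2 = p \<bullet> p - (w \<bullet> p)\<^sup>2"
    unfolding power2_norm_eq_inner by (simp add: inner_diff_left inner_diff_right inner_commute
        power2_eq_square)
  ultimately show ?thesis using w1 by simp
qed

lemma rphi_null_frame:
  assumes t: "t \<in> {t1..t2}" and x: "x \<noteq> 0"
  shows "Lop (rphi f) t x = Lpsi t (norm x) (omega x)"
    and "Lbar (rphi f) t x = Lbarpsi t (norm x) (omega x)"
    and "(norm (angrad (rphi f) t x))\<^sup>2 = (norm x)\<^sup>2 * ang2 t (norm x) (omega x)"
proof -
  have w: "omega x \<bullet> omega x = 1" using norm_omega[OF x] by (simp add: norm_eq_1)
  show "Lop (rphi f) t x = Lpsi t (norm x) (omega x)" "Lbar (rphi f) t x = Lbarpsi t (norm x) (omega x)"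
    unfolding Lop_def Lbar_def dr_def rphi_derivs[OF assms] Lpsi_def Lbarpsi_def norm_scaleR_omega
    by (simp_all add: inner_add_right w algebra_simps)
  let ?p = "grad f t x"
  have "angrad (rphi f) t x = norm x *\<^sub>R (?p - (omega x \<bullet> ?p) *\<^sub>R omega x)"
    unfolding angrad_def rphi_derivs[OF assms] by (simp add: inner_add_right w algebra_simps)
  then show "(norm (angrad (rphi f) t x))\<^sup>2 = (norm x)\<^sup>2 * ang2 t (norm x) (omega x)"
    using ang2_norm[OF norm_omega[OF x], of ?p t "norm x"] by (simp add: norm_scaleR_omega
        power_mult_distrib)
qed

definition ndensx :: "real \<Rightarrow> real^3 \<Rightarrow> real" where
  "ndensx t x = ndens t (norm x) (omega x) / (norm x)\<^sup>2"

lemma normplus_eq: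
  assumes t: "t \<in> {t1..t2}"
  shows "normplus s f t = enn_sqrt (\<integral>\<^sup>+ x. ennreal (ndensx t x) \<partial>lborel)"
proof -
  have *: "wtm t r / (1 + (t - r)\<^sup>2) = wt (s - 1) (t - r)" for r
  proof -
    have "1 + (t - r)\<^sup>2 \<noteq> 0" using zero_le_power2[of "t - r"] by linarith
    then show ?thesis using wt_add[of "s - 1" 1 "t - r"] by simp
  qed
  have "(jp (t + norm x) powr (2 * s) * ((Lop (rphi f) t x)\<^sup>2 + (norm (angrad (rphi f) t x))\<^sup>2)
     + jp (t - norm x) powr (2 * s) * ((Lbar (rphi f) t x)\<^sup>2 + (f t x)\<^sup>2
          + (rphi f t x)\<^sup>2 / (jp (t - norm x))\<^sup>2)) / (norm x)\<^sup>2 = ndensx t x" if "x \<noteq> 0" for x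
    unfolding ndensx_def ndens_def rphi_null_frame[OF t that] jp_powr jp_power2 norm_scaleR_omega
        *[symmetric]
    by (simp add: rphi_def distrib_left)
  then show ?thesis
    unfolding normplus_def
    by (intro arg_cong[where f=enn_sqrt] nn_integral_cong_AE eventually_mono[OF AE_lborel_singleton[of
        0]]) simp
qed

lemma ndensx_nonneg: "0 \<le> ndensx t x"
  by (simp add: ndensx_def ndens_nonneg)

lemma cont_slice:
  assumes t: "t \<in> {t1..t2}"
  shows "continuous_on UNIV (\<lambda>p. ndens t (fst p) (snd p))" "continuous_on UNIV (\<lambda>p. boxdens t (fst p)
      (snd p))"
  using t by (auto intro!: conts2 continuous_intros)

lemma ball_ndensx:
  assumes t: "t \<in> {t1..t2}" and b: "0 < b"
  shows "(\<integral>\<^sup>+ x. ennreal (ndensx t x) * indicator (ball 0 b) x \<partial>lborel) = ennreal (nint t b)"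
  unfolding ndensx_def nint_def by (rule polar_nn_integral[OF cont_slice(1)[OF t] b ndens_nonneg])

lemma ndensx_measurable:
  assumes t: "t \<in> {t1..t2}"
  shows "(\<lambda>x. ndensx t x) \<in> borel_measurable borel"
proof -
  have "(\<lambda>x. (\<lambda>p. ndens t (fst p) (snd p)) (norm x, omega x)) \<in> borel_measurable borel"
      by (rule measurable_compose[OF _ borel_measurable_continuous_onI[OF cont_slice(1)[OF t]]])
         (intro borel_measurable_Pair omega_measurable borel_measurable_norm measurable_ident_sets refl)
  then show ?thesis unfolding ndensx_def by simp
qed

lemma nint_le_normplus:
  assumes t: "t \<in> {t1..t2}" and b: "0 < b"
  shows "ennreal (sqrt (nint t b)) \<le> normplus s f t"
proof -
  have "0 \<le> nint t b"
    unfolding nint_def using t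
    by (intro integral_nonneg integrable_smean smean_nonneg ndens_nonneg) (auto intro!: conts2
        continuous_intros)
  then have "ennreal (sqrt (nint t b)) = enn_sqrt (ennreal (nint t b))" by (simp add: enn_sqrt_ennreal)
  also have "\<dots> \<le> normplus s f t"
    unfolding normplus_eq[OF t] ball_ndensx[OF assms, symmetric]
    by (intro enn_sqrt_mono nn_integral_mono) (auto simp: indicator_def)
  finally show ?thesis .
qed

text \<open>Monotone convergence along balls of integer radius. The truncated integrals are finite
  numbers; only their limit could be infinite.\<close>

lemma normplus_le:
  assumes t: "t \<in> {t1..t2}" and Z: "0 \<le> Z" "\<And>b. 0 < b \<Longrightarrow> nint t b \<le> Z"
  shows "normplus s f t \<le> ennreal (sqrt Z)"
proof -
  note m = ndensx_measurable[OF t]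
  have "(\<integral>\<^sup>+ x. ennreal (ndensx t x) \<partial>lborel) = (\<integral>\<^sup>+ x. (SUP n. ennreal (ndensx t x) * indicator (ball 0
      (real (Suc n))) x) \<partial>lborel)"
  proof (rule nn_integral_cong)
    fix x :: "real^3"
    obtain n where n: "norm x < real (Suc n)" using reals_Archimedean2[of "norm x"] by (metis less_trans
        lessI of_nat_less_iff)
    show "ennreal (ndensx t x) = (SUP n. ennreal (ndensx t x) * indicator (ball 0 (real (Suc n))) x)"
    proof (rule antisym)
      have "ennreal (ndensx t x) = ennreal (ndensx t x) * indicator (ball 0 (real (Suc n))) x" using n
          by simp
      also have "\<dots> \<le> (SUP n. ennreal (ndensx t x) * indicator (ball 0 (real (Suc n))) x)" by (rule
          SUP_upper) simp
      finally show "ennreal (ndensx t x) \<le> (SUP n. ennreal (ndensx t x) * indicator (ball 0 (real (Suc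
          n))) x)" .
    qed (auto intro!: SUP_least simp: indicator_def)
  qed
  also have "\<dots> = (SUP n. \<integral>\<^sup>+ x. ennreal (ndensx t x) * indicator (ball 0 (real (Suc n))) x \<partial>lborel)"
  proof (rule nn_integral_monotone_convergence_SUP)
    show "incseq (\<lambda>n x. ennreal (ndensx t x) * indicator (ball 0 (real (Suc n))) x)"
      by (auto simp: incseq_def le_fun_def indicator_def)
    show "(\<lambda>x. ennreal (ndensx t x) * indicator (ball 0 (real (Suc n))) x) \<in> borel_measurable lborel" for n
      using m by (intro borel_measurable_times_ennreal borel_measurable_indicator) auto
  qed
  also have "\<dots> \<le> ennreal Z"
    by (rule SUP_least) (simp only: ball_ndensx[OF t] of_nat_0_less_iff zero_less_Suc, intro ennreal_leI
        Z(2), simp)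
  finally show ?thesis
    unfolding normplus_eq[OF t] enn_sqrt_ennreal[OF Z(1), symmetric] by (rule enn_sqrt_mono)
qed

text \<open>The factor 2 is due to the angular term, which has weight \<open>wtp + wtm\<close> in
  the energy but only \<open>wtp\<close> in the norm.\<close>

lemma edens_le_ndens:
  assumes "0 \<le> t" "0 \<le> r"
  shows "edens t r w \<le> 2 * ndens t r w"
proof -
  have "wtm t r * (r\<^sup>2 * ang2 t r w) \<le> wtp t r * (r\<^sup>2 * ang2 t r w)"
    using wtm_le_wtp[OF assms] by (intro mult_right_mono) (auto simp: ang2_def)
  moreover have "0 \<le> wtp t r * (Lpsi t r w)\<^sup>2" "0 \<le> wtm t r * (Lbarpsi t r w)\<^sup>2" "0 \<le> wtm t r * (f t (r
      *\<^sub>R w))\<^sup>2"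
    "0 \<le> wt (s - 1) (t - r) * (r * f t (r *\<^sub>R w))\<^sup>2" by auto
  ultimately show ?thesis
    unfolding edens_def ndens_def distrib_left distrib_right by linarith
qed

lemma energy_le_nint:
  assumes t: "t \<in> {t1..t2}"
  shows "energy t b \<le> 2 * nint t b"
proof -
  have t0: "0 \<le> t" using t t1 by simp
  have c: "continuous_on UNIV (ndens t r)" "continuous_on UNIV (edens t r)" for r
    using t by (auto intro!: conts2 continuous_intros)
  have "energy t b \<le> integral {0..b} (\<lambda>r. 2 * smean (ndens t r))"
    unfolding energy_def
  proof (rule integral_le)
    fix r assume "r \<in> {0..b}"
    then have "smean (edens t r) \<le> smean (\<lambda>w. 2 * ndens t r w)"
      using edens_le_ndens[OF t0, of r] by (intro smean_mono c continuous_intros) auto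
    then show "smean (edens t r) \<le> 2 * smean (ndens t r)" by (simp only: smean_cmult)
  qed (intro integrable_on_mult_right integrable_smean t)+
  then show ?thesis by (simp add: nint_def)
qed

lemma boxint_nonneg:
  assumes t: "t \<in> {t1..t2}"
  shows "0 \<le> boxint t b"
  unfolding boxint_def using t
  by (intro integral_nonneg integrable_smean smean_nonneg) (auto intro!: conts2 continuous_intros simp:
      boxdens_def)

lemma boxint_le_L2norm:
  assumes t: "t \<in> {t1..t2}" and b: "0 \<le> b"
  shows "ennreal (sqrt (boxint t b)) \<le> L2norm (\<lambda>x. jp (t + norm x) powr s * Defs.box f t x)"
proof (cases "b = 0")
  case True
  then show ?thesis by (simp add: boxint_def)
next
  case False
  then have b: "0 < b" using b by simp
  have "ennreal (sqrt (boxint t b)) = enn_sqrt (ennreal (boxint t b))" by (simp add: enn_sqrt_ennreal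
      boxint_nonneg[OF t])
  also have "ennreal (boxint t b) = (\<integral>\<^sup>+ x. ennreal (boxdens t (norm x) (omega x) / (norm x)\<^sup>2) *
      indicator (ball 0 b) x \<partial>lborel)"
    unfolding boxint_def by (rule polar_nn_integral[OF cont_slice(2)[OF t] b, symmetric]) (simp add:
        boxdens_def)
  also have "\<dots> \<le> (\<integral>\<^sup>+ x. ennreal ((jp (t + norm x) powr s * Defs.box f t x)\<^sup>2) \<partial>lborel)"
  proof (rule nn_integral_mono)
    fix x :: "real^3"
    have "(wt (s / 2) (t + norm x))\<^sup>2 = wtp t (norm x)"
      using wt_add[of "s/2" "s/2" "t + norm x"] by (simp add: power2_eq_square)
    \<comment> \<open>At the origin the quotient is 0 / 0 = 0, so the bound holds there as
      well.\<close>
    then have "boxdens t (norm x) (omega x) / (norm x)\<^sup>2 \<le> (jp (t + norm x) powr s * Defs.box f t x)\<^sup>2"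
      by (cases "x = 0") (auto simp: boxdens_def norm_scaleR_omega jp_powr power_mult_distrib)
    then show "ennreal (boxdens t (norm x) (omega x) / (norm x)\<^sup>2) * indicator (ball 0 b) x
        \<le> ennreal ((jp (t + norm x) powr s * Defs.box f t x)\<^sup>2)"
      by (auto simp: indicator_def ennreal_leI)
  qed
  finally show ?thesis unfolding L2norm_def by (simp add: enn_sqrt_mono)
qed

text \<open>Before time t2 - R the cone is empty, hence the lower limit \<tau>. The half comes from
  \<open>edens - eflux\<close> being twice the flux density.\<close>

lemma flux_le:
  assumes R: "0 < R"
  defines "\<tau> \<equiv> max t1 (t2 - R)"
  shows "flux s f R t1 t2 \<le> ennreal (integral {\<tau>..t2} (\<lambda>t. smean (edens t (R - t2 + t)) - smean (eflux t
      (R - t2 + t))) / 2)"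
proof -
  let ?c = "R - t2"
  let ?G = "\<lambda>t. smean (edens t (?c + t)) - smean (eflux t (?c + t))"
  have sub: "{\<tau>..t2} \<subseteq> {t1..t2}" by (auto simp: \<tau>_def)
  have c: "continuous_on UNIV (edens t r)" "continuous_on UNIV (eflux t r)" if "t \<in> {t1..t2}" for t r
    using that by (auto intro!: conts2 continuous_intros)
  have diff: "edens t r w - eflux t r w = 2 * (wtp t r * (Lpsi t r w)\<^sup>2 + wtm t r * (r\<^sup>2 * ang2 t r w))"
      for t r w
    by (simp add: edens_def eflux_def algebra_simps)
  have G0: "0 \<le> ?G t" if "t \<in> {t1..t2}" for t
    using smean_mono[OF c(2)[OF that] c(1)[OF that], of "?c + t" "?c + t"] diff[of t "?c + t"]
    by (simp add: ang2_def) (smt (verit) inner_ge_zero mult_nonneg_nonneg wt_nonneg zero_le_power2)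
  have cG: "continuous_on {\<tau>..t2} ?G"
  proof -
    have cc: "continuous_on ({\<tau>..t2} \<times> UNIV) (\<lambda>p. smean (edens (fst p) (snd p)))"
      "continuous_on ({\<tau>..t2} \<times> UNIV) (\<lambda>p. smean (eflux (fst p) (snd p)))"
      by (rule cont_smean[OF _ sub], intro conts, assumption+)+
    show ?thesis
      by (intro continuous_intros continuous_on_compose2[OF cc(1), of _ "\<lambda>t. (t, ?c + t)", unfolded
          fst_conv snd_conv]
        continuous_on_compose2[OF cc(2), of _ "\<lambda>t. (t, ?c + t)", unfolded fst_conv snd_conv]) auto
  qed
  have slice: "sphint (\<lambda>w. let x = (R - (t2 - t)) *\<^sub>R w in
         ennreal (jp (t + norm x) powr (2 * s) * (Lop (rphi f) t x)\<^sup>2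
                + jp (t - norm x) powr (2 * s) * (norm (angrad (rphi f) t x))\<^sup>2)) = ennreal (?G t / 2)"
    if t: "t \<in> {t1..t2}" and b: "0 < R - (t2 - t)" for t
  proof -
    let ?b = "?c + t"
    let ?H = "\<lambda>w. wtp t ?b * (Lpsi t ?b w)\<^sup>2 + wtm t ?b * (?b\<^sup>2 * ang2 t ?b w)"
    have b': "R - (t2 - t) = ?b" by simp
    have eq: "(let x = ?b *\<^sub>R w in ennreal (jp (t + norm x) powr (2 * s) * (Lop (rphi f) t x)\<^sup>2
                + jp (t - norm x) powr (2 * s) * (norm (angrad (rphi f) t x))\<^sup>2)) = ennreal (?H w)" if
                    w: "norm w = 1" for w
    proof -
      have x: "?b *\<^sub>R w \<noteq> 0" using b w by auto
      have n: "norm (?b *\<^sub>R w) = ?b" "omega (?b *\<^sub>R w) = w" using b w omega_scaleR[of ?b w] by auto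
      show ?thesis
        unfolding Let_def rphi_null_frame[OF t x] n jp_powr by simp
    qed
    have "sphint (\<lambda>w. let x = ?b *\<^sub>R w in ennreal (jp (t + norm x) powr (2 * s) * (Lop (rphi f) t x)\<^sup>2
                + jp (t - norm x) powr (2 * s) * (norm (angrad (rphi f) t x))\<^sup>2)) = sphint (\<lambda>w. ennreal
                    (?H w))"
      unfolding sphint_def using eq[OF norm_sph] by simp
    also have "\<dots> = ennreal (smean ?H)"
      using t by (intro sphint_continuous) (auto intro!: conts2 continuous_intros simp: ang2_nonneg)
    also have "smean ?H = ?G t / 2"
    proof -
      have "?G t = smean (\<lambda>w. 2 * ?H w)"
        unfolding diff[symmetric] by (rule smean_diff[OF c(1)[OF t] c(2)[OF t], symmetric])
      then show ?thesis by (simp only: smean_cmult)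
    qed
    finally show ?thesis unfolding b' .
  qed
  have "flux s f R t1 t2 \<le> (\<integral>\<^sup>+ t. ennreal (?G t / 2) * indicator {\<tau>..t2} t \<partial>lborel)"
    unfolding flux_def
  \<comment> \<open>At the vertex time t2 - R the radius is zero and the null frame is undefined;
    this single time is discarded.\<close>
  proof (rule nn_integral_mono_AE, rule eventually_mono[OF AE_lborel_singleton[of "t2 - R"]])
    fix t assume ne: "t \<noteq> t2 - R"
    show "(if R - (t2 - t) < 0 then 0 else sphint (\<lambda>w. let x = (R - (t2 - t)) *\<^sub>R w in
         ennreal (jp (t + norm x) powr (2 * s) * (Lop (rphi f) t x)\<^sup>2
                + jp (t - norm x) powr (2 * s) * (norm (angrad (rphi f) t x))\<^sup>2))) * indicator {t1..t2} t
        \<le> ennreal (?G t / 2) * indicator {\<tau>..t2} t"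
    proof (cases "t \<in> {t1..t2} \<and> 0 < R - (t2 - t)")
      case True
      then show ?thesis using slice[of t] by (auto simp: \<tau>_def indicator_def)
    next
      case False
      then show ?thesis using ne by (auto simp: indicator_def)
    qed
  qed
  also have "\<dots> = ennreal (integral {\<tau>..t2} (\<lambda>t. ?G t / 2))"
  proof (rule nn_integral_has_integral_lebesgue')
    show "0 \<le> ?G t / 2" if "t \<in> {\<tau>..t2}" for t using G0[of t] sub that by auto
    show "((\<lambda>t. ?G t / 2) has_integral integral {\<tau>..t2} (\<lambda>t. ?G t / 2)) {\<tau>..t2}"
      by (intro integrable_integral integrable_continuous_interval continuous_intros cG) auto
  qed
  finally show ?thesis by simp
qed

lemma weighted_estimate:
  assumes d: "decay s f t1"
  shows "normplus s f t1 + (SUP R\<in>{0<..}. enn_sqrt (flux s f R t1 t2))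
    \<le> ennreal (2 * sqrt 2 * (sqrt (16 * s\<^sup>2 + 7) + 1)) * (normplus s f t2 +
        (\<integral>\<^sup>+ t\<in>{t1..t2}. L2norm (\<lambda>x. jp (t + norm x) powr s * Defs.box f t x) \<partial>lborel))"
proof -
  let ?C = "2 * sqrt 2 * (sqrt (16 * s\<^sup>2 + 7) + 1)"
  let ?I = "\<integral>\<^sup>+ t\<in>{t1..t2}. L2norm (\<lambda>x. jp (t + norm x) powr s * Defs.box f t x) \<partial>lborel"
  have C: "0 < ?C" by (simp add: add_nonneg_pos)
  show ?thesis
  proof (cases "normplus s f t2 + ?I = top")
    case True
    \<comment> \<open>Needed because 0 * top = 0 in \<open>ennreal\<close>: an infinite right side
      is trivial only for a positive constant.\<close>
    have "ennreal ?C \<noteq> 0" using C by (simp only: ennreal_eq_0_iff not_le)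
    then show ?thesis unfolding True by (simp only: ennreal_mult_top if_False top_greatest)
  next
    case False
    then have fin: "normplus s f t2 \<noteq> top" "?I \<noteq> top" by auto
    then obtain N where N: "normplus s f t2 = ennreal N" "0 \<le> N" by (cases "normplus s f t2") auto
    obtain I where I: "?I = ennreal I" "0 \<le> I" using fin(2) by (cases ?I) auto
    \<comment> \<open>The first sqrt 2 comes from \<open>energy_le_nint\<close> at time t2, the
      factor 2 sqrt 2 from \<open>energy_bound\<close>.\<close>
    define \<Lambda> where "\<Lambda> = sqrt 2 * N + 2 * sqrt 2 * I"
    have \<Lambda>: "0 \<le> \<Lambda>" using N I by (simp add: \<Lambda>_def)
    have t1I: "t1 \<in> {t1..t2}" and t2I: "t2 \<in> {t1..t2}" using t12 by auto
    have e2: "sqrt (energy t2 b) \<le> sqrt 2 * N" if b: "0 < b" for b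
    proof -
      have "sqrt (nint t2 b) \<le> N"
        using nint_le_normplus[OF t2I b] N by simp
      then have "sqrt 2 * sqrt (nint t2 b) \<le> sqrt 2 * N" by simp
      moreover have "sqrt (energy t2 b) \<le> sqrt 2 * sqrt (nint t2 b)"
        using energy_le_nint[OF t2I, of b] by (simp flip: real_sqrt_mult)
      ultimately show ?thesis by linarith
    qed
    have nI: "integral {\<tau>..t2} (\<lambda>t. sqrt (boxint t (c + t))) \<le> I" if \<tau>: "t1 \<le> \<tau>" "\<tau> \<le> t2" "0 \<le> c + \<tau>"
        for \<tau> c
    proof -
      have sub: "{\<tau>..t2} \<subseteq> {t1..t2}" using \<tau> by auto
      have "continuous_on ({\<tau>..t2} \<times> UNIV) (\<lambda>p. smean (boxdens (fst p) (snd p)))"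
        by (rule cont_smean[OF _ sub], intro conts2, assumption+)
      from continuous_on_integral_moving_end[OF this \<tau>(3)]
      have "continuous_on {\<tau>..t2} (\<lambda>t. sqrt (boxint t (c + t)))"
        unfolding boxint_def by (intro continuous_intros)
      then have "((\<lambda>t. sqrt (boxint t (c + t))) has_integral integral {\<tau>..t2} (\<lambda>t. sqrt (boxint t (c +
          t)))) {\<tau>..t2}"
        by (intro integrable_integral integrable_continuous_interval)
      from nn_integral_has_integral_lebesgue'[OF _ this]
      have "ennreal (integral {\<tau>..t2} (\<lambda>t. sqrt (boxint t (c + t)))) = (\<integral>\<^sup>+ t. ennreal (sqrt (boxint t
          (c + t))) * indicator {\<tau>..t2} t \<partial>lborel)"
        using boxint_nonneg sub by auto
      also have "\<dots> \<le> ?I"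
      proof (rule nn_integral_mono)
        fix t
        show "ennreal (sqrt (boxint t (c + t))) * indicator {\<tau>..t2} t
          \<le> L2norm (\<lambda>x. jp (t + norm x) powr s * Defs.box f t x) * indicator {t1..t2} t"
          using boxint_le_L2norm[of t "c + t"] \<tau> by (auto simp: indicator_def)
      qed
      finally show ?thesis using I by (simp add: ennreal_le_iff)
    qed
    have bound: "energy \<tau> (c + \<tau>) + integral {\<tau>..t2} (\<lambda>t. smean (edens t (c + t)) - smean (eflux t (c +
        t))) \<le> \<Lambda>\<^sup>2"
      if \<tau>: "t1 \<le> \<tau>" "\<tau> \<le> t2" "0 \<le> c + \<tau>" "0 < c + t2" for \<tau> c
    proof -
      have "0 \<le> integral {\<tau>..t2} (\<lambda>t. sqrt (boxint t (c + t)))"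
        using boxint_nonneg \<tau> by (cases "(\<lambda>t. sqrt (boxint t (c + t))) integrable_on {\<tau>..t2}")
          (auto intro!: integral_nonneg simp: not_integrable_integral)
      moreover have "0 \<le> energy t2 (c + t2)"
        unfolding energy_def using t2I
        by (intro integral_nonneg integrable_smean smean_nonneg edens_nonneg) (auto intro!: conts2
            continuous_intros)
      ultimately have "(sqrt (energy t2 (c + t2)) + 2 * sqrt 2 * integral {\<tau>..t2} (\<lambda>t. sqrt (boxint t (c
          + t))))\<^sup>2 \<le> \<Lambda>\<^sup>2"
        unfolding \<Lambda>_def using e2[OF \<tau>(4)] nI[OF \<tau>(1-3)]
        by (intro power_mono add_mono mult_left_mono add_nonneg_nonneg mult_nonneg_nonneg) auto
      then show ?thesis using energy_bound[OF \<tau>(1-3)] by linarith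
    qed
    \<comment> \<open>A function that is not integrable has integral 0 by convention, so the sign
      needs no continuity argument.\<close>
    have fl0: "0 \<le> integral {\<tau>..t2} (\<lambda>t. smean (edens t (c + t)) - smean (eflux t (c + t)))" if "t1 \<le> \<tau>"
        for \<tau> c
    proof (cases "(\<lambda>t. smean (edens t (c + t)) - smean (eflux t (c + t))) integrable_on {\<tau>..t2}")
      case True
      then show ?thesis
      proof (rule integral_nonneg)
        fix t assume "t \<in> {\<tau>..t2}"
        then have "t \<in> {t1..t2}" using that by auto
        then show "0 \<le> smean (edens t (c + t)) - smean (eflux t (c + t))"
          by (auto intro!: smean_mono conts continuous_intros simp: edens_def eflux_def ang2_def
              algebra_simps)
      qed
    qed (simp add: not_integrable_integral)
    have en0: "0 \<le> energy t b" if "t \<in> {t1..t2}" for t b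
      unfolding energy_def using that
      by (intro integral_nonneg integrable_smean smean_nonneg edens_nonneg) (auto intro!: conts2
          continuous_intros)
    \<comment> \<open>The cone of radius b at time t1, with its nonnegative flux dropped. The bound
      does not depend on b, so it reaches the whole slice.\<close>
    have "energy t1 b \<le> \<Lambda>\<^sup>2" if "0 < b" for b
      using bound[of t1 "b - t1"] fl0[of t1 "b - t1"] that t12 by simp
    from nint_bound[OF t1I d this]
    have "normplus s f t1 \<le> ennreal (sqrt ((16 * s\<^sup>2 + 7) * \<Lambda>\<^sup>2))"
      by (intro normplus_le[OF t1I]) auto
    also have "sqrt ((16 * s\<^sup>2 + 7) * \<Lambda>\<^sup>2) = sqrt (16 * s\<^sup>2 + 7) * \<Lambda>"
      using \<Lambda> by (simp add: real_sqrt_mult)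
    finally have 1: "normplus s f t1 \<le> ennreal (sqrt (16 * s\<^sup>2 + 7) * \<Lambda>)" .
    have 2: "(SUP R\<in>{0<..}. enn_sqrt (flux s f R t1 t2)) \<le> ennreal \<Lambda>"
    proof (rule SUP_least)
      fix R :: real assume "R \<in> {0<..}"
      then have R: "0 < R" by simp
      let ?\<tau> = "max t1 (t2 - R)"
      let ?F = "integral {?\<tau>..t2} (\<lambda>t. smean (edens t (R - t2 + t)) - smean (eflux t (R - t2 + t)))"
      have \<tau>I: "?\<tau> \<in> {t1..t2}" using R t12 by auto
      \<comment> \<open>The cone of radius R at time t2, now dropping the energy at its lower end,
        which is either t1 or the vertex.\<close>
      have "?F \<le> \<Lambda>\<^sup>2"
        using bound[of ?\<tau> "R - t2"] en0[OF \<tau>I, of "R - t2 + ?\<tau>"] R t12 \<tau>I by (simp add: max_def split: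
            if_splits)
      moreover have "0 \<le> ?F" by (rule fl0) simp
      ultimately have "ennreal (?F / 2) \<le> ennreal (\<Lambda>\<^sup>2)" by (intro ennreal_leI) simp
      then have "flux s f R t1 t2 \<le> ennreal (\<Lambda>\<^sup>2)" using flux_le[OF R] by (rule order_trans[rotated])
      then have "enn_sqrt (flux s f R t1 t2) \<le> enn_sqrt (ennreal (\<Lambda>\<^sup>2))" by (rule enn_sqrt_mono)
      then show "enn_sqrt (flux s f R t1 t2) \<le> ennreal \<Lambda>" using \<Lambda> by (simp add: enn_sqrt_ennreal)
    qed
    have "normplus s f t1 + (SUP R\<in>{0<..}. enn_sqrt (flux s f R t1 t2)) \<le> ennreal (sqrt (16 * s\<^sup>2 + 7) *
        \<Lambda>) + ennreal \<Lambda>"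
      by (rule add_mono[OF 1 2])
    also have "\<dots> = ennreal ((sqrt (16 * s\<^sup>2 + 7) + 1) * \<Lambda>)"
      using \<Lambda> by (simp add: ennreal_plus[symmetric] distrib_right del: ennreal_plus)
    also have "\<dots> \<le> ennreal (?C * (N + I))"
    proof (rule ennreal_leI)
      have "sqrt 2 * N \<le> 2 * sqrt 2 * N" using N by simp
      then have "\<Lambda> \<le> 2 * sqrt 2 * (N + I)" unfolding \<Lambda>_def by (simp add: algebra_simps)
      then have "(sqrt (16 * s\<^sup>2 + 7) + 1) * \<Lambda> \<le> (sqrt (16 * s\<^sup>2 + 7) + 1) * (2 * sqrt 2 * (N + I))"
        by (intro mult_left_mono) auto
      then show "(sqrt (16 * s\<^sup>2 + 7) + 1) * \<Lambda> \<le> ?C * (N + I)" by (simp add: mult_ac)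
    qed
    also have "\<dots> = ennreal ?C * (normplus s f t2 + ?I)"
      using C N I by (simp add: ennreal_mult ennreal_plus)
    finally show ?thesis .
  qed
qed

section \<open>Pointwise control of the commuting vector fields\<close>

lemma L2norm_le_normplus:
  assumes t: "t \<in> {t1..t2}" and K: "0 \<le> K"
    and g: "\<And>x. x \<noteq> 0 \<Longrightarrow> (g x)\<^sup>2 \<le> K\<^sup>2 * ndensx t x"
  shows "L2norm g \<le> ennreal K * normplus s f t"
proof -
  have m: "(\<lambda>x. ennreal (ndensx t x)) \<in> borel_measurable lborel"
    using ndensx_measurable[OF t] by simp
  have "(\<integral>\<^sup>+ x. ennreal ((g x)\<^sup>2) \<partial>lborel) \<le> (\<integral>\<^sup>+ x. ennreal (K\<^sup>2) * ennreal (ndensx t x) \<partial>lborel)"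
  proof (rule nn_integral_mono_AE, rule eventually_mono[OF AE_lborel_singleton[of 0]])
    fix x :: "real^3" assume "x \<noteq> 0"
    from ennreal_leI[OF g[OF this]] show "ennreal ((g x)\<^sup>2) \<le> ennreal (K\<^sup>2) * ennreal (ndensx t x)"
      by (simp add: ennreal_mult ndensx_nonneg)
  qed
  also have "\<dots> = ennreal (K\<^sup>2) * (\<integral>\<^sup>+ x. ennreal (ndensx t x) \<partial>lborel)"
    by (rule nn_integral_cmult[OF m])
  finally have "L2norm g \<le> enn_sqrt (ennreal (K\<^sup>2) * (\<integral>\<^sup>+ x. ennreal (ndensx t x) \<partial>lborel))"
    unfolding L2norm_def by (rule enn_sqrt_mono)
  also have "\<dots> = ennreal K * normplus s f t"
    unfolding normplus_eq[OF t] by (rule enn_sqrt_scale[OF K])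
  finally show ?thesis .
qed

text \<open>In the null frame, r Z f is a combination of v \<open>Lpsi\<close>, u
  \<open>Lbarpsi\<close>, the two null derivatives without these factors, u \<phi>, r \<phi>, \<phi>
  and angular terms of size at most v r |a|. After multiplication by <u>^(s-1) each is at most the
  root of the density. Counting coefficients gives at most 4, for the boosts; 5 serves for all
  Z.\<close>

lemma Zops_bound:
  assumes t: "t \<in> {t1..t2}" and x: "x \<noteq> 0" and Z: "Z \<in> set Zops"
  shows "(jp (t - norm x) powr (s - 1) * Z f t x)\<^sup>2 \<le> 5\<^sup>2 * ndensx t x"
proof -
  define r where "r = norm x"
  define w where "w = omega x"
  have r: "0 < r" using x by (simp add: r_def)
  have w: "norm w = 1" using norm_omega[OF x] by (simp add: w_def)
  have xr: "x = r *\<^sub>R w" by (simp add: r_def w_def norm_scaleR_omega)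
  have t0: "0 \<le> t" using t t1 by simp
  define u v where "u = t - r" and "v = t + r"
  define p where "p = grad f t x"
  define q where "q = w \<bullet> p"
  define a where "a = p - q *\<^sub>R w"
  define \<phi> where "\<phi> = f t x"
  define \<phi>t where "\<phi>t = dt f t x"
  define X where "X = wt (s - 1) u"
  define D where "D = ndens t r w"
  define k where "k = sqrt X"
  have X: "0 \<le> X" by (simp add: X_def)
  have k: "0 \<le> k" "k\<^sup>2 = X" using X by (auto simp: k_def)
  have V: "wtm t r = (1 + u\<^sup>2) * X" using wt_add[of 1 "s - 1" u] by (simp add: u_def X_def)
  \<comment> \<open>Since |u| \<le> v and s \<ge> 1, the weight <u>^(2s-2) can be raised to
    <v>^(2s-2); this leaves a free factor <v>^2 for the coefficients t and r of the fields.\<close>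
  have W: "(1 + v\<^sup>2) * X \<le> wtp t r"
  proof -
    have "(1 + v\<^sup>2) * X \<le> (1 + v\<^sup>2) * wt (s - 1) v"
      unfolding X_def using s t0 r by (intro mult_left_mono wt_mono) (auto simp: u_def v_def)
    then show ?thesis using wt_add[of 1 "s - 1" v] by (simp add: v_def)
  qed
  have Lpsi: "Lpsi t r w = r * (\<phi>t + q) + \<phi>" and Lbarpsi: "Lbarpsi t r w = r * (\<phi>t - q) - \<phi>"
    by (simp_all add: Lpsi_def Lbarpsi_def xr[symmetric] \<phi>t_def \<phi>_def q_def p_def)
  have an: "(norm a)\<^sup>2 = ang2 t r w"
    unfolding a_def q_def by (rule ang2_norm[OF w]) (simp add: p_def flip: xr)
  have Dterms: "X * y\<^sup>2 \<le> D"
    if "X * y\<^sup>2 \<le> (1 + v\<^sup>2) * X * (Lpsi t r w)\<^sup>2 \<or> X * y\<^sup>2 \<le> (1 + v\<^sup>2) * X * (r\<^sup>2 * (norm a)\<^sup>2)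
      \<or> X * y\<^sup>2 \<le> (1 + u\<^sup>2) * X * (Lbarpsi t r w)\<^sup>2 \<or> X * y\<^sup>2 \<le> (1 + u\<^sup>2) * X * \<phi>\<^sup>2 \<or> X * y\<^sup>2 \<le> X * (r *
          \<phi>)\<^sup>2" for y
  proof -
    have D: "D = wtp t r * (Lpsi t r w)\<^sup>2 + wtp t r * (r\<^sup>2 * (norm a)\<^sup>2) + (1 + u\<^sup>2) * X * (Lbarpsi t r
        w)\<^sup>2 + (1 + u\<^sup>2) * X * \<phi>\<^sup>2 + X * (r * \<phi>)\<^sup>2"
      by (simp add: D_def ndens_def an V[folded u_def] X_def \<phi>_def distrib_left flip: u_def xr)
    have "(1 + v\<^sup>2) * X * (Lpsi t r w)\<^sup>2 \<le> wtp t r * (Lpsi t r w)\<^sup>2" "(1 + v\<^sup>2) * X * (r\<^sup>2 * (norm a)\<^sup>2)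
        \<le> wtp t r * (r\<^sup>2 * (norm a)\<^sup>2)"
      using W by (intro mult_right_mono; simp)+
    moreover have "0 \<le> wtp t r * (Lpsi t r w)\<^sup>2" "0 \<le> wtp t r * (r\<^sup>2 * (norm a)\<^sup>2)"
      "0 \<le> (1 + u\<^sup>2) * X * (Lbarpsi t r w)\<^sup>2" "0 \<le> (1 + u\<^sup>2) * X * \<phi>\<^sup>2" "0 \<le> X * (r * \<phi>)\<^sup>2"
      using X by (auto intro!: mult_nonneg_nonneg)
    ultimately show ?thesis using that unfolding D by linarith
  qed
  have D0: "0 \<le> D" by (simp add: D_def ndens_nonneg)
  define \<delta> where "\<delta> = sqrt D"
  have \<delta>: "0 \<le> \<delta>" "\<delta>\<^sup>2 = D" using D0 by (auto simp: \<delta>_def)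
  have abs: "k * \<bar>y\<bar> \<le> \<delta>" if "X * y\<^sup>2 \<le> D" for y
  proof -
    have "(k * \<bar>y\<bar>)\<^sup>2 \<le> \<delta>\<^sup>2" using that k \<delta> by (simp add: power_mult_distrib)
    then show ?thesis using \<delta>(1) by (rule power2_le_imp_le)
  qed
  have XX: "X * y\<^sup>2 \<le> (1 + z\<^sup>2) * X * y\<^sup>2" "X * (z * y)\<^sup>2 \<le> (1 + z\<^sup>2) * X * y\<^sup>2" for y z
    using X by (auto simp: algebra_simps power_mult_distrib)
  have B1: "k * \<bar>Lpsi t r w\<bar> \<le> \<delta>" "k * \<bar>v * Lpsi t r w\<bar> \<le> \<delta>" "k * \<bar>Lbarpsi t r w\<bar> \<le> \<delta>" "k * \<bar>u * Lbarpsi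
      t r w\<bar> \<le> \<delta>"
    "k * \<bar>\<phi>\<bar> \<le> \<delta>" "k * \<bar>u * \<phi>\<bar> \<le> \<delta>" "k * \<bar>r * \<phi>\<bar> \<le> \<delta>"
    using XX by (auto intro!: abs Dterms)
  have B2: "k * \<bar>r * norm a\<bar> \<le> \<delta>" "k * \<bar>v * (r * norm a)\<bar> \<le> \<delta>"
    using XX(1)[of "r * norm a" v] XX(2)[of v "r * norm a"] by (auto intro!: abs Dterms simp:
        power_mult_distrib)
  have wi: "\<bar>w $ i\<bar> \<le> 1" for i using component_le_norm_cart[of w i] w by simp
  have ai: "\<bar>a $ i\<bar> \<le> norm a" for i by (rule component_le_norm_cart)
  have pi: "p $ i = q * w $ i + a $ i" for i by (simp add: a_def)
  have kr: "k * \<bar>r * a $ i\<bar> \<le> \<delta>" for i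
    using order_trans[OF mult_left_mono[OF _ k(1)] B2(1)] ai[of i] r by (simp add: abs_mult)
  have kt: "k * \<bar>c * (r * a $ i)\<bar> \<le> \<delta>" if "\<bar>c\<bar> \<le> v" for c i
  proof (rule order_trans[OF mult_left_mono[OF _ k(1)] B2(2)])
    show "\<bar>c * (r * a $ i)\<bar> \<le> \<bar>v * (r * norm a)\<bar>"
      unfolding abs_mult using that ai[of i] by (intro mult_mono) auto
  qed
  have scale: "k * \<bar>w $ i * y\<bar> \<le> M" if "k * \<bar>y\<bar> \<le> M" for i y M
  proof -
    have "k * \<bar>w $ i * y\<bar> \<le> k * \<bar>y\<bar>"
      unfolding abs_mult using wi[of i] k by (intro mult_left_mono mult_left_le_one_le) auto
    then show ?thesis using that by linarith
  qed
  have tri: "k * \<bar>y + z\<bar> \<le> M + N" if "k * \<bar>y\<bar> \<le> M" "k * \<bar>z\<bar> \<le> N" for y z M N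
    using mult_left_mono[OF abs_triangle_ineq[of y z] k(1)] that by (simp add: distrib_left)
  have neg: "k * \<bar>- y\<bar> \<le> M" if "k * \<bar>y\<bar> \<le> M" for y M using that by simp
  have half: "k * \<bar>y / 2\<bar> \<le> \<delta> / 2" if "k * \<bar>y\<bar> \<le> \<delta>" for y using that by simp
  have rt: "r * \<phi>t = Lpsi t r w / 2 + Lbarpsi t r w / 2" by (simp add: Lpsi Lbarpsi field_simps)
  have rq: "r * q = Lpsi t r w / 2 + - (Lbarpsi t r w / 2) + - \<phi>" by (simp add: Lpsi Lbarpsi field_simps)
  have T: "k * \<bar>r * \<phi>t\<bar> \<le> \<delta>"
    unfolding rt using tri[OF half[OF B1(1)] half[OF B1(3)]] by simp
  have Xi: "k * \<bar>r * p $ i\<bar> \<le> 5 * \<delta>" for i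
  proof -
    have e: "r * p $ i = w $ i * (Lpsi t r w / 2 + - (Lbarpsi t r w / 2) + - \<phi>) + r * a $ i"
      unfolding rq[symmetric] pi by (simp add: algebra_simps)
    show ?thesis
      unfolding e using tri[OF scale[OF tri[OF tri[OF half[OF B1(1)] neg[OF half[OF B1(3)]]] neg[OF
          B1(5)]], of i] kr[of i]] \<delta>(1) by simp
  qed
  have Rot: "k * \<bar>r * (x $ i * p $ j - x $ j * p $ i)\<bar> \<le> 5 * \<delta>" for i j
  proof -
    have e: "r * (x $ i * p $ j - x $ j * p $ i) = w $ i * (r * (r * a $ j)) + - (w $ j * (r * (r * a $
        i)))"
      unfolding xr pi by (simp add: algebra_simps)
    have rv: "\<bar>r\<bar> \<le> v" using r t0 by (simp add: v_def)
    show ?thesis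
      unfolding e using tri[OF scale[OF kt[OF rv, of j], of i] neg[OF scale[OF kt[OF rv, of i], of j]]]
          \<delta>(1) by simp
  qed
  have Bo: "k * \<bar>r * (x $ i * \<phi>t + t * p $ i)\<bar> \<le> 5 * \<delta>" for i
  proof -
    \<comment> \<open>The radial part of a boost pairs v with \<open>Lpsi\<close> and u with
      \<open>Lbarpsi\<close>. The leftover t \<phi> is split as u \<phi> + r \<phi>, because <t> is
      not controlled by <u> alone.\<close>
    have "w $ i * (r * (r * \<phi>t) + t * (r * q)) = w $ i * ((v * Lpsi t r w / 2 + - (u * Lbarpsi t r w /
        2)) + (- (u * \<phi>) + - (r * \<phi>)))"
      unfolding rt rq by (simp add: u_def v_def field_simps)
    then have e: "r * (x $ i * \<phi>t + t * p $ i) = w $ i * ((v * Lpsi t r w / 2 + - (u * Lbarpsi t r w /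
        2)) + (- (u * \<phi>) + - (r * \<phi>))) + t * (r * a $ i)"
      unfolding pi by (simp add: xr algebra_simps)
    have tv: "\<bar>t\<bar> \<le> v" using r t0 by (simp add: v_def)
    show ?thesis
      unfolding e using tri[OF scale[OF tri[OF tri[OF half[OF B1(2)] neg[OF half[OF B1(4)]]] tri[OF
          neg[OF B1(6)] neg[OF B1(7)]]], of i] kt[OF tv, of i]] \<delta>(1)
      by simp
  qed
  have Sc: "k * \<bar>r * (t * \<phi>t + x \<bullet> p)\<bar> \<le> 5 * \<delta>"
  proof -
    have "x \<bullet> p = r * q" by (simp add: xr q_def)
    then have "r * (t * \<phi>t + x \<bullet> p) = t * (r * \<phi>t) + r * (r * q)" by (simp add: algebra_simps)
    also have "\<dots> = (v * Lpsi t r w / 2 + u * Lbarpsi t r w / 2) + - (r * \<phi>)"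
      unfolding rt rq by (simp add: u_def v_def field_simps)
    finally show ?thesis using tri[OF tri[OF half[OF B1(2)] half[OF B1(4)]] neg[OF B1(7)]] \<delta>(1) by simp
  qed
  have "k * \<bar>r * Z f t x\<bar> \<le> 5 * \<delta>"
  proof -
    have pn: "dx i f t x = p $ i" for i by (simp add: p_def)
    have cases: "Z = id \<or> Z = dt \<or> (\<exists>i. Z = dx i) \<or> (\<exists>i j. Z = rot i j) \<or> (\<exists>i. Z = boost i) \<or> Z = scal"
      using Z unfolding Zops_def by auto
    have "k * \<bar>r * id f t x\<bar> \<le> 5 * \<delta>" using B1(7) \<delta>(1) by (simp add: \<phi>_def)
    moreover have "k * \<bar>r * dt f t x\<bar> \<le> 5 * \<delta>" using T \<delta>(1) by (simp add: \<phi>t_def)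
    moreover have "k * \<bar>r * dx i f t x\<bar> \<le> 5 * \<delta>" for i unfolding pn by (rule Xi)
    moreover have "k * \<bar>r * rot i j f t x\<bar> \<le> 5 * \<delta>" for i j unfolding rot_def pn by (rule Rot)
    moreover have "k * \<bar>r * boost i f t x\<bar> \<le> 5 * \<delta>" for i unfolding boost_def pn \<phi>t_def[symmetric] by
        (rule Bo)
    moreover have "k * \<bar>r * scal f t x\<bar> \<le> 5 * \<delta>"
      unfolding scal_def pn \<phi>t_def[symmetric] using Sc by (simp add: inner_vec_def)
    ultimately show ?thesis using cases by auto
  qed
  then have "(k * \<bar>r * Z f t x\<bar>)\<^sup>2 \<le> (5 * \<delta>)\<^sup>2" using k by (intro power_mono) auto
  then have "X * (r * Z f t x)\<^sup>2 \<le> 5\<^sup>2 * D" by (simp add: power_mult_distrib k \<delta>)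
  moreover have "(jp (t - norm x) powr (s - 1))\<^sup>2 = X"
    by (simp add: jp_powr X_def u_def r_def power2_eq_square flip: wt_add)
  ultimately show ?thesis
    using r by (simp add: ndensx_def power_mult_distrib D_def r_def[symmetric] w_def[symmetric] field_simps)
qed

lemma normZ_le_normplus:
  assumes t: "t \<in> {t1..t2}"
  shows "normZ s f t \<le> ennreal 60 * normplus s f t"
proof -
  have "normZ s f t \<le> sum_list (map (\<lambda>Z. ennreal 5 * normplus s f t) Zops)"
    unfolding normZ_def
    by (intro sum_list_mono L2norm_le_normplus[OF t] Zops_bound[OF t]) auto
  also have "\<dots> = ennreal 60 * normplus s f t"
  proof -
    \<comment> \<open>Twelve operators, each with constant 5, give 60.\<close>
    have "length Zops = 12" by (simp add: Zops_def)
    then have "sum_list (map (\<lambda>Z. ennreal 5 * normplus s f t) Zops) = of_nat 12 * (ennreal 5 * normplus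
        s f t)"
      by (simp add: map_replicate_const sum_list_replicate)
    then show ?thesis by (simp add: mult.assoc[symmetric])
  qed
  finally show ?thesis .
qed

end

theorem theorem1p3:
  fixes s :: real
  assumes "s \<ge> 1"
  shows "\<exists>C::real.
    (\<forall>t1 t2 (\<phi>::stfun) U. 0 \<le> t1 \<longrightarrow> t1 \<le> t2 \<longrightarrow> open U \<longrightarrow>
        {t1..t2} \<times> UNIV \<subseteq> U \<longrightarrow> smooth_on U \<phi> \<longrightarrow> decay s \<phi> t1 \<longrightarrow>
        normplus s \<phi> t1 + (SUP R\<in>{0<..}. enn_sqrt (flux s \<phi> R t1 t2))
          \<le> ennreal C * (normplus s \<phi> t2 +
               (\<integral>\<^sup>+ t\<in>{t1..t2}. L2norm (\<lambda>x. jp (t + norm x) powr s * box \<phi> t x) \<partial>lborel)))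
  \<and> (\<forall>t (\<phi>::stfun) U. 0 \<le> t \<longrightarrow> open U \<longrightarrow> {t} \<times> UNIV \<subseteq> U \<longrightarrow>
        smooth_on U \<phi> \<longrightarrow> decay s \<phi> t \<longrightarrow>
        normZ s \<phi> t \<le> ennreal C * normplus s \<phi> t)"
proof -
  let ?C = "max (2 * sqrt 2 * (sqrt (16 * s\<^sup>2 + 7) + 1)) 60"
  have 1: "normplus s \<phi> t1 + (SUP R\<in>{0<..}. enn_sqrt (flux s \<phi> R t1 t2))
      \<le> ennreal ?C * (normplus s \<phi> t2 +
           (\<integral>\<^sup>+ t\<in>{t1..t2}. L2norm (\<lambda>x. jp (t + norm x) powr s * box \<phi> t x) \<partial>lborel))"
    if "0 \<le> t1" "t1 \<le> t2" "open U" "{t1..t2} \<times> UNIV \<subseteq> U" "smooth_on U \<phi>" "decay s \<phi> t1" for t1 t2 \<phi> U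
  proof -
    interpret smooth_wave s \<phi> U t1 t2 by unfold_locales (use assms that in auto)
    show ?thesis
      by (rule order_trans[OF weighted_estimate[OF that(6)]]) (intro mult_right_mono ennreal_leI, auto)
  qed
  have 2: "normZ s \<phi> t \<le> ennreal ?C * normplus s \<phi> t"
    if "0 \<le> t" "open U" "{t} \<times> UNIV \<subseteq> U" "smooth_on U \<phi>" for t \<phi> U
  proof -
    \<comment> \<open>A slab of zero height: only a neighbourhood of the slice is available
      here.\<close>
    interpret smooth_wave s \<phi> U t t by unfold_locales (use assms that in auto)
    show ?thesis
      by (rule order_trans[OF normZ_le_normplus]) (auto intro!: mult_right_mono ennreal_leI)
  qed
  show ?thesis using 1 2 by blast
qed

end
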